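(* Let $\omega>0$, suppose $V\in L^1((0,\omega);dx)$ (complex-valued), let $\theta\in[0,2\pi)$, and $z\in\mathbb{C}\setminus\operatorname{spec}(H^{(0)}_\theta)$, $z\neq0$. Then, with $K_\theta(z)$, $\Delta(z)$, $\psi_\pm$, $\varphi_\pm$ as defined in the context, $$\begin{aligned} \det(I-K_\theta(z))&=\frac{\Delta(z)-\cos(\theta)}{\cos(z^{1/2}\omega)-\cos(\theta)}\\ &=\bigg[1+\frac{i}{2z^{1/2}}\frac{e^{i\theta}e^{-iz^{1/2}\omega}}{e^{i\theta}e^{-iz^{1/2}\omega}-1}\int_0^\omega dx\,e^{-iz^{1/2}x}V(x)\psi_+(z,x)\bigg]\\ &\quad\times\bigg[1+\frac{i}{2z^{1/2}}\frac{1}{e^{-i\theta}e^{-iz^{1/2}\omega}-1}\int_0^\omega dx\,e^{iz^{1/2}x}V(x)\psi_-(z,x)\bigg]\\ &\quad+\frac{1}{4z}\frac{e^{i\theta}e^{-iz^{1/2}\omega}}{\big[e^{i\theta}e^{-iz^{1/2}\omega}-1\big]\big[e^{-i\theta}e^{-iz^{1/2}\omega}-1\big]}\int_0^\omega dx\,e^{iz^{1/2}x}V(x)\psi_+(z,x)\int_0^\omega dx\,e^{-iz^{1/2}x}V(x)\psi_-(z,x)\\ &=\bigg[1+\frac{i}{2z^{1/2}}\frac{1}{e^{i\theta}e^{-iz^{1/2}\omega}-1}\int_0^\omega dx\,e^{-iz^{1/2}x}V(x)\varphi_+(z,x)\bigg]\\ &\quad\times\bigg[1+\frac{i}{2z^{1/2}}\frac{e^{-i\theta}e^{-iz^{1/2}\omega}}{e^{-i\theta}e^{-iz^{1/2}\omega}-1}\int_0^\omega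 dx\,e^{iz^{1/2}x}V(x)\varphi_-(z,x)\bigg]\\ &\quad+\frac{1}{4z}\frac{e^{-i\theta}e^{-iz^{1/2}\omega}}{\big[e^{i\theta}e^{-iz^{1/2}\omega}-1\big]\big[e^{-i\theta}e^{-iz^{1/2}\omega}-1\big]}\int_0^\omega dx\,e^{iz^{1/2}x}V(x)\varphi_+(z,x)\int_0^\omega dx\,e^{-iz^{1/2}x}V(x)\varphi_-(z,x). \end{aligned}$$
   Context: $z^{1/2}$ is a square root of $z$ with $\operatorname{Im}(z^{1/2})\ge0$. $H^{(0)}_\theta$ is the self-adjoint operator $H^{(0)}_\theta f=-f''$ in $L^2((0,\omega);dx)$ with domain $\{g\in L^2((0,\omega);dx): g,g'\in AC([0,\omega]),\ g(\omega)=e^{i\theta}g(0),\ g'(\omega)=e^{i\theta}g'(0),\ g''\in L^2((0,\omega);dx)\}$; $\operatorname{spec}$ denotes the spectrum. The integral kernel (Green's function) of $(H^{(0)}_\theta-z)^{-1}$ is $$G^{(0)}_\theta(z,x,x')=\frac{i}{2z^{1/2}}\bigg[e^{iz^{1/2}|x-x'|}+\frac{e^{iz^{1/2}(x-x')}}{e^{i\theta}e^{-iz^{1/2}\omega}-1}+\frac{e^{-iz^{1/2}(x-x')}}{e^{-i\theta}e^{-iz^{1/2}\omega}-1}\bigg].$$ Factor $V=uv$ with $v(x)=|V(x)|^{1/2}$, $u(x)=|V(x)|^{1/2}\exp(i\arg(V(x)))$. $K_\theta(z)=-\overline{u(H^{(0)}_\theta-z)^{-1}v}$ (closure) is the integral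 operator in $L^2((0,\omega);dx)$ with kernel $-u(x)G^{(0)}_\theta(z,x,x')v(x')$; it is trace class and $\det(I-K_\theta(z))$ is the Fredholm determinant. Let $c(z,\cdot)$, $s(z,\cdot)$ be the solutions of $-\psi''+V\psi=z\psi$ on $[0,\omega]$ with $c(z,0)=1=s'(z,0)$, $c'(z,0)=0=s(z,0)$. The Floquet discriminant is $\Delta(z)=[c(z,\omega)+s'(z,\omega)]/2$. With $g^{(0)}(z,x,x')=z^{-1/2}\sin(z^{1/2}(x-x'))$, the functions $\varphi_\pm(z,\cdot)$, $\psi_\pm(z,\cdot)$ on $[0,\omega]$ are the solutions of the Volterra integral equations $$\varphi_\pm(z,x)=e^{\pm iz^{1/2}x}+\int_0^x dx'\,g^{(0)}(z,x,x')V(x')\varphi_\pm(z,x'),\qquad \psi_\pm(z,x)=e^{\pm iz^{1/2}x}-\int_x^\omega dx'\,g^{(0)}(z,x,x')V(x')\psi_\pm(z,x').$$ *)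

theory Defs
  imports "HOL-Analysis.Analysis" "HOL-Combinatorics.Permutations"
begin

section \<open>The Hilbert space of square integrable functions on an interval\<close>

text \<open>
  Elements of the Hilbert space over \<open>(0,\<omega>)\<close> are represented by square integrable functions, and
  equality in it by equality almost everywhere. The values of a representative outside \<open>(0,\<omega>)\<close>
  are irrelevant.
\<close>

abbreviation Leb :: "real \<Rightarrow> real measure" where
  "Leb \<omega> \<equiv> lebesgue_on {0<..<\<omega>}"

definition L2 :: "real \<Rightarrow> (real \<Rightarrow> complex) set" where
  "L2 \<omega> = {f \<in> borel_measurable (Leb \<omega>).
             integrable (Leb \<omega>) (\<lambda>x. (norm (f x))\<^sup>2)}"

definition l2_inner :: "real \<Rightarrow> (real \<Rightarrow> complex) \<Rightarrow> (real \<Rightarrow> complex) \<Rightarrow> complex" where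
  "l2_inner \<omega> f g = (LINT x|Leb \<omega>. cnj (f x) * g x)"

definition l2_norm :: "real \<Rightarrow> (real \<Rightarrow> complex) \<Rightarrow> real" where
  "l2_norm \<omega> f = sqrt (LINT x|Leb \<omega>. (norm (f x))\<^sup>2)"

definition orthonormal_basis :: "real \<Rightarrow> (nat \<Rightarrow> real \<Rightarrow> complex) \<Rightarrow> bool" where
  "orthonormal_basis \<omega> e \<longleftrightarrow>
     (\<forall>i. e i \<in> L2 \<omega>) \<and>
     (\<forall>i j. l2_inner \<omega> (e i) (e j) = (if i = j then 1 else 0)) \<and>
     (\<forall>f\<in>L2 \<omega>. (\<forall>i. l2_inner \<omega> (e i) f = 0) \<longrightarrow> (AE x in Leb \<omega>. f x = 0))"

section \<open>Linear operators, given by their graphs\<close>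

text \<open>
  An operator is the set of pairs \<open>(f, T f)\<close>, where both components range over all their
  representatives. With this encoding the product \<open>S T\<close> of operators, with its natural domain, is
  the relational composition \<open>T O S\<close>, and the closure of an operator is the closure of its graph.
\<close>

type_synonym operator = "((real \<Rightarrow> complex) \<times> (real \<Rightarrow> complex)) set"

definition bounded_operator :: "real \<Rightarrow> operator \<Rightarrow> bool" where
  "bounded_operator \<omega> T \<longleftrightarrow>
     T \<subseteq> L2 \<omega> \<times> L2 \<omega> \<and>
     (\<forall>f\<in>L2 \<omega>. \<exists>h. (f, h) \<in> T) \<and>
     (\<forall>f h f' h' a b. (f, h) \<in> T \<longrightarrow> (f', h') \<in> T \<longrightarrow>
        ((\<lambda>x. a * f x + b * f' x), (\<lambda>x. a * h x + b * h' x)) \<in> T) \<and>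
     (\<exists>C. \<forall>(f, h)\<in>T. l2_norm \<omega> h \<le> C * l2_norm \<omega> f)"

definition op_closure :: "real \<Rightarrow> operator \<Rightarrow> operator" where
  "op_closure \<omega> T = {(f, h). f \<in> L2 \<omega> \<and> h \<in> L2 \<omega> \<and>
     (\<exists>F H. (\<forall>n::nat. (F n, H n) \<in> T) \<and>
        (\<lambda>n. l2_norm \<omega> (\<lambda>x. F n x - f x)) \<longlonglongrightarrow> 0 \<and>
        (\<lambda>n. l2_norm \<omega> (\<lambda>x. H n x - h x)) \<longlonglongrightarrow> 0)}"

definition op_uminus :: "operator \<Rightarrow> operator" where
  "op_uminus T = {(f, (\<lambda>x. - h x)) | f h. (f, h) \<in> T}"

text \<open>The maximal operator of multiplication by \<open>m\<close>.\<close>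
definition mult_op :: "real \<Rightarrow> (real \<Rightarrow> complex) \<Rightarrow> operator" where
  "mult_op \<omega> m = {(f, h). f \<in> L2 \<omega> \<and> h \<in> L2 \<omega> \<and> (AE x in Leb \<omega>. h x = m x * f x)}"

text \<open>
  \<open>resolvent T z\<close> is the inverse relation of \<open>T - z\<close>. It is a bounded operator (everywhere
  defined and, by the norm bound, single-valued up to equality almost everywhere) iff \<open>T - z\<close> maps
  the domain of \<open>T\<close> bijectively onto the Hilbert space with bounded inverse.
\<close>
definition resolvent :: "operator \<Rightarrow> complex \<Rightarrow> operator" where
  "resolvent T z = {((\<lambda>x. h x - z * f x), f) | f h. (f, h) \<in> T}"

definition op_spectrum :: "real \<Rightarrow> operator \<Rightarrow> complex set" where
  "op_spectrum \<omega> T = {z. \<not> bounded_operator \<omega> (resolvent T z)}"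

section \<open>Trace class operators and the Fredholm determinant\<close>

text \<open>The value \<open>T f\<close>; for a bounded operator it is unique up to equality almost everywhere.\<close>
definition op_app :: "operator \<Rightarrow> (real \<Rightarrow> complex) \<Rightarrow> (real \<Rightarrow> complex)" where
  "op_app T f = (SOME h. (f, h) \<in> T)"

definition trace_class :: "real \<Rightarrow> operator \<Rightarrow> bool" where
  "trace_class \<omega> T \<longleftrightarrow>
     bounded_operator \<omega> T \<and>
     (\<forall>d e. orthonormal_basis \<omega> d \<longrightarrow> orthonormal_basis \<omega> e \<longrightarrow>
        summable (\<lambda>n. norm (l2_inner \<omega> (d n) (op_app T (e n)))))"

text \<open>
  The determinant of the finite matrix \<open>(A i j)\<close> with \<open>i, j \<in> S\<close>, by the Leibniz formula.
\<close>
definition minor_det :: "(nat \<Rightarrow> nat \<Rightarrow> complex) \<Rightarrow> nat set \<Rightarrow> complex" where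
  "minor_det A S = (\<Sum>p | p permutes S. of_int (sign p) * (\<Prod>i\<in>S. A i (p i)))"

text \<open>
  The trace of the \<open>n\<close>-th exterior power of \<open>T\<close>, computed in the orthonormal basis of the exterior
  power of the Hilbert space that consists of the vectors
  \<open>e i\<^sub>1 \<and> \<dots> \<and> e i\<^sub>n\<close> with \<open>i\<^sub>1 < \<dots> < i\<^sub>n\<close>.
  These are indexed by the sets \<open>S\<close> of cardinality \<open>n\<close>; the corresponding diagonal entry of the
  exterior power of \<open>T\<close> is the determinant of the entries \<open>\<langle>e i, T (e j)\<rangle>\<close> with \<open>i, j \<in> S\<close>.
\<close>
definition exterior_power_trace ::
  "real \<Rightarrow> (nat \<Rightarrow> real \<Rightarrow> complex) \<Rightarrow> operator \<Rightarrow> nat \<Rightarrow> complex" where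
  "exterior_power_trace \<omega> e T n =
     (\<Sum>\<^sub>\<infinity>S\<in>{S. finite S \<and> card S = n}. minor_det (\<lambda>i j. l2_inner \<omega> (e i) (op_app T (e j))) S)"

text \<open>
  \<open>has_fredholm_det \<omega> T d\<close> states that \<open>T\<close> is of trace class and that \<open>d = det (I - T)\<close>, the
  determinant being the alternating sum of the traces of the exterior powers of \<open>T\<close>. As these
  traces do not depend on the orthonormal basis, the formula is required for every one.
\<close>
definition has_fredholm_det :: "real \<Rightarrow> operator \<Rightarrow> complex \<Rightarrow> bool" where
  "has_fredholm_det \<omega> T d \<longleftrightarrow>
     trace_class \<omega> T \<and>
     (\<forall>e. orthonormal_basis \<omega> e \<longrightarrow> (\<lambda>n. (-1) ^ n * exterior_power_trace \<omega> e T n) sums d)"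

section \<open>Schroedinger operators on an interval\<close>

definition abs_continuous_on :: "real \<Rightarrow> real \<Rightarrow> (real \<Rightarrow> complex) \<Rightarrow> bool" where
  "abs_continuous_on s t f \<longleftrightarrow>
     (\<forall>\<epsilon>>0. \<exists>\<delta>>0. \<forall>(n::nat) a b.
        (\<forall>i<n. s \<le> a i \<and> a i \<le> b i \<and> b i \<le> t) \<longrightarrow>
        disjoint_family_on (\<lambda>i. {a i<..<b i}) {..<n} \<longrightarrow>
        (\<Sum>i<n. b i - a i) < \<delta> \<longrightarrow>
        (\<Sum>i<n. norm (f (b i) - f (a i))) < \<epsilon>)"

text \<open>
  The function \<open>g'\<close> is the derivative of \<open>g\<close> on \<open>[0,\<omega>]\<close>, one-sided at the endpoints, and both are
  absolutely continuous.
\<close>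
definition ac_derivative_on :: "real \<Rightarrow> (real \<Rightarrow> complex) \<Rightarrow> (real \<Rightarrow> complex) \<Rightarrow> bool" where
  "ac_derivative_on \<omega> g g' \<longleftrightarrow>
     abs_continuous_on 0 \<omega> g \<and> abs_continuous_on 0 \<omega> g' \<and>
     (\<forall>x\<in>{0..\<omega>}. (g has_vector_derivative g' x) (at x within {0..\<omega>}))"

text \<open>
  The operator \<open>f \<mapsto> -f''\<close> with the boundary conditions \<open>g(\<omega>) = e\<^sup>i\<^sup>\<theta> g(0)\<close> and
  \<open>g'(\<omega>) = e\<^sup>i\<^sup>\<theta> g'(0)\<close> on the absolutely continuous representative \<open>g\<close> of \<open>f\<close>.
\<close>
definition H0 :: "real \<Rightarrow> real \<Rightarrow> operator" where
  "H0 \<omega> \<theta> = {(f, h). f \<in> L2 \<omega> \<and> h \<in> L2 \<omega> \<and>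
     (\<exists>g g'. ac_derivative_on \<omega> g g' \<and>
        g \<omega> = exp (\<i> * of_real \<theta>) * g 0 \<and>
        g' \<omega> = exp (\<i> * of_real \<theta>) * g' 0 \<and>
        (AE x in Leb \<omega>. f x = g x) \<and>
        (AE x in Leb \<omega>. (g' has_vector_derivative - h x) (at x)))}"

definition v_factor :: "(real \<Rightarrow> complex) \<Rightarrow> real \<Rightarrow> complex" where
  "v_factor V x = of_real (sqrt (norm (V x)))"

definition u_factor :: "(real \<Rightarrow> complex) \<Rightarrow> real \<Rightarrow> complex" where
  "u_factor V x = of_real (sqrt (norm (V x))) * exp (\<i> * of_real (Arg (V x)))"

text \<open>The Birman-Schwinger operator: minus the closure of \<open>u (H\<^sub>0 - z)\<^sup>-\<^sup>1 v\<close>.\<close>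
definition K_op :: "real \<Rightarrow> real \<Rightarrow> (real \<Rightarrow> complex) \<Rightarrow> complex \<Rightarrow> operator" where
  "K_op \<omega> \<theta> V z = op_uminus (op_closure \<omega>
     (mult_op \<omega> (v_factor V) O resolvent (H0 \<omega> \<theta>) z O mult_op \<omega> (u_factor V)))"

text \<open>
  \<open>\<psi>\<close>, with derivative \<open>\<psi>'\<close>, solves \<open>-\<psi>'' + V \<psi> = z \<psi>\<close> on \<open>[0,\<omega>]\<close> in the sense of integrable
  potentials, that is, almost everywhere with \<open>\<psi>\<close> and \<open>\<psi>'\<close> absolutely continuous.
\<close>
definition schroedinger_solution ::
  "real \<Rightarrow> (real \<Rightarrow> complex) \<Rightarrow> complex \<Rightarrow> (real \<Rightarrow> complex) \<Rightarrow> (real \<Rightarrow> complex) \<Rightarrow> bool" where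
  "schroedinger_solution \<omega> V z \<psi> \<psi>' \<longleftrightarrow>
     ac_derivative_on \<omega> \<psi> \<psi>' \<and>
     (AE x in Leb \<omega>.
        \<exists>\<psi>''. (\<psi>' has_vector_derivative \<psi>'') (at x) \<and> - \<psi>'' + V x * \<psi> x = z * \<psi> x)"

text \<open>
  In the following, \<open>r\<close> is the chosen square root of \<open>z\<close> and \<open>\<kappa>\<close> is \<open>\<i> r\<close> or \<open>-\<i> r\<close>. The
  integrability condition makes the Lebesgue integrals of the equations meaningful.
\<close>
definition free_kernel :: "complex \<Rightarrow> real \<Rightarrow> real \<Rightarrow> complex" where
  "free_kernel r x x' = sin (r * of_real (x - x')) / r"

definition volterra_forward ::
  "real \<Rightarrow> (real \<Rightarrow> complex) \<Rightarrow> complex \<Rightarrow> complex \<Rightarrow> (real \<Rightarrow> complex) \<Rightarrow> bool" where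
  "volterra_forward \<omega> V r \<kappa> \<phi> \<longleftrightarrow>
     integrable (Leb \<omega>) (\<lambda>x. V x * \<phi> x) \<and>
     (\<forall>x\<in>{0..\<omega>}. \<phi> x = exp (\<kappa> * of_real x)
        + (LINT x'|lebesgue_on {0<..<x}. free_kernel r x x' * V x' * \<phi> x'))"

definition volterra_backward ::
  "real \<Rightarrow> (real \<Rightarrow> complex) \<Rightarrow> complex \<Rightarrow> complex \<Rightarrow> (real \<Rightarrow> complex) \<Rightarrow> bool" where
  "volterra_backward \<omega> V r \<kappa> \<psi> \<longleftrightarrow>
     integrable (Leb \<omega>) (\<lambda>x. V x * \<psi> x) \<and>
     (\<forall>x\<in>{0..\<omega>}. \<psi> x = exp (\<kappa> * of_real x)
        - (LINT x'|lebesgue_on {x<..<\<omega>}. free_kernel r x x' * V x' * \<psi> x'))"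

end

theory Submission
  imports Defs "Jordan_Normal_Form.Determinant"
begin

text \<open>
  The Green's function is a kernel of rank two minus the Volterra kernel \<open>free_kernel\<close>. Freezing
  it on a uniform grid of \<open>m\<close> cells approximates \<open>K\<close> by operators of finite rank. Sylvester's
  identity turns the determinant of such an operator into that of an \<open>m\<close> by \<open>m\<close> matrix which is
  unit lower triangular plus a matrix of rank two, hence into a determinant of size two. Its entries
  involve the solution of a discretised Volterra equation and converge to integrals of \<open>\<phi>\<^sub>\<plusminus>\<close>.
  On the other side, a factorisation of the grid operators with uniformly bounded Hilbert--Schmidt
  norms and Hadamard's inequality control the exterior traces uniformly in \<open>m\<close>, in an arbitrary
  orthonormal basis, so that the limit may be taken termwise.

  The other formulas are algebra: variation of constants expresses \<open>c\<close>, \<open>s\<close> and \<open>\<psi>\<^sub>\<plusminus>\<close> through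
  \<open>\<phi>\<^sub>\<plusminus>\<close>, and the constancy of the Wronskian of \<open>c\<close> and \<open>s\<close> relates the four moments of
  \<open>\<phi>\<^sub>\<plusminus>\<close> that occur.
\<close>

section \<open>Determinants of finite matrices\<close>

text \<open>Trace class and determinant are demanded in every orthonormal basis, where the entries
  of \<open>K\<close> are known only through square sums. Hadamard's inequality for the matrix of
  \<open>K\<close> itself is too weak: the row norms of a trace class matrix need not be summable,
  as a rank one matrix with a square summable but not summable left vector shows. For a product, a
  minor over \<open>S\<close> is at most a product over \<open>S\<close> of row norms of the left
  factor times column norms of the right one, up to constants, and by Cauchy--Schwarz these are
  summable when both factors are Hilbert--Schmidt. Such factors exist because the Green's function,
  in spite of its kink on the diagonal, is Lipschitz: its rows on a grid of \<open>m\<close> cells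
  differ by increments of order \<open>1 / m\<close>. What remains is decay in the basis index that
  is uniform in \<open>m\<close>; it comes from the fact that the cut-offs of \<open>u\<close>,
  which make up the left factors of all grids, form a relatively compact family of square integrable
  functions.\<close>

lemma minor_det_eq_det: "minor_det k {..<n} = Determinant.det (mat n n (\<lambda>(i, j). k i j))"
proof -
  have "minor_det k {..<n} = (\<Sum>p | p permutes {0..<n}. of_int (sign p) * (\<Prod>i\<in>{0..<n}. k i (p i)))"
    unfolding minor_det_def atLeast0LessThan ..
  also have "\<dots> = Determinant.det (mat n n (\<lambda>(i, j). k i j))"
    unfolding Determinant.det_def
    by (auto intro!: sum.cong prod.cong simp: permutes_in_image)
  finally show ?thesis .
qed

lemma minor_det_cong:
  assumes "\<And>i j. i \<in> S \<Longrightarrow> j \<in> S \<Longrightarrow> k i j = k' i j"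
  shows "minor_det k S = minor_det k' S"
  unfolding minor_det_def
  by (intro sum.cong prod.cong refl arg_cong2[where f = "(*)"]) (auto simp: assms permutes_in_image)

lemma minor_det_mult:
  "minor_det (\<lambda>i j. \<Sum>l<n. a i l * b l j) {..<n} = minor_det a {..<n} * minor_det b {..<n}"
proof -
  have "mat n n (\<lambda>(i, j). \<Sum>l<n. a i l * b l j) = mat n n (\<lambda>(i, j). a i j) * mat n n (\<lambda>(i, j). b i j)"
    by (intro eq_matI) (auto simp: scalar_prod_def atLeast0LessThan)
  then show ?thesis
    unfolding minor_det_eq_det by (simp add: Determinant.det_mult[of _ n])
qed

lemma minor_det_lower_triangular:
  assumes "\<And>i j. i < j \<Longrightarrow> j < n \<Longrightarrow> k i j = 0"
  shows "minor_det k {..<n} = (\<Prod>i<n. k i i)"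
proof -
  have "Determinant.det (mat n n (\<lambda>(i, j). k i j)) = prod_list (diag_mat (mat n n (\<lambda>(i, j). k i j)))"
    by (rule det_lower_triangular[where n = n]) (auto simp: assms)
  also have "\<dots> = (\<Prod>i<n. k i i)"
    unfolding diag_mat_def prod.list_conv_set_nth
    by (auto intro!: prod.cong simp: atLeast0LessThan)
  finally show ?thesis unfolding minor_det_eq_det .
qed

lemma minor_det_transpose: "minor_det (\<lambda>i j. k j i) {..<n} = minor_det k {..<n}"
proof -
  have "mat n n (\<lambda>(i, j). k j i) = transpose_mat (mat n n (\<lambda>(i, j). k i j))"
    by (intro eq_matI) auto
  then show ?thesis
    unfolding minor_det_eq_det by (simp add: Determinant.det_transpose[of _ n])
qed

lemma minor_det_cnj: "minor_det (\<lambda>i j. cnj (k i j)) S = cnj (minor_det k S)"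
  unfolding minor_det_def by simp

text \<open>Conjugation by \<open>f\<close> carries permutations of \<open>T\<close> to permutations
  of \<open>S\<close> and keeps their sign. Relabelling reduces minors over arbitrary finite index
  sets to \<open>{..<n}\<close>, where matrix determinants are available.\<close>

lemma minor_det_bij:
  assumes f: "bij_betw f T S" and T: "finite T"
  shows "minor_det k S = minor_det (\<lambda>i j. k (f i) (f j)) T"
proof -
  have inj: "inj_on f T" and im: "f ` T = S" using f by (auto simp: bij_betw_def)
  have fi: "bij_betw (inv_into T f) S T" by (rule bij_betw_inv_into[OF f])
  have inji: "inj_on (inv_into T f) S" using fi by (auto simp: bij_betw_def)
  have bij: "bij_betw (map_permutation T f) {p. p permutes T} {p. p permutes S}"
  proof (rule bij_betw_byWitness[where f' = "map_permutation S (inv_into T f)"])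
    show "\<forall>p\<in>{p. p permutes T}. map_permutation S (inv_into T f) (map_permutation T f p) = p"
    proof
      fix p assume "p \<in> {p. p permutes T}"
      then have p: "p permutes T" by simp
      have "map_permutation S (inv_into T f) (map_permutation T f p) = map_permutation T (inv_into T f \<circ> f) p"
        by (rule map_permutation_compose[OF f inji])
      also have "\<dots> = map_permutation T id p"
        using inj p by (intro map_permutation_cong) (auto simp: inv_into_f_f inj_on_def)
      finally show "map_permutation S (inv_into T f) (map_permutation T f p) = p" using p by simp
    qed
    show "\<forall>p\<in>{p. p permutes S}. map_permutation T f (map_permutation S (inv_into T f) p) = p"
    proof
      fix p assume "p \<in> {p. p permutes S}"
      then have p: "p permutes S" by simp
      have "map_permutation T f (map_permutation S (inv_into T f) p) = map_permutation S (f \<circ> inv_into T f) p"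
        by (rule map_permutation_compose[OF fi inj])
      also have "\<dots> = map_permutation S id p"
        using im p by (intro map_permutation_cong) (auto simp: f_inv_into_f inj_on_def)
      finally show "map_permutation T f (map_permutation S (inv_into T f) p) = p" using p by simp
    qed
    show "map_permutation T f ` {p. p permutes T} \<subseteq> {p. p permutes S}"
      using f by (auto intro: map_permutation_permutes)
    show "map_permutation S (inv_into T f) ` {p. p permutes S} \<subseteq> {p. p permutes T}"
      using fi by (auto intro: map_permutation_permutes)
  qed
  have "minor_det k S = (\<Sum>p | p permutes T. of_int (sign (map_permutation T f p)) * (\<Prod>i\<in>S. k i (map_permutation T f p i)))"
    unfolding minor_det_def by (rule sum.reindex_bij_betw[OF bij, symmetric])
  also have "\<dots> = (\<Sum>p | p permutes T. of_int (sign p) * (\<Prod>i\<in>T. k (f i) (f (p i))))"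
  proof (intro sum.cong refl)
    fix p assume "p \<in> {p. p permutes T}"
    then have p: "p permutes T" by simp
    have "(\<Prod>i\<in>S. k i (map_permutation T f p i)) = (\<Prod>i\<in>T. k (f i) (map_permutation T f p (f i)))"
      by (rule prod.reindex_bij_betw[OF f, symmetric])
    also have "\<dots> = (\<Prod>i\<in>T. k (f i) (f (p i)))"
      using im inj by (intro prod.cong refl) (auto simp: map_permutation_def restrict_id_def inv_into_f_f)
    finally show "of_int (sign (map_permutation T f p)) * (\<Prod>i\<in>S. k i (map_permutation T f p i))
      = of_int (sign p) * (\<Prod>i\<in>T. k (f i) (f (p i)))"
      by (simp add: sign_map_permutation[OF inj p T])
  qed
  finally show ?thesis unfolding minor_det_def .
qed

text \<open>The finite form of the series in \<open>has_fredholm_det\<close>. Expanding the product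
  over \<open>S\<close> selects a set \<open>T\<close> of positions that take \<open>- k\<close>;
  the identity entries elsewhere vanish unless the permutation fixes every point of
  \<open>S - T\<close>, so only permutations of \<open>T\<close> survive.\<close>

lemma minor_det_one_minus:
  assumes S: "finite S"
  shows "minor_det (\<lambda>i j. (if i = j then 1 else 0) - k i j) S
    = (\<Sum>T\<in>Pow S. (-1) ^ card T * minor_det k T)"
proof -
  have "minor_det (\<lambda>i j. (if i = j then 1 else 0) - k i j) S
    = (\<Sum>p | p permutes S. of_int (sign p) * (\<Prod>i\<in>S. - k i (p i) + (if i = p i then 1 else 0)))"
    unfolding minor_det_def by (intro sum.cong refl arg_cong2[where f = "(*)"] prod.cong) auto
  also have "\<dots> = (\<Sum>p | p permutes S. \<Sum>T\<in>Pow S. of_int (sign p) * ((\<Prod>i\<in>T. - k i (p i)) * (\<Prod>i\<in>S - T. if i = p i then 1 else 0)))"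
    by (subst Groups_Big.prod_add[OF S]) (simp add: sum_distrib_left)
  also have "\<dots> = (\<Sum>T\<in>Pow S. \<Sum>p | p permutes S. of_int (sign p) * ((\<Prod>i\<in>T. - k i (p i)) * (\<Prod>i\<in>S - T. if i = p i then 1 else 0)))"
    by (rule sum.swap)
  also have "\<dots> = (\<Sum>T\<in>Pow S. (-1) ^ card T * minor_det k T)"
  proof (intro sum.cong refl)
    fix T assume T: "T \<in> Pow S"
    then have fT: "finite T" using S finite_subset by auto
    have "(\<Sum>p | p permutes S. of_int (sign p) * ((\<Prod>i\<in>T. - k i (p i)) * (\<Prod>i\<in>S - T. if i = p i then 1 else 0)))
      = (\<Sum>p | p permutes T. of_int (sign p) * ((\<Prod>i\<in>T. - k i (p i)) * (\<Prod>i\<in>S - T. if i = p i then 1 else 0)))"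
    proof (rule sum.mono_neutral_right)
      show "finite {p. p permutes S}" by (rule finite_permutations[OF S])
      show "{p. p permutes T} \<subseteq> {p. p permutes S}" using T permutes_subset by blast
      show "\<forall>p\<in>{p. p permutes S} - {p. p permutes T}.
        of_int (sign p) * ((\<Prod>i\<in>T. - k i (p i)) * (\<Prod>i\<in>S - T. if i = p i then 1 else 0)) = 0"
      proof
        fix p assume "p \<in> {p. p permutes S} - {p. p permutes T}"
        then have p: "p permutes S" "\<not> p permutes T" by auto
        obtain i where "i \<in> S - T" "i \<noteq> p i"
          using p permutes_superset[of p S T] by (metis)
        then have "(\<Prod>i\<in>S - T. if i = p i then 1 else (0::complex)) = 0"
          using S by (intro prod_zero bexI[of _ i]) auto
        then show "of_int (sign p) * ((\<Prod>i\<in>T. - k i (p i)) * (\<Prod>i\<in>S - T. if i = p i then 1 else 0)) = 0"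
          by simp
      qed
    qed
    also have "\<dots> = (\<Sum>p | p permutes T. (-1) ^ card T * (of_int (sign p) * (\<Prod>i\<in>T. k i (p i))))"
    proof (intro sum.cong refl)
      fix p assume "p \<in> {p. p permutes T}"
      then have p: "p permutes T" by simp
      have "(\<Prod>i\<in>S - T. if i = p i then 1 else (0::complex)) = 1"
        using p by (intro prod.neutral) (auto simp: permutes_not_in)
      moreover have "(\<Prod>i\<in>T. - k i (p i)) = (-1) ^ card T * (\<Prod>i\<in>T. k i (p i))"
        by (simp add: prod_uminus)
      ultimately show "of_int (sign p) * ((\<Prod>i\<in>T. - k i (p i)) * (\<Prod>i\<in>S - T. if i = p i then 1 else 0))
        = (-1) ^ card T * (of_int (sign p) * (\<Prod>i\<in>T. k i (p i)))" by simp
    qed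
    finally show "(\<Sum>p | p permutes S. of_int (sign p) * ((\<Prod>i\<in>T. - k i (p i)) * (\<Prod>i\<in>S - T. if i = p i then 1 else 0)))
      = (-1) ^ card T * minor_det k T"
      unfolding minor_det_def by (simp add: sum_distrib_left)
  qed
  finally show ?thesis .
qed

section \<open>Gram determinants and Hadamard's inequality\<close>

lemma minor_det_Suc_column:
  assumes "\<And>i. 0 < i \<Longrightarrow> i < Suc n \<Longrightarrow> k i 0 = 0"
  shows "minor_det k {..<Suc n} = k 0 0 * minor_det (\<lambda>i j. k (Suc i) (Suc j)) {..<n}"
proof -
  have eq: "mat (Suc n) (Suc n) (\<lambda>(i, j). k i j) =
    four_block_mat (mat 1 1 (\<lambda>(i, j). k 0 0)) (mat 1 n (\<lambda>(i, j). k 0 (Suc j))) (0\<^sub>m n 1)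
      (mat n n (\<lambda>(i, j). k (Suc i) (Suc j)))" (is "?A = ?B")
  proof (rule eq_matI)
    fix i j assume "i < dim_row ?B" "j < dim_col ?B"
    then have "i < Suc n" "j < Suc n" by auto
    then show "?A $$ (i, j) = ?B $$ (i, j)"
      using assms[of i] by (cases i; cases j) (auto simp: four_block_mat_def)
  qed auto
  show ?thesis
    unfolding minor_det_eq_det eq
    by (subst det_four_block_mat_lower_left_zero_col[where n = n]) (auto simp: det_single)
qed

text \<open>Projecting the other rows onto the complement of the first one is a unimodular change of rows.\<close>
lemma gram_det_le:
  fixes a :: "nat \<Rightarrow> nat \<Rightarrow> complex"
  shows "\<exists>d. minor_det (\<lambda>i j. \<Sum>l<L. a i l * cnj (a j l)) {..<n} = of_real d \<and>
    0 \<le> d \<and> d \<le> (\<Prod>i<n. \<Sum>l<L. (norm (a i l))\<^sup>2)"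
proof (induction n arbitrary: a)
  case 0
  show ?case by (intro exI[of _ 1]) (simp add: minor_det_def)
next
  case (Suc n)
  define ip where "ip f g = (\<Sum>l<L. f l * cnj (g l))" for f g :: "nat \<Rightarrow> complex"
  define sq where "sq f = (\<Sum>l<L. (norm (f l))\<^sup>2)" for f :: "nat \<Rightarrow> complex"
  have ip_self: "ip f f = of_real (sq f)" for f
    by (simp add: ip_def sq_def complex_norm_square del: of_real_power)
  have sq0: "0 \<le> sq f" for f unfolding sq_def by (intro sum_nonneg) auto
  show ?case
  proof (cases "sq (a 0) = 0")
    case True
    then have z: "a 0 l = 0" if "l < L" for l
      using that unfolding sq_def by (subst (asm) sum_nonneg_eq_0_iff) auto
    \<comment> \<open>A zero first row of \<open>a\<close> makes the first column of the Gram matrix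
      vanish, including its corner.\<close>
    have "minor_det (\<lambda>i j. \<Sum>l<L. a i l * cnj (a j l)) {..<Suc n} = 0"
      by (subst minor_det_Suc_column) (auto simp: z)
    moreover have "0 \<le> (\<Prod>i<Suc n. \<Sum>l<L. (norm (a i l))\<^sup>2)"
      by (intro prod_nonneg sum_nonneg ballI) auto
    ultimately show ?thesis by (intro exI[of _ 0]) auto
  next
    case False
    define s where "s = sq (a 0)"
    have s: "s > 0" using False sq0[of "a 0"] by (auto simp: s_def)
    define \<gamma> where "\<gamma> i = ip (a i) (a 0) / of_real s" for i
    define a' where "a' i l = a (Suc i) l - \<gamma> (Suc i) * a 0 l" for i l
    \<comment> \<open>\<open>T\<close> is unit lower triangular: it subtracts from every other row
      its component along row 0. Hence \<open>X\<close>, which is \<open>T\<close> times the Gram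
      matrix, has the same determinant.\<close>
    define T where "T i j = (if i = j then 1 else if j = 0 then - \<gamma> i else (0::complex))" for i j
    define X where "X i j = (\<Sum>l<Suc n. T i l * ip (a l) (a j))" for i j
    have X0: "X 0 j = ip (a 0) (a j)" for j
      unfolding X_def T_def by (subst sum.remove[of _ 0]) (auto intro!: sum.neutral)
    have XS: "X (Suc i) j = ip (a' i) (a j)" if "i < n" for i j
    proof -
      have "X (Suc i) j = (\<Sum>l\<in>{0, Suc i}. T (Suc i) l * ip (a l) (a j))"
        unfolding X_def using that by (intro sum.mono_neutral_right) (auto simp: T_def)
      also have "\<dots> = ip (a' i) (a j)"
        by (simp add: T_def ip_def a'_def algebra_simps sum.distrib sum_subtractf sum_distrib_left sum_negf)
      finally show ?thesis .
    qed
    have orth: "ip (a' i) (a 0) = 0" for i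
    proof -
      have "ip (a' i) (a 0) = ip (a (Suc i)) (a 0) - \<gamma> (Suc i) * ip (a 0) (a 0)"
        by (simp add: ip_def a'_def algebra_simps sum_subtractf sum_distrib_left)
      then show ?thesis using s by (simp add: \<gamma>_def ip_self s_def)
    qed
    \<comment> \<open>Changing the rows takes care of the columns: \<open>a' i\<close> is orthogonal
      to \<open>a 0\<close>, so the right argument may be projected too.\<close>
    have ip': "ip (a' i) (a (Suc j)) = ip (a' i) (a' j)" for i j
    proof -
      have "ip (a' i) (a' j) = ip (a' i) (a (Suc j)) - cnj (\<gamma> (Suc j)) * ip (a' i) (a 0)"
        by (simp add: ip_def a'_def[of j] algebra_simps sum_subtractf sum_distrib_left)
      then show ?thesis by (simp add: orth)
    qed
    have "minor_det X {..<Suc n} = minor_det T {..<Suc n} * minor_det (\<lambda>i j. ip (a i) (a j)) {..<Suc n}"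
      unfolding X_def by (rule minor_det_mult)
    also have "minor_det T {..<Suc n} = 1"
      by (subst minor_det_lower_triangular) (auto simp: T_def)
    finally have "minor_det (\<lambda>i j. ip (a i) (a j)) {..<Suc n} = minor_det X {..<Suc n}" by simp
    also have "\<dots> = X 0 0 * minor_det (\<lambda>i j. X (Suc i) (Suc j)) {..<n}"
    proof (rule minor_det_Suc_column)
      fix i :: nat assume "0 < i" "i < Suc n"
      then obtain j where "i = Suc j" "j < n" by (cases i) auto
      then show "X i 0 = 0" by (simp add: XS orth)
    qed
    also have "minor_det (\<lambda>i j. X (Suc i) (Suc j)) {..<n} = minor_det (\<lambda>i j. ip (a' i) (a' j)) {..<n}"
      by (rule minor_det_cong) (simp add: XS ip')
    finally have *: "minor_det (\<lambda>i j. ip (a i) (a j)) {..<Suc n}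
      = of_real s * minor_det (\<lambda>i j. ip (a' i) (a' j)) {..<n}"
      by (simp add: X0 ip_self s_def)
    obtain d where d: "minor_det (\<lambda>i j. ip (a' i) (a' j)) {..<n} = of_real d" "0 \<le> d" "d \<le> (\<Prod>i<n. sq (a' i))"
      using Suc.IH[of a'] unfolding ip_def sq_def by blast
    \<comment> \<open>Projection does not increase norms, so the bound for the projected rows passes
      to the original ones.\<close>
    have pyth: "sq (a' i) \<le> sq (a (Suc i))" for i
    proof -
      have "ip (a (Suc i)) (a (Suc i)) = ip (\<lambda>l. a' i l + \<gamma> (Suc i) * a 0 l) (\<lambda>l. a' i l + \<gamma> (Suc i) * a 0 l)"
        by (simp add: a'_def)
      also have "\<dots> = ip (a' i) (a' i) + \<gamma> (Suc i) * ip (a 0) (a' i) + cnj (\<gamma> (Suc i)) * ip (a' i) (a 0)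
        + \<gamma> (Suc i) * cnj (\<gamma> (Suc i)) * ip (a 0) (a 0)"
        by (simp add: ip_def algebra_simps sum.distrib sum_distrib_left)
      also have "ip (a 0) (a' i) = cnj (ip (a' i) (a 0))" by (simp add: ip_def mult.commute)
      finally have "of_real (sq (a (Suc i))) = complex_of_real (sq (a' i) + (norm (\<gamma> (Suc i)))\<^sup>2 * s)"
        by (simp add: orth ip_self s_def complex_norm_square del: of_real_power)
      then have "sq (a (Suc i)) = sq (a' i) + (norm (\<gamma> (Suc i)))\<^sup>2 * s"
        using of_real_eq_iff by blast
      then show ?thesis using s by simp
    qed
    have "s * d \<le> s * (\<Prod>i<n. sq (a (Suc i)))"
      using s d(3) prod_mono[of "{..<n}" "\<lambda>i. sq (a' i)" "\<lambda>i. sq (a (Suc i))"] pyth sq0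
      by (intro mult_left_mono) (auto intro: order_trans)
    also have "\<dots> = (\<Prod>i<Suc n. sq (a i))"
      unfolding s_def by (simp only: prod.lessThan_Suc_shift)
    finally show ?thesis
      using * d s unfolding ip_def sq_def by (intro exI[of _ "s * d"]) auto
  qed
qed

text \<open>The Gram matrix of the rows of a square matrix is the matrix times its conjugate
  transpose, so its determinant is the squared modulus.\<close>

lemma hadamard_inequality:
  fixes a :: "nat \<Rightarrow> nat \<Rightarrow> complex"
  shows "(norm (minor_det a {..<n}))\<^sup>2 \<le> (\<Prod>i<n. \<Sum>l<n. (norm (a i l))\<^sup>2)"
proof -
  obtain d where d: "minor_det (\<lambda>i j. \<Sum>l<n. a i l * cnj (a j l)) {..<n} = of_real d"
    "d \<le> (\<Prod>i<n. \<Sum>l<n. (norm (a i l))\<^sup>2)"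
    using gram_det_le by blast
  have "minor_det (\<lambda>i j. \<Sum>l<n. a i l * cnj (a j l)) {..<n}
    = minor_det a {..<n} * minor_det (\<lambda>i j. cnj (a j i)) {..<n}"
    by (rule minor_det_mult)
  also have "minor_det (\<lambda>i j. cnj (a j i)) {..<n} = cnj (minor_det a {..<n})"
    by (simp add: minor_det_cnj minor_det_transpose[of a])
  finally have "of_real d = complex_of_real ((norm (minor_det a {..<n}))\<^sup>2)"
    using d by (simp add: complex_norm_square del: of_real_power)
  then show ?thesis using d(2) of_real_eq_iff by metis
qed

text \<open>Both sides are the determinant of the block matrix with identity diagonal blocks and
  off-diagonal blocks \<open>A\<close>, \<open>B\<close>: eliminating \<open>A\<close> by
  \<open>?U\<close> leaves \<open>1 - A B\<close>, eliminating \<open>B\<close> by \<open>?W\<close>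
  leaves \<open>1 - B A\<close>. The sizes \<open>n\<close> and \<open>m\<close> are unrelated, so a
  truncation of the basis can be exchanged for a grid.\<close>

lemma minor_det_sylvester:
  "minor_det (\<lambda>i j. (if i = j then 1 else 0) - (\<Sum>l<m. a i l * b l j)) {..<n}
    = minor_det (\<lambda>l l'. (if l = l' then 1 else 0) - (\<Sum>i<n. b l i * a i l')) {..<m}"
proof -
  define A B where "A = mat n m (\<lambda>(i, l). a i l)" and "B = mat m n (\<lambda>(l, i). b l i)"
  have A[simp]: "A \<in> carrier_mat n m" and B[simp]: "B \<in> carrier_mat m n"
    by (auto simp: A_def B_def)
  \<comment> \<open>Block entries that arise in the two eliminations, simplified beforehand from the
    shape that \<open>mult_four_block_mat\<close> produces.\<close>
  have Z1: "1\<^sub>m n * 1\<^sub>m n + - A * B = 1\<^sub>m n - A * B" "0\<^sub>m n n + - A * B = - (A * B)"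
    and Z2: "1\<^sub>m n * A + - A * 1\<^sub>m m = 0\<^sub>m n m" "- B * A + 1\<^sub>m m = 1\<^sub>m m - B * A"
    and Z3: "0\<^sub>m m n + 1\<^sub>m m * B = B" "- B + B = 0\<^sub>m m n"
    and Z4: "0\<^sub>m m n * A + 1\<^sub>m m = 1\<^sub>m m" "A + 0\<^sub>m n m = A"
    and Z5: "1\<^sub>m n + - A * B = 1\<^sub>m n - A * B"
      "1\<^sub>m n + 0\<^sub>m n m * B = 1\<^sub>m n" "1\<^sub>m n * A + 0\<^sub>m n m = A" "- B * 1\<^sub>m n + 1\<^sub>m m * B = 0\<^sub>m m n"
    by (intro eq_matI; auto simp: A_def B_def scalar_prod_def sum_negf)+
  have C[simp]: "1\<^sub>m n - A * B \<in> carrier_mat n n" "- (A * B) \<in> carrier_mat n n"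
    "1\<^sub>m m - B * A \<in> carrier_mat m m"
    by (auto simp: A_def B_def)
  let ?M = "four_block_mat (1\<^sub>m n) A B (1\<^sub>m m)"
  have M: "?M \<in> carrier_mat (n + m) (n + m)" by simp
  let ?U = "four_block_mat (1\<^sub>m n) (- A) (0\<^sub>m m n) (1\<^sub>m m)"
  let ?W = "four_block_mat (1\<^sub>m n) (0\<^sub>m n m) (- B) (1\<^sub>m m)"
  have dU: "Determinant.det ?U = 1" and dW: "Determinant.det ?W = 1"
    by (simp_all add: det_four_block_mat_lower_left_zero[where n = n and m = m]
        det_four_block_mat_upper_right_zero[where n = n and m = m])
  have "?U * ?M = four_block_mat (1\<^sub>m n - A * B) (0\<^sub>m n m) B (1\<^sub>m m)"
    by (subst mult_four_block_mat[where ?n1.0 = n and ?n2.0 = m and ?nc1.0 = n and ?nc2.0 = m and ?nr1.0 = n and ?nr2.0 = m])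
      (auto simp: Z1 Z2 Z3 Z4 Z5 simp del: uminus_mult_left_mat)
  then have "Determinant.det (?U * ?M) = Determinant.det (1\<^sub>m n - A * B)"
    by (simp add: det_four_block_mat_upper_right_zero[OF C(1) refl B one_carrier_mat])
  then have 1: "Determinant.det ?M = Determinant.det (1\<^sub>m n - A * B)"
    by (subst (asm) Determinant.det_mult[where n = "n + m"]) (auto simp: dU)
  have "?W * ?M = four_block_mat (1\<^sub>m n) A (0\<^sub>m m n) (1\<^sub>m m - B * A)"
    by (subst mult_four_block_mat[where ?n1.0 = n and ?n2.0 = m and ?nc1.0 = n and ?nc2.0 = m and ?nr1.0 = n and ?nr2.0 = m])
      (auto simp: Z1 Z2 Z3 Z4 Z5)
  then have "Determinant.det (?W * ?M) = Determinant.det (1\<^sub>m m - B * A)"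
    by (simp add: det_four_block_mat_lower_left_zero[OF one_carrier_mat A refl C(3)])
  then have 2: "Determinant.det ?M = Determinant.det (1\<^sub>m m - B * A)"
    by (subst (asm) Determinant.det_mult[where n = "n + m"]) (auto simp: dW)
  have 3: "1\<^sub>m n - A * B = mat n n (\<lambda>(i, j). (if i = j then 1 else 0) - (\<Sum>l<m. a i l * b l j))"
    by (intro eq_matI) (auto simp: A_def B_def scalar_prod_def atLeast0LessThan)
  have 4: "1\<^sub>m m - B * A = mat m m (\<lambda>(i, j). (if i = j then 1 else 0) - (\<Sum>l<n. b i l * a l j))"
    by (intro eq_matI) (auto simp: A_def B_def scalar_prod_def atLeast0LessThan)
  show ?thesis
    using 1 2 unfolding 3 4 minor_det_eq_det by simp
qed

text \<open>The block matrix with rows \<open>(0, A)\<close> and \<open>(B, 1)\<close> has the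
  determinant of the product, up to the sign \<open>(-1) ^ n\<close>. In it the factors occupy
  separate rows, so Hadamard's inequality sees \<open>A\<close> and \<open>B\<close> instead of the
  entries of their product.\<close>

lemma minor_det_product_block:
  "norm (minor_det (\<lambda>i j. \<Sum>l<m. a i l * b l j) {..<n})
    = norm (minor_det (\<lambda>i j. if i < n then (if j < n then 0 else a i (j - n))
        else (if j < n then b (i - n) j else if i = j then 1 else 0)) {..<n + m})"
proof -
  define A B where "A = mat n m (\<lambda>(i, l). a i l)" and "B = mat m n (\<lambda>(l, i). b l i)"
  have A[simp]: "A \<in> carrier_mat n m" and B[simp]: "B \<in> carrier_mat m n"
    by (auto simp: A_def B_def)
  have Z1: "1\<^sub>m n * 1\<^sub>m n + - A * B = 1\<^sub>m n - A * B" "0\<^sub>m n n + - A * B = - (A * B)"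
    and Z2: "1\<^sub>m n * A + - A * 1\<^sub>m m = 0\<^sub>m n m" "- B * A + 1\<^sub>m m = 1\<^sub>m m - B * A"
    and Z3: "0\<^sub>m m n + 1\<^sub>m m * B = B" "- B + B = 0\<^sub>m m n"
    and Z4: "0\<^sub>m m n * A + 1\<^sub>m m = 1\<^sub>m m" "A + 0\<^sub>m n m = A"
    and Z5: "1\<^sub>m n + - A * B = 1\<^sub>m n - A * B"
      "1\<^sub>m n + 0\<^sub>m n m * B = 1\<^sub>m n" "1\<^sub>m n * A + 0\<^sub>m n m = A" "- B * 1\<^sub>m n + 1\<^sub>m m * B = 0\<^sub>m m n"
    by (intro eq_matI; auto simp: A_def B_def scalar_prod_def sum_negf)+
  have C[simp]: "1\<^sub>m n - A * B \<in> carrier_mat n n" "- (A * B) \<in> carrier_mat n n"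
    "1\<^sub>m m - B * A \<in> carrier_mat m m"
    by (auto simp: A_def B_def)
  let ?M = "four_block_mat (0\<^sub>m n n) A B (1\<^sub>m m)"
  let ?U = "four_block_mat (1\<^sub>m n) (- A) (0\<^sub>m m n) (1\<^sub>m m)"
  have dU: "Determinant.det ?U = 1"
    by (simp add: det_four_block_mat_lower_left_zero[where n = n and m = m])
  have "?U * ?M = four_block_mat (- (A * B)) (0\<^sub>m n m) B (1\<^sub>m m)"
    by (subst mult_four_block_mat[where ?n1.0 = n and ?n2.0 = m and ?nc1.0 = n and ?nc2.0 = m and ?nr1.0 = n and ?nr2.0 = m])
      (auto simp: Z1 Z2 Z3 Z4 Z5 simp del: uminus_mult_left_mat)
  then have "Determinant.det (?U * ?M) = Determinant.det (- (A * B))"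
    by (simp add: det_four_block_mat_upper_right_zero[OF C(2) refl B one_carrier_mat])
  also have "- (A * B) = (-1) \<cdot>\<^sub>m (A * B)" by (intro eq_matI) auto
  also have "Determinant.det \<dots> = (-1) ^ n * Determinant.det (A * B)"
    by (subst det_smult) (simp add: B_def)
  finally have "Determinant.det ?M = (-1) ^ n * Determinant.det (A * B)"
    by (subst (asm) Determinant.det_mult[where n = "n + m"]) (auto simp: dU)
  then have 1: "norm (Determinant.det ?M) = norm (Determinant.det (A * B))"
    by (simp add: norm_mult norm_power)
  have 2: "A * B = mat n n (\<lambda>(i, j). (\<Sum>l<m. a i l * b l j))"
    by (intro eq_matI) (auto simp: A_def B_def scalar_prod_def atLeast0LessThan)
  have 3: "?M = mat (n + m) (n + m) (\<lambda>(i, j). if i < n then (if j < n then 0 else a i (j - n))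
        else (if j < n then b (i - n) j else if i = j then 1 else 0))"
    by (intro eq_matI) (auto simp: A_def B_def four_block_mat_def)
  show ?thesis
    using 1 unfolding 2 3 minor_det_eq_det by simp
qed

lemma sum_lessThan_add_split: "(\<Sum>i<n + m. f i) = (\<Sum>i<n. f i) + (\<Sum>i<m. f (n + i))"
  for f :: "nat \<Rightarrow> 'a::comm_monoid_add"
  by (induction m) (auto simp: add.assoc)

lemma prod_lessThan_add_split: "(\<Prod>i<n + m. f i) = (\<Prod>i<n. f i) * (\<Prod>i<m. f (n + i))"
  for f :: "nat \<Rightarrow> 'a::comm_monoid_mult"
  by (induction m) (auto simp: mult.assoc)

lemma minor_det_zero_column:
  assumes "j \<in> S" "finite S" "\<And>i. i \<in> S \<Longrightarrow> k i j = 0"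
  shows "minor_det k S = 0"
  unfolding minor_det_def
proof (intro sum.neutral ballI)
  fix p assume "p \<in> {p. p permutes S}"
  then have p: "p permutes S" by simp
  obtain i where "i \<in> S" "p i = j" using p assms(1) by (metis permutes_def permutes_in_image)
  then have "(\<Prod>i\<in>S. k i (p i)) = 0" using assms by (intro prod_zero) auto
  then show "of_int (sign p) * (\<Prod>i\<in>S. k i (p i)) = 0" by simp
qed

lemma minor_det_scale_columns:
  "minor_det (\<lambda>i j. k i j * of_real (t j)) S = minor_det k S * of_real (\<Prod>i\<in>S. t i)"
  unfolding minor_det_def sum_distrib_right
proof (intro sum.cong refl)
  fix p assume "p \<in> {p. p permutes S}"
  then have p: "p permutes S" by simp
  have "(\<Prod>i\<in>S. k i (p i) * complex_of_real (t (p i))) = (\<Prod>i\<in>S. k i (p i)) * of_real (\<Prod>i\<in>S. t (p i))"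
    by (simp add: prod.distrib)
  also have "(\<Prod>i\<in>S. t (p i)) = (\<Prod>i\<in>S. t i)"
    using prod.permute[OF p, of t] by (simp add: o_def)
  finally show "of_int (sign p) * (\<Prod>i\<in>S. k i (p i) * of_real (t (p i)))
    = of_int (sign p) * (\<Prod>i\<in>S. k i (p i)) * of_real (\<Prod>i\<in>S. t i)" by simp
qed

text \<open>With \<open>L\<close> the unit lower triangular matrix \<open>1 - t\<close>, the second
  hypothesis says that \<phi> solves \<open>L \<phi> = P\<close>. Thus the matrix on the left is
  \<open>L (1 + \<phi> Q)\<close>; the factor \<open>L\<close> has determinant one, and Sylvester's
  identity moves the rest to size \<open>r\<close>.\<close>

lemma minor_det_triangular_plus_finite_rank:
  fixes t :: "nat \<Rightarrow> nat \<Rightarrow> complex"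
  assumes t: "\<And>p q. p \<le> q \<Longrightarrow> t p q = 0"
    and \<phi>: "\<And>p l. p < m \<Longrightarrow> l < r \<Longrightarrow> \<phi> p l = P p l + (\<Sum>q<m. t p q * \<phi> q l)"
  shows "minor_det (\<lambda>p q. (if p = q then 1 else 0) - t p q + (\<Sum>l<r. P p l * Q l q)) {..<m}
    = minor_det (\<lambda>l l'. (if l = l' then 1 else 0) + (\<Sum>p<m. Q l p * \<phi> p l')) {..<r}"
proof -
  define L where "L p q = (if p = q then 1 else 0) - t p q" for p q
  have L: "(\<Sum>k<m. L p k * f k) = f p - (\<Sum>k<m. t p k * f k)" if "p < m" for p f
    using that by (simp add: L_def left_diff_distrib sum_subtractf if_distrib[of "\<lambda>x. x * _"] cong: if_cong)
  have "minor_det (\<lambda>p q. (if p = q then 1 else 0) - t p q + (\<Sum>l<r. P p l * Q l q)) {..<m}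
    = minor_det (\<lambda>p q. \<Sum>k<m. L p k * ((if k = q then 1 else 0) - (\<Sum>l<r. - \<phi> k l * Q l q))) {..<m}"
  proof (rule minor_det_cong)
    fix p q assume "p \<in> {..<m}" "q \<in> {..<m}"
    then have p: "p < m" and q: "q < m" by auto
    have "(\<Sum>k<m. L p k * ((if k = q then 1 else 0) - (\<Sum>l<r. - \<phi> k l * Q l q)))
      = (\<Sum>k<m. L p k * (if k = q then 1 else 0)) + (\<Sum>k<m. L p k * (\<Sum>l<r. \<phi> k l * Q l q))"
      by (simp add: sum_negf algebra_simps sum.distrib)
    also have "(\<Sum>k<m. L p k * (if k = q then 1 else 0)) = L p q"
      using q by (simp add: if_distrib[of "\<lambda>x. _ * x"] cong: if_cong)
    also have "(\<Sum>k<m. L p k * (\<Sum>l<r. \<phi> k l * Q l q)) = (\<Sum>l<r. (\<Sum>k<m. L p k * \<phi> k l) * Q l q)"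
      unfolding sum_distrib_left sum_distrib_right by (subst sum.swap) (simp add: mult_ac)
    also have "\<dots> = (\<Sum>l<r. P p l * Q l q)"
      using \<phi> p by (intro sum.cong refl) (simp add: L)
    finally show "(if p = q then 1 else 0) - t p q + (\<Sum>l<r. P p l * Q l q)
      = (\<Sum>k<m. L p k * ((if k = q then 1 else 0) - (\<Sum>l<r. - \<phi> k l * Q l q)))"
      by (simp add: L_def)
  qed
  also have "\<dots> = minor_det L {..<m} *
    minor_det (\<lambda>k q. (if k = q then 1 else 0) - (\<Sum>l<r. - \<phi> k l * Q l q)) {..<m}"
    by (rule minor_det_mult)
  also have "minor_det L {..<m} = 1"
    by (subst minor_det_lower_triangular) (auto simp: L_def t)
  also have "minor_det (\<lambda>k q. (if k = q then 1 else 0) - (\<Sum>l<r. - \<phi> k l * Q l q)) {..<m}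
    = minor_det (\<lambda>l l'. (if l = l' then 1 else 0) + (\<Sum>p<m. Q l p * \<phi> p l')) {..<r}"
    by (subst minor_det_sylvester) (simp add: sum_negf)
  finally show ?thesis by simp
qed

lemma minor_det_2: "minor_det k {..<2} = k 0 0 * k 1 1 - k 0 1 * k 1 0"
proof -
  have f01: "finite {1::nat}" "0 \<notin> {1::nat}" by auto
  have 2: "{..<2} = {0, 1::nat}" by auto
  show ?thesis
    unfolding 2 minor_det_def sum_over_permutations_insert[OF f01] permutes_sing
    by (simp add: sign_swap_id sign_id)
qed

lemma tendsto_minor_det:
  assumes "\<And>i j. i \<in> S \<Longrightarrow> j \<in> S \<Longrightarrow> ((\<lambda>n. k n i j) \<longlongrightarrow> k' i j) F"
  shows "((\<lambda>n. minor_det (k n) S) \<longlongrightarrow> minor_det k' S) F"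
  unfolding minor_det_def
  by (intro tendsto_intros assms) (auto simp: permutes_in_image)

text \<open>
  Hadamard's inequality for the block matrix with rows \<open>(0, a i)\<close> and \<open>(b l, e l)\<close>, whose
  determinant is that of the product up to sign; the identity block costs the factor \<open>exp (1/2)\<close>
  per row once the columns of \<open>b\<close> are normalised.
\<close>
lemma minor_det_product_le_lessThan:
  fixes a b :: "nat \<Rightarrow> nat \<Rightarrow> complex"
  shows "norm (minor_det (\<lambda>i j. \<Sum>l<m. a i l * b l j) {..<n})
    \<le> (\<Prod>i<n. exp (1 / 2) * (L2_set (\<lambda>l. norm (a i l)) {..<m} * L2_set (\<lambda>l. norm (b l i)) {..<m}))"
proof -
  define \<alpha> where "\<alpha> i = L2_set (\<lambda>l. norm (a i l)) {..<m}" for i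
  define \<beta> where "\<beta> i = L2_set (\<lambda>l. norm (b l i)) {..<m}" for i
  have \<alpha>0: "0 \<le> \<alpha> i" and \<beta>0: "0 \<le> \<beta> i" for i by (auto simp: \<alpha>_def \<beta>_def)
  show ?thesis
  proof (cases "\<exists>j<n. \<beta> j = 0")
    \<comment> \<open>A vanishing column of \<open>b\<close> cannot be normalised, but then the
      product has a vanishing column as well.\<close>
    case True
    then obtain j where j: "j < n" "\<beta> j = 0" by auto
    then have "b l j = 0" if "l < m" for l
      using that by (auto simp: \<beta>_def L2_set_eq_0_iff)
    then have "minor_det (\<lambda>i j. \<Sum>l<m. a i l * b l j) {..<n} = 0"
      using j by (intro minor_det_zero_column[of j]) auto
    then show ?thesis using \<alpha>0 \<beta>0 by (auto intro!: prod_nonneg simp: \<alpha>_def \<beta>_def)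
  next
    case False
    then have \<beta>: "0 < \<beta> j" if "j < n" for j using that \<beta>0[of j] by (auto simp: less_le)
    define b' where "b' l j = b l j * of_real (1 / \<beta> j)" for l j
    define M where "M i j = (if i < n then (if j < n then 0 else a i (j - n))
        else (if j < n then b' (i - n) j else if i = j then 1 else 0))" for i j
    have b'1: "(\<Sum>l<m. (norm (b' l j))\<^sup>2) = 1" if "j < n" for j
    proof -
      have "(\<Sum>l<m. (norm (b' l j))\<^sup>2) = (\<Sum>l<m. (norm (b l j))\<^sup>2) / (\<beta> j)\<^sup>2"
        by (simp add: b'_def norm_mult norm_divide power_divide sum_divide_distrib)
      also have "(\<Sum>l<m. (norm (b l j))\<^sup>2) = (\<beta> j)\<^sup>2"
        by (simp add: \<beta>_def L2_set_def sum_nonneg)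
      finally show ?thesis using \<beta>[OF that] by simp
    qed
    have "(norm (minor_det M {..<n + m}))\<^sup>2 \<le> (\<Prod>i<n + m. \<Sum>l<n + m. (norm (M i l))\<^sup>2)"
      by (rule hadamard_inequality)
    also have "\<dots> = (\<Prod>i<n. (\<alpha> i)\<^sup>2) * (\<Prod>l<m. 1 + (\<Sum>j<n. (norm (b' l j))\<^sup>2))"
      unfolding prod_lessThan_add_split
    proof (intro arg_cong2[where f = "(*)"] prod.cong refl)
      fix i assume "i \<in> {..<n}"
      then show "(\<Sum>l<n + m. (norm (M i l))\<^sup>2) = (\<alpha> i)\<^sup>2"
        unfolding sum_lessThan_add_split by (simp add: M_def \<alpha>_def L2_set_def sum_nonneg)
    next
      fix l assume l: "l \<in> {..<m}"
      have "(\<Sum>j<m. (norm (M (n + l) (n + j)))\<^sup>2) = (\<Sum>j\<in>{l}. (norm (M (n + l) (n + j)))\<^sup>2)"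
        using l by (intro sum.mono_neutral_right) (auto simp: M_def)
      then show "(\<Sum>j<n + m. (norm (M (n + l) j))\<^sup>2) = 1 + (\<Sum>j<n. (norm (b' l j))\<^sup>2)"
        unfolding sum_lessThan_add_split by (simp add: M_def)
    qed
    also have "\<dots> \<le> (\<Prod>i<n. (\<alpha> i)\<^sup>2) * (\<Prod>i<n. (exp (1 / 2))\<^sup>2)"
    proof (intro mult_left_mono)
      \<comment> \<open>By \<open>1 + x \<le> exp x\<close> the rows of the identity block
        contribute at most \<open>exp\<close> of the total squared mass of \<open>b'\<close>, and
        that mass is \<open>n\<close>, one for each unit column.\<close>
      have "(\<Prod>l<m. 1 + (\<Sum>j<n. (norm (b' l j))\<^sup>2)) \<le> (\<Prod>l<m. exp (\<Sum>j<n. (norm (b' l j))\<^sup>2))"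
        by (intro prod_mono) (auto intro!: add_nonneg_nonneg sum_nonneg exp_ge_add_one_self)
      also have "\<dots> = exp (\<Sum>j<n. \<Sum>l<m. (norm (b' l j))\<^sup>2)"
        by (subst sum.swap) (simp add: exp_sum)
      also have "(\<Sum>j<n. \<Sum>l<m. (norm (b' l j))\<^sup>2) = n" using b'1 by simp
      also have "exp (real n) = (\<Prod>i<n. (exp (1 / 2))\<^sup>2)"
        by (simp add: exp_double[symmetric] exp_of_nat_mult[symmetric])
      finally show "(\<Prod>l<m. 1 + (\<Sum>j<n. (norm (b' l j))\<^sup>2)) \<le> (\<Prod>i<n. (exp (1 / 2))\<^sup>2)" .
    qed (auto intro!: prod_nonneg)
    also have "\<dots> = (\<Prod>i<n. exp (1 / 2) * \<alpha> i)\<^sup>2"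
      unfolding prod_power_distrib prod.distrib[symmetric]
      by (intro prod.cong refl) (simp add: power_mult_distrib)
    finally have "(norm (minor_det M {..<n + m}))\<^sup>2 \<le> (\<Prod>i<n. exp (1 / 2) * \<alpha> i)\<^sup>2" .
    then have "norm (minor_det M {..<n + m}) \<le> (\<Prod>i<n. exp (1 / 2) * \<alpha> i)"
      by (rule power2_le_imp_le) (auto intro!: prod_nonneg simp: \<alpha>0)
    then have le: "norm (minor_det (\<lambda>i j. \<Sum>l<m. a i l * b' l j) {..<n}) \<le> (\<Prod>i<n. exp (1 / 2) * \<alpha> i)"
      by (subst minor_det_product_block) (simp add: M_def[abs_def])
    have "minor_det (\<lambda>i j. \<Sum>l<m. a i l * b l j) {..<n}
      = minor_det (\<lambda>i j. (\<Sum>l<m. a i l * b' l j) * of_real (\<beta> j)) {..<n}"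
    proof (rule minor_det_cong)
      fix i j assume "j \<in> {..<n}"
      then have "\<beta> j \<noteq> 0" using \<beta>[of j] by auto
      then show "(\<Sum>l<m. a i l * b l j) = (\<Sum>l<m. a i l * b' l j) * of_real (\<beta> j)"
        by (simp add: b'_def sum_distrib_right)
    qed
    also have "\<dots> = minor_det (\<lambda>i j. \<Sum>l<m. a i l * b' l j) {..<n} * of_real (\<Prod>i<n. \<beta> i)"
      by (rule minor_det_scale_columns)
    finally have "norm (minor_det (\<lambda>i j. \<Sum>l<m. a i l * b l j) {..<n})
      = norm (minor_det (\<lambda>i j. \<Sum>l<m. a i l * b' l j) {..<n}) * (\<Prod>i<n. \<beta> i)"
      using \<beta>0 by (simp add: norm_mult abs_of_nonneg prod_nonneg flip: of_real_prod)
    also have "\<dots> \<le> (\<Prod>i<n. exp (1 / 2) * \<alpha> i) * (\<Prod>i<n. \<beta> i)"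
      using le \<beta>0 by (intro mult_right_mono) (auto intro!: prod_nonneg)
    finally show ?thesis by (simp add: prod.distrib \<alpha>_def \<beta>_def mult_ac)
  qed
qed

lemma minor_det_product_le:
  fixes a b :: "nat \<Rightarrow> nat \<Rightarrow> complex"
  assumes S: "finite S"
  shows "norm (minor_det (\<lambda>i j. \<Sum>l<m. a i l * b l j) S)
    \<le> (\<Prod>i\<in>S. exp (1 / 2) * (L2_set (\<lambda>l. norm (a i l)) {..<m} * L2_set (\<lambda>l. norm (b l i)) {..<m}))"
proof -
  obtain f where f: "bij_betw f {..<card S} S"
    using ex_bij_betw_nat_finite[OF S] by (auto simp: atLeast0LessThan)
  show ?thesis
    unfolding minor_det_bij[OF f finite_lessThan] prod.reindex_bij_betw[OF f, symmetric]
    by (rule minor_det_product_le_lessThan)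
qed

lemma sum_Pow_prod_eq:
  fixes x :: "'a \<Rightarrow> real"
  assumes "finite A"
  shows "(\<Sum>S\<in>Pow A. \<Prod>i\<in>S. x i) = (\<Prod>i\<in>A. 1 + x i)"
  using Groups_Big.prod_add[OF assms, of x "\<lambda>_. 1"] by (simp add: add.commute)

lemma prod_one_plus_le_exp:
  fixes x :: "'a \<Rightarrow> real"
  assumes "\<And>i. i \<in> A \<Longrightarrow> 0 \<le> x i" "finite A"
  shows "(\<Prod>i\<in>A. 1 + x i) \<le> exp (\<Sum>i\<in>A. x i)"
  unfolding exp_sum[OF assms(2)]
  by (intro prod_mono) (auto intro: exp_ge_add_one_self add_nonneg_nonneg assms(1))

section \<open>Exterior traces of factored matrices\<close>

lemma sum_mult_L2_set_le:
  assumes "\<And>i. i \<in> I \<Longrightarrow> 0 \<le> f i" "\<And>i. i \<in> I \<Longrightarrow> 0 \<le> g i"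
    and "(\<Sum>i\<in>I. (f i)\<^sup>2) \<le> A" "(\<Sum>i\<in>I. (g i)\<^sup>2) \<le> B"
  shows "(\<Sum>i\<in>I. f i * g i) \<le> sqrt (A * B)"
proof -
  have "(\<Sum>i\<in>I. f i * g i) = (\<Sum>i\<in>I. \<bar>f i\<bar> * \<bar>g i\<bar>)"
    using assms(1,2) by (intro sum.cong) auto
  also have "\<dots> \<le> L2_set f I * L2_set g I" by (rule L2_set_mult_ineq)
  also have "\<dots> \<le> sqrt A * sqrt B"
    unfolding L2_set_def using assms(3,4)
    by (intro mult_mono) (auto intro: real_sqrt_le_mono sum_nonneg order_trans[OF sum_nonneg assms(3)])
  finally show ?thesis by (simp add: real_sqrt_mult)
qed

text \<open>Cauchy--Schwarz bounds the first \<open>M\<close> entries of each approximation by the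
  two Hilbert--Schmidt norms; the bound is independent of \<open>m\<close>, so it survives the limit
  in \<open>m\<close> at fixed \<open>M\<close>. The factors may come from two different bases, as
  \<open>trace_class\<close> requires.\<close>

lemma summable_factored_entries:
  fixes t :: "nat \<Rightarrow> complex" and a b :: "nat \<Rightarrow> nat \<Rightarrow> nat \<Rightarrow> complex"
  assumes conv: "\<And>i. (\<lambda>m. \<Sum>l<L m. a m i l * b m l i) \<longlonglongrightarrow> t i"
    and A: "\<And>m M. (\<Sum>i<M. \<Sum>l<L m. (norm (a m i l))\<^sup>2) \<le> A"
    and B: "\<And>m M. (\<Sum>i<M. \<Sum>l<L m. (norm (b m l i))\<^sup>2) \<le> B"
  shows "summable (\<lambda>i. norm (t i))"
proof (rule summableI_nonneg_bounded)
  fix M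
  show "(\<Sum>i<M. norm (t i)) \<le> sqrt (A * B)"
  proof (rule LIMSEQ_le_const2)
    show "(\<lambda>m. \<Sum>i<M. norm (\<Sum>l<L m. a m i l * b m l i)) \<longlonglongrightarrow> (\<Sum>i<M. norm (t i))"
      by (intro tendsto_intros conv)
    have "(\<Sum>i<M. norm (\<Sum>l<L m. a m i l * b m l i)) \<le> sqrt (A * B)" for m
    proof -
      have "(\<Sum>i<M. norm (\<Sum>l<L m. a m i l * b m l i))
        \<le> (\<Sum>i<M. L2_set (\<lambda>l. norm (a m i l)) {..<L m} * L2_set (\<lambda>l. norm (b m l i)) {..<L m})"
      proof (rule sum_mono)
        fix i
        have "norm (\<Sum>l<L m. a m i l * b m l i) \<le> (\<Sum>l<L m. \<bar>norm (a m i l)\<bar> * \<bar>norm (b m l i)\<bar>)"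
          by (rule order_trans[OF norm_sum]) (simp add: norm_mult)
        also have "\<dots> \<le> L2_set (\<lambda>l. norm (a m i l)) {..<L m} * L2_set (\<lambda>l. norm (b m l i)) {..<L m}"
          by (rule L2_set_mult_ineq)
        finally show "norm (\<Sum>l<L m. a m i l * b m l i)
          \<le> L2_set (\<lambda>l. norm (a m i l)) {..<L m} * L2_set (\<lambda>l. norm (b m l i)) {..<L m}" .
      qed
      also have "\<dots> \<le> sqrt (A * B)"
        using A[where m = m and M = M] B[where m = m and M = M] by (intro sum_mult_L2_set_le) (auto simp: L2_set_def sum_nonneg)
      finally show ?thesis .
    qed
    then show "\<exists>N. \<forall>m\<ge>N. (\<Sum>i<M. norm (\<Sum>l<L m. a m i l * b m l i)) \<le> sqrt (A * B)" by blast
  qed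
qed auto

text \<open>
  The tail bound is uniform in \<open>m\<close>, so the limits over the truncation \<open>N\<close> of the index set and over
  the approximations \<open>m\<close> may be interchanged.
\<close>
lemma exterior_traces_sums:
  fixes k :: "nat \<Rightarrow> nat \<Rightarrow> complex" and a b :: "nat \<Rightarrow> nat \<Rightarrow> nat \<Rightarrow> complex" and L :: "nat \<Rightarrow> nat"
  defines "km \<equiv> \<lambda>m i j. \<Sum>l<L m. a m i l * b m l j"
  assumes conv: "\<And>i j. (\<lambda>m. km m i j) \<longlonglongrightarrow> k i j"
    and tail: "\<And>m N M. (\<Sum>i\<in>{N..<M}. \<Sum>l<L m. (norm (a m i l))\<^sup>2) \<le> \<tau> N" and \<tau>: "\<tau> \<longlonglongrightarrow> 0"
    and bnd: "\<And>m M. (\<Sum>j<M. \<Sum>l<L m. (norm (b m l j))\<^sup>2) \<le> C"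
    and fin: "\<And>m. (\<lambda>N. minor_det (\<lambda>i j. (if i = j then 1 else 0) - km m i j) {..<N}) \<longlonglongrightarrow> d m"
    and d: "d \<longlonglongrightarrow> D"
  shows "(\<lambda>n. (-1) ^ n * (\<Sum>\<^sub>\<infinity>S\<in>{S. finite S \<and> card S = n}. minor_det k S)) sums D"
proof -
  \<comment> \<open>The bound of \<open>minor_det_product_le\<close> is multiplicative in
    \<open>S\<close>: \<open>x m i\<close> is the factor of the index \<open>i\<close>, and
    \<open>\<sigma> N\<close> bounds the sum of these factors from \<open>N\<close> on.\<close>
  define x where "x m i = exp (1 / 2) * (L2_set (\<lambda>l. norm (a m i l)) {..<L m} * L2_set (\<lambda>l. norm (b m l i)) {..<L m})" for m i
  define \<sigma> where "\<sigma> N = exp (1 / 2) * sqrt (\<tau> N * C)" for N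
  have x0: "0 \<le> x m i" for m i by (simp add: x_def)
  have xsum: "(\<Sum>i\<in>{N..<M}. x m i) \<le> \<sigma> N" for m N M
  proof -
    have "(\<Sum>i\<in>{N..<M}. \<Sum>l<L m. (norm (b m l i))\<^sup>2) \<le> (\<Sum>i<M. \<Sum>l<L m. (norm (b m l i))\<^sup>2)"
      by (intro sum_mono2) (auto intro!: sum_nonneg)
    then have "(\<Sum>i\<in>{N..<M}. \<Sum>l<L m. (norm (b m l i))\<^sup>2) \<le> C" using bnd[where m = m and M = M] by linarith
    then show ?thesis
      unfolding x_def \<sigma>_def sum_distrib_left[symmetric] using tail[where m = m and M = M and N = N]
      by (intro mult_left_mono sum_mult_L2_set_le) (auto simp: L2_set_def sum_nonneg)
  qed
  have xsum0: "(\<Sum>i<M. x m i) \<le> \<sigma> 0" for m M using xsum[where m = m and N = 0 and M = M] by (simp add: atLeast0LessThan)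
  have \<sigma>: "\<sigma> \<longlonglongrightarrow> 0"
  proof -
    have "(\<lambda>N. exp (1 / 2) * sqrt (\<tau> N * C)) \<longlonglongrightarrow> exp (1 / 2) * sqrt (0 * C)"
      by (intro tendsto_intros \<tau>)
    then show ?thesis by (simp add: \<sigma>_def[abs_def])
  qed
  \<comment> \<open>Minors over sets that leave \<open>{..<N}\<close> sum to at most a difference of
    two products of \<open>1 + x\<close>: the product of the first \<open>N\<close> factors is at
    most \<open>exp (\<sigma> 0)\<close>, and that of the remaining ones exceeds one by at most
    \<open>exp (\<sigma> N) - 1\<close>.\<close>
  define \<epsilon> where "\<epsilon> N = exp (\<sigma> 0) * (exp (\<sigma> N) - 1)" for N
  have \<epsilon>: "\<epsilon> \<longlonglongrightarrow> 0"
  proof -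
    have "(\<lambda>N. exp (\<sigma> 0) * (exp (\<sigma> N) - 1)) \<longlonglongrightarrow> exp (\<sigma> 0) * (exp 0 - 1)"
      by (intro tendsto_intros \<sigma>)
    then show ?thesis by (simp add: \<epsilon>_def[abs_def])
  qed
  have md: "norm (minor_det (km m) S) \<le> (\<Prod>i\<in>S. x m i)" if "finite S" for m S
    unfolding km_def x_def by (rule minor_det_product_le[OF that])
  define det where "det kk N = minor_det (\<lambda>i j. (if i = j then 1 else 0) - kk i j) {..<N}"
    for kk :: "nat \<Rightarrow> nat \<Rightarrow> complex" and N
  have det_eq: "det kk N = (\<Sum>S\<in>Pow {..<N}. (-1) ^ card S * minor_det kk S)" for kk N
    unfolding det_def by (rule minor_det_one_minus) simp
  have diff: "norm (det (km m) M - det (km m) N) \<le> \<epsilon> N" if NM: "N \<le> M" for m N M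
  proof -
    have sub: "Pow {..<N} \<subseteq> Pow {..<M}" using NM by auto
    have "det (km m) M - det (km m) N = (\<Sum>S\<in>Pow {..<M} - Pow {..<N}. (-1) ^ card S * minor_det (km m) S)"
      unfolding det_eq by (subst sum_diff[OF _ sub]) auto
    also have "norm \<dots> \<le> (\<Sum>S\<in>Pow {..<M} - Pow {..<N}. \<Prod>i\<in>S. x m i)"
      by (intro sum_norm_le) (auto simp: norm_mult norm_power intro!: md intro: finite_subset)
    also have "\<dots> = (\<Prod>i<M. 1 + x m i) - (\<Prod>i<N. 1 + x m i)"
      by (subst sum_diff[OF _ sub]) (auto simp: sum_Pow_prod_eq)
    also have "(\<Prod>i<M. 1 + x m i) = (\<Prod>i<N. 1 + x m i) * (\<Prod>i\<in>{N..<M}. 1 + x m i)"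
      using NM by (subst prod.union_disjoint[symmetric]) (auto intro!: prod.cong)
    also have "(\<Prod>i<N. 1 + x m i) * (\<Prod>i\<in>{N..<M}. 1 + x m i) - (\<Prod>i<N. 1 + x m i)
      = (\<Prod>i<N. 1 + x m i) * ((\<Prod>i\<in>{N..<M}. 1 + x m i) - 1)" by (simp add: algebra_simps)
    also have "\<dots> \<le> exp (\<sigma> 0) * (exp (\<sigma> N) - 1)"
    proof (intro mult_mono)
      show "(\<Prod>i<N. 1 + x m i) \<le> exp (\<sigma> 0)"
        by (rule order_trans[OF prod_one_plus_le_exp]) (use xsum0[where m = m and M = N] x0 in auto)
      have "(\<Prod>i\<in>{N..<M}. 1 + x m i) \<le> exp (\<sigma> N)"
        by (rule order_trans[OF prod_one_plus_le_exp]) (use xsum[where m = m and N = N and M = M] x0 in auto)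
      then show "(\<Prod>i\<in>{N..<M}. 1 + x m i) - 1 \<le> exp (\<sigma> N) - 1" by simp
      show "0 \<le> (\<Prod>i\<in>{N..<M}. 1 + x m i) - 1" using x0 by (simp add: prod_ge_1)
    qed auto
    finally show ?thesis by (simp add: \<epsilon>_def)
  qed
  have dN: "norm (d m - det (km m) N) \<le> \<epsilon> N" for m N
  proof (rule LIMSEQ_le_const2)
    show "(\<lambda>M. norm (det (km m) M - det (km m) N)) \<longlonglongrightarrow> norm (d m - det (km m) N)"
      using fin[of m] by (intro tendsto_intros) (simp add: det_def)
    show "\<exists>M0. \<forall>M\<ge>M0. norm (det (km m) M - det (km m) N) \<le> \<epsilon> N" using diff by blast
  qed
  have mk: "(\<lambda>m. minor_det (km m) S) \<longlonglongrightarrow> minor_det k S" for S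
    by (intro tendsto_minor_det conv)
  \<comment> \<open>For fixed \<open>N\<close> only finitely many minors pass to the limit in
    \<open>m\<close>, and the error bound of \<open>dN\<close> does not depend on
    \<open>m\<close>.\<close>
  have DN: "norm (D - det k N) \<le> \<epsilon> N" for N
  proof (rule LIMSEQ_le_const2)
    have "(\<lambda>m. det (km m) N) \<longlonglongrightarrow> det k N"
      unfolding det_eq by (intro tendsto_intros mk)
    then show "(\<lambda>m. norm (d m - det (km m) N)) \<longlonglongrightarrow> norm (D - det k N)"
      by (intro tendsto_intros d)
    show "\<exists>m0. \<forall>m\<ge>m0. norm (d m - det (km m) N) \<le> \<epsilon> N" using dN by blast
  qed
  have limD: "(\<lambda>N. det k N) \<longlonglongrightarrow> D"
  proof -
    have "(\<lambda>N. D - det k N) \<longlonglongrightarrow> 0"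
      by (rule Lim_null_comparison[OF _ \<epsilon>]) (use DN in auto)
    then have "(\<lambda>N. D - (D - det k N)) \<longlonglongrightarrow> D - 0" by (intro tendsto_intros)
    then show ?thesis by simp
  qed
  define F where "F = {S :: nat set. finite S}"
  define f where "f S = (-1) ^ card S * minor_det k S" for S
  have nf: "norm (f S) = norm (minor_det k S)" for S by (simp add: f_def norm_mult norm_power)
  \<comment> \<open>Absolute summability over all finite sets, on which the regrouping by
    cardinality rests.\<close>
  have bound: "(\<Sum>S\<in>Pow {..<M}. norm (f S)) \<le> exp (\<sigma> 0)" for M
  proof (rule LIMSEQ_le_const2)
    show "(\<lambda>m. \<Sum>S\<in>Pow {..<M}. norm (minor_det (km m) S)) \<longlonglongrightarrow> (\<Sum>S\<in>Pow {..<M}. norm (f S))"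
      unfolding nf by (intro tendsto_intros mk)
    have "(\<Sum>S\<in>Pow {..<M}. norm (minor_det (km m) S)) \<le> exp (\<sigma> 0)" for m
    proof -
      have "(\<Sum>S\<in>Pow {..<M}. norm (minor_det (km m) S)) \<le> (\<Sum>S\<in>Pow {..<M}. \<Prod>i\<in>S. x m i)"
        by (intro sum_mono md) (auto intro: finite_subset)
      also have "\<dots> \<le> exp (\<sigma> 0)"
        unfolding sum_Pow_prod_eq[OF finite_lessThan]
        by (rule order_trans[OF prod_one_plus_le_exp]) (use xsum0[where m = m and M = M] x0 in auto)
      finally show ?thesis .
    qed
    then show "\<exists>m0. \<forall>m\<ge>m0. (\<Sum>S\<in>Pow {..<M}. norm (minor_det (km m) S)) \<le> exp (\<sigma> 0)" by blast
  qed
  have cover: "\<exists>M. X \<subseteq> Pow {..<M}" if "finite X" "X \<subseteq> F" for X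
  proof -
    have "finite (\<Union>X)" using that by (auto simp: F_def)
    then obtain M where "\<Union>X \<subseteq> {..<M}" using finite_nat_iff_bounded by blast
    then show ?thesis by blast
  qed
  have abs: "(\<lambda>S. norm (f S)) summable_on F"
  proof (rule nonneg_bdd_above_summable_on)
    show "bdd_above (sum (\<lambda>S. norm (f S)) ` {X. X \<subseteq> F \<and> finite X})"
    proof (rule bdd_aboveI2)
      fix X assume "X \<in> {X. X \<subseteq> F \<and> finite X}"
      then obtain M where "X \<subseteq> Pow {..<M}" using cover by blast
      then have "sum (\<lambda>S. norm (f S)) X \<le> (\<Sum>S\<in>Pow {..<M}. norm (f S))"
        by (intro sum_mono2) auto
      then show "sum (\<lambda>S. norm (f S)) X \<le> exp (\<sigma> 0)" using bound[of M] by linarith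
    qed
  qed simp
  then have summ: "f summable_on F" by (rule abs_summable_summable)
  \<comment> \<open>The sets \<open>Pow {..<N}\<close> are cofinal among the finite collections of
    finite sets, so the unordered sum is the limit of the truncated determinants.\<close>
  have lim: "filterlim (\<lambda>N. Pow {..<N}) (finite_subsets_at_top F) sequentially"
    unfolding filterlim_def le_filter_def eventually_filtermap eventually_finite_subsets_at_top
  proof (intro allI impI, elim exE conjE)
    fix P X assume X: "finite X" "X \<subseteq> F" and P: "\<forall>Y. finite Y \<and> X \<subseteq> Y \<and> Y \<subseteq> F \<longrightarrow> P Y"
    obtain M where M: "X \<subseteq> Pow {..<M}" using cover[OF X] by blast
    show "\<forall>\<^sub>F N in sequentially. P (Pow {..<N})"
    proof (rule eventually_sequentiallyI[of M])
      fix N assume "M \<le> N"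
      then have "Pow {..<M} \<subseteq> Pow {..<N}" by auto
      with M have "X \<subseteq> Pow {..<N}" by (rule order_trans)
      moreover have "finite (Pow {..<N})" "Pow {..<N} \<subseteq> F"
        by (auto simp: F_def intro: finite_subset)
      ultimately show "P (Pow {..<N})" using P[rule_format, of "Pow {..<N}"] by metis
    qed
  qed
  have "(f has_sum infsum f F) F" using summ by simp
  then have "(\<lambda>N. \<Sum>S\<in>Pow {..<N}. f S) \<longlonglongrightarrow> infsum f F"
    unfolding has_sum_def using filterlim_compose[OF _ lim] by blast
  moreover have "(\<lambda>N. \<Sum>S\<in>Pow {..<N}. f S) \<longlonglongrightarrow> D"
    using limD by (simp add: det_eq f_def)
  ultimately have "infsum f F = D" by (rule LIMSEQ_unique)
  then have hs: "(f has_sum D) F" using summ by (simp add: has_sum_iff)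
  define B where "B n = {S :: nat set. finite S \<and> card S = n}" for n
  have BF: "B n \<subseteq> F" for n by (auto simp: B_def F_def)
  have "((\<lambda>(n, S). f S) has_sum D) (Sigma UNIV B)"
    using hs by (subst has_sum_reindex_bij_witness[of _ "\<lambda>S. (card S, S)" snd F f]) (auto simp: B_def F_def)
  then have "((\<lambda>n. infsum f (B n)) has_sum D) UNIV"
    by (rule has_sum_SigmaD) (use summable_on_subset_banach[OF summ BF] in auto)
  then have "(\<lambda>n. infsum f (B n)) sums D" by (rule has_sum_imp_sums)
  moreover have "infsum f (B n) = (-1) ^ n * infsum (minor_det k) (B n)" for n
  proof -
    have "infsum f (B n) = infsum (\<lambda>S. (-1) ^ n * minor_det k S) (B n)"
      by (rule infsum_cong) (auto simp: f_def B_def)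
    then show ?thesis by (simp add: infsum_cmult_right')
  qed
  ultimately show ?thesis by (simp add: B_def)
qed

section \<open>Square integrable functions\<close>

lemma finite_measure_Leb: "finite_measure (Leb \<omega>)"
  by (rule finite_measure_lebesgue_on) auto

lemma L2_iff: "f \<in> L2 \<omega> \<longleftrightarrow> f \<in> borel_measurable (Leb \<omega>) \<and> integrable (Leb \<omega>) (\<lambda>x. (norm (f x))\<^sup>2)"
  by (simp add: L2_def)

lemma L2_borel [measurable_dest]: "f \<in> L2 \<omega> \<Longrightarrow> f \<in> borel_measurable (Leb \<omega>)"
  by (simp add: L2_def)

lemma L2_bound:
  assumes "f \<in> borel_measurable (Leb \<omega>)" "g \<in> L2 \<omega>" "AE x in Leb \<omega>. norm (f x) \<le> c * norm (g x)"
  shows "f \<in> L2 \<omega>"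
  unfolding L2_iff
proof
  have "integrable (Leb \<omega>) (\<lambda>x. c\<^sup>2 * (norm (g x))\<^sup>2)" using assms(2) by (simp add: L2_iff)
  then show "integrable (Leb \<omega>) (\<lambda>x. (norm (f x))\<^sup>2)"
    by (rule Bochner_Integration.integrable_bound)
      (use assms in \<open>auto elim!: eventually_mono simp flip: power_mult_distrib intro: power_mono\<close>)
qed (rule assms)

lemma borel_measurable_cnj [measurable (raw)]:
  "f \<in> borel_measurable M \<Longrightarrow> (\<lambda>x. cnj (f x)) \<in> borel_measurable M"
  by (rule borel_measurable_continuous_on[OF continuous_on_cnj[OF continuous_on_id]])

lemma L2_cnj: "f \<in> L2 \<omega> \<Longrightarrow> (\<lambda>x. cnj (f x)) \<in> L2 \<omega>"
  by (auto simp: L2_iff)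

lemma L2_scale: "f \<in> L2 \<omega> \<Longrightarrow> (\<lambda>x. c * f x) \<in> L2 \<omega>"
  by (auto simp: L2_iff norm_mult power_mult_distrib)

lemma L2_add:
  assumes "f \<in> L2 \<omega>" "g \<in> L2 \<omega>"
  shows "(\<lambda>x. f x + g x) \<in> L2 \<omega>"
  unfolding L2_iff
proof
  show "(\<lambda>x. f x + g x) \<in> borel_measurable (Leb \<omega>)" using assms by (auto simp: L2_iff)
  have "integrable (Leb \<omega>) (\<lambda>x. 2 * (norm (f x))\<^sup>2 + 2 * (norm (g x))\<^sup>2)"
    using assms by (auto simp: L2_iff)
  then show "integrable (Leb \<omega>) (\<lambda>x. (norm (f x + g x))\<^sup>2)"
  proof (rule Bochner_Integration.integrable_bound)
    have "(norm (f x + g x))\<^sup>2 \<le> 2 * (norm (f x))\<^sup>2 + 2 * (norm (g x))\<^sup>2" for x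
    proof -
      have "(norm (f x + g x))\<^sup>2 \<le> (norm (f x) + norm (g x))\<^sup>2"
        by (intro power_mono norm_triangle_ineq) auto
      also have "\<dots> \<le> 2 * (norm (f x))\<^sup>2 + 2 * (norm (g x))\<^sup>2"
        using sum_squares_bound[of "norm (f x)" "norm (g x)"] by (simp add: power2_sum)
      finally show ?thesis .
    qed
    then show "AE x in Leb \<omega>. norm ((norm (f x + g x))\<^sup>2) \<le> norm (2 * (norm (f x))\<^sup>2 + 2 * (norm (g x))\<^sup>2)"
      by (intro AE_I2) (simp add: abs_of_nonneg)
  qed (use assms in \<open>auto simp: L2_iff\<close>)
qed

lemma L2_zero: "(\<lambda>x. 0) \<in> L2 \<omega>" by (simp add: L2_iff)

lemma L2_diff: "f \<in> L2 \<omega> \<Longrightarrow> g \<in> L2 \<omega> \<Longrightarrow> (\<lambda>x. f x - g x) \<in> L2 \<omega>"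
  using L2_add[of f \<omega> "\<lambda>x. (-1) * g x"] L2_scale[of g \<omega> "-1"] by simp

lemma L2_sum: "(\<And>i. i \<in> I \<Longrightarrow> f i \<in> L2 \<omega>) \<Longrightarrow> (\<lambda>x. \<Sum>i\<in>I. f i x) \<in> L2 \<omega>"
  by (induction I rule: infinite_finite_induct) (auto intro: L2_add L2_zero)

lemma L2_mult_integrable:
  assumes "f \<in> L2 \<omega>" "g \<in> L2 \<omega>"
  shows "integrable (Leb \<omega>) (\<lambda>x. f x * g x)"
proof (rule Bochner_Integration.integrable_bound)
  show "integrable (Leb \<omega>) (\<lambda>x. (norm (f x))\<^sup>2 + (norm (g x))\<^sup>2)" using assms by (auto simp: L2_iff)
  have "norm (f x * g x) \<le> norm ((norm (f x))\<^sup>2 + (norm (g x))\<^sup>2)" for x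
  proof -
    have "norm (f x * g x) \<le> 2 * (norm (f x) * norm (g x))" by (simp add: norm_mult)
    also have "\<dots> \<le> (norm (f x))\<^sup>2 + (norm (g x))\<^sup>2"
      using sum_squares_bound[of "norm (f x)" "norm (g x)"] by (simp add: mult.assoc)
    finally show ?thesis by simp
  qed
  then show "AE x in Leb \<omega>. norm (f x * g x) \<le> norm ((norm (f x))\<^sup>2 + (norm (g x))\<^sup>2)" by simp
qed (use assms in \<open>auto simp: L2_iff\<close>)

lemma L2_bounded_measurable:
  assumes "f \<in> borel_measurable (Leb \<omega>)" "\<And>x. x \<in> {0<..<\<omega>} \<Longrightarrow> norm (f x) \<le> c"
  shows "f \<in> L2 \<omega>"
proof -
  interpret finite_measure "Leb \<omega>" by (rule finite_measure_Leb)
  have "(\<lambda>x. 1) \<in> L2 \<omega>" by (simp add: L2_iff)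
  then show ?thesis
    by (rule L2_bound[OF assms(1), where c = c]) (use assms(2) in \<open>auto intro!: AE_I2\<close>)
qed

lemma L2_integrable:
  assumes "f \<in> L2 \<omega>"
  shows "integrable (Leb \<omega>) f"
proof -
  have "(\<lambda>x. 1) \<in> L2 \<omega>" by (rule L2_bounded_measurable[where c = 1]) auto
  from L2_mult_integrable[OF assms this] show ?thesis by simp
qed

lemma l2_norm_nonneg [simp]: "0 \<le> l2_norm \<omega> f"
  by (simp add: l2_norm_def integral_nonneg_AE)

lemma l2_norm_sq: "(l2_norm \<omega> f)\<^sup>2 = (LINT x|Leb \<omega>. (norm (f x))\<^sup>2)"
  by (simp add: l2_norm_def integral_nonneg_AE)

lemma l2_norm_cong_AE:
  assumes "AE x in Leb \<omega>. f x = g x" "f \<in> borel_measurable (Leb \<omega>)" "g \<in> borel_measurable (Leb \<omega>)"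
  shows "l2_norm \<omega> f = l2_norm \<omega> g"
  unfolding l2_norm_def using assms by (intro arg_cong[where f = sqrt] integral_cong_AE) auto

lemma l2_norm_mono:
  assumes "f \<in> borel_measurable (Leb \<omega>)" "g \<in> L2 \<omega>" "AE x in Leb \<omega>. norm (f x) \<le> norm (g x)"
  shows "l2_norm \<omega> f \<le> l2_norm \<omega> g"
  unfolding l2_norm_def
proof (intro real_sqrt_le_mono integral_mono_AE)
  have "f \<in> L2 \<omega>" using L2_bound[OF assms(1,2), of 1] assms(3) by simp
  then show "integrable (Leb \<omega>) (\<lambda>x. (norm (f x))\<^sup>2)" by (simp add: L2_iff)
qed (use assms in \<open>auto simp: L2_iff elim!: eventually_mono\<close>)

lemma l2_norm_scale: "l2_norm \<omega> (\<lambda>x. c * f x) = norm c * l2_norm \<omega> f"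
  by (simp add: l2_norm_def norm_mult power_mult_distrib real_sqrt_mult)

lemma l2_norm_eq_0_iff:
  assumes "f \<in> L2 \<omega>"
  shows "l2_norm \<omega> f = 0 \<longleftrightarrow> (AE x in Leb \<omega>. f x = 0)"
  using assms unfolding l2_norm_def L2_iff real_sqrt_eq_0_iff
  by (subst integral_nonneg_eq_0_iff_AE) auto

lemma L2_cauchy_schwarz:
  assumes "f \<in> L2 \<omega>" "g \<in> L2 \<omega>"
  shows "(LINT x|Leb \<omega>. norm (f x * g x)) \<le> l2_norm \<omega> f * l2_norm \<omega> g"
proof -
  have [measurable]: "f \<in> borel_measurable (Leb \<omega>)" "g \<in> borel_measurable (Leb \<omega>)" using assms by (auto simp: L2_iff)
  have sq: "(\<integral>\<^sup>+x. (ennreal (norm (h x)))\<^sup>2 \<partial>Leb \<omega>) = ennreal ((l2_norm \<omega> h)\<^sup>2)" if "h \<in> L2 \<omega>" for h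
  proof -
    have "(\<integral>\<^sup>+x. (ennreal (norm (h x)))\<^sup>2 \<partial>Leb \<omega>) = (\<integral>\<^sup>+x. ennreal ((norm (h x))\<^sup>2) \<partial>Leb \<omega>)"
      by (simp add: ennreal_power)
    also have "\<dots> = ennreal (LINT x|Leb \<omega>. (norm (h x))\<^sup>2)"
      using that by (intro nn_integral_eq_integral) (auto simp: L2_iff)
    finally show ?thesis by (simp add: l2_norm_sq)
  qed
  have "ennreal ((LINT x|Leb \<omega>. norm (f x * g x))\<^sup>2) = (\<integral>\<^sup>+x. ennreal (norm (f x * g x)) \<partial>Leb \<omega>)\<^sup>2"
    using L2_mult_integrable[OF assms]
    by (subst nn_integral_eq_integral) (auto simp: ennreal_power integral_nonneg_AE)
  also have "\<dots> = (\<integral>\<^sup>+x. ennreal (norm (f x)) * ennreal (norm (g x)) \<partial>Leb \<omega>)\<^sup>2"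
    by (simp add: norm_mult ennreal_mult)
  also have "\<dots> \<le> ennreal ((l2_norm \<omega> f)\<^sup>2) * ennreal ((l2_norm \<omega> g)\<^sup>2)"
    unfolding sq[OF assms(1), symmetric] sq[OF assms(2), symmetric]
    by (rule Cauchy_Schwarz_nn_integral) auto
  also have "\<dots> = ennreal ((l2_norm \<omega> f * l2_norm \<omega> g)\<^sup>2)"
    by (simp add: ennreal_mult power_mult_distrib)
  finally have "(LINT x|Leb \<omega>. norm (f x * g x))\<^sup>2 \<le> (l2_norm \<omega> f * l2_norm \<omega> g)\<^sup>2"
    by (subst (asm) ennreal_le_iff) auto
  then show ?thesis by (rule power2_le_imp_le) simp
qed

lemma l2_inner_le:
  assumes "f \<in> L2 \<omega>" "g \<in> L2 \<omega>"
  shows "norm (l2_inner \<omega> f g) \<le> l2_norm \<omega> f * l2_norm \<omega> g"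
proof -
  have "norm (l2_inner \<omega> f g) \<le> (LINT x|Leb \<omega>. norm (cnj (f x) * g x))"
    unfolding l2_inner_def by (rule integral_norm_bound)
  also have "\<dots> \<le> l2_norm \<omega> (\<lambda>x. cnj (f x)) * l2_norm \<omega> g"
    by (rule L2_cauchy_schwarz[OF L2_cnj[OF assms(1)] assms(2)])
  finally show ?thesis by (simp add: l2_norm_def)
qed

lemma l2_inner_self: "l2_inner \<omega> f f = of_real ((l2_norm \<omega> f)\<^sup>2)"
  unfolding l2_norm_sq l2_inner_def integral_complex_of_real[symmetric]
  by (intro Bochner_Integration.integral_cong refl) (simp add: complex_norm_square mult.commute del: of_real_power)

lemma l2_inner_commute: "l2_inner \<omega> g f = cnj (l2_inner \<omega> f g)"
  unfolding l2_inner_def by (subst Bochner_Integration.integral_cnj[symmetric]) (simp add: mult.commute)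

lemma l2_inner_add_right:
  assumes "f \<in> L2 \<omega>" "g \<in> L2 \<omega>" "h \<in> L2 \<omega>"
  shows "l2_inner \<omega> f (\<lambda>x. g x + h x) = l2_inner \<omega> f g + l2_inner \<omega> f h"
  unfolding l2_inner_def distrib_left
  by (intro Bochner_Integration.integral_add L2_mult_integrable L2_cnj assms)

lemma l2_inner_diff_right:
  assumes "f \<in> L2 \<omega>" "g \<in> L2 \<omega>" "h \<in> L2 \<omega>"
  shows "l2_inner \<omega> f (\<lambda>x. g x - h x) = l2_inner \<omega> f g - l2_inner \<omega> f h"
  unfolding l2_inner_def right_diff_distrib
  by (intro Bochner_Integration.integral_diff L2_mult_integrable L2_cnj assms)

lemma l2_inner_scale_right: "l2_inner \<omega> f (\<lambda>x. c * g x) = c * l2_inner \<omega> f g"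
  unfolding l2_inner_def by (subst integral_mult_right_zero[symmetric]) (simp add: mult_ac)

lemma l2_inner_sum_right:
  assumes "f \<in> L2 \<omega>" "\<And>i. i \<in> I \<Longrightarrow> g i \<in> L2 \<omega>"
  shows "l2_inner \<omega> f (\<lambda>x. \<Sum>i\<in>I. c i * g i x) = (\<Sum>i\<in>I. c i * l2_inner \<omega> f (g i))"
  using assms(2)
proof (induction I rule: infinite_finite_induct)
  case (insert j I)
  then show ?case
    by (simp add: l2_inner_add_right[OF assms(1) L2_scale L2_sum] L2_scale l2_inner_scale_right)
qed (auto simp: l2_inner_def)

lemma l2_inner_cong_AE:
  assumes "AE x in Leb \<omega>. g x = h x" "f \<in> L2 \<omega>" "g \<in> L2 \<omega>" "h \<in> L2 \<omega>"
  shows "l2_inner \<omega> f g = l2_inner \<omega> f h"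
  unfolding l2_inner_def
  by (intro integral_cong_AE) (use assms in \<open>auto simp: L2_iff elim!: eventually_mono\<close>)

lemma l2_norm_triangle:
  assumes "f \<in> L2 \<omega>" "g \<in> L2 \<omega>"
  shows "l2_norm \<omega> (\<lambda>x. f x + g x) \<le> l2_norm \<omega> f + l2_norm \<omega> g"
proof (rule power2_le_imp_le)
  have eq: "(a + b)\<^sup>2 = a\<^sup>2 + a * b + (b * a + b\<^sup>2)" for a b :: real
    by (simp add: power2_eq_square algebra_simps)
  have fg: "(\<lambda>x. f x + g x) \<in> L2 \<omega>" by (rule L2_add[OF assms])
  have "(l2_norm \<omega> (\<lambda>x. f x + g x))\<^sup>2 = norm (l2_inner \<omega> (\<lambda>x. f x + g x) (\<lambda>x. f x + g x))"
    by (simp add: l2_inner_self norm_power)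
  also have "l2_inner \<omega> (\<lambda>x. f x + g x) (\<lambda>x. f x + g x)
    = cnj (l2_inner \<omega> f (\<lambda>x. f x + g x)) + cnj (l2_inner \<omega> g (\<lambda>x. f x + g x))"
    unfolding l2_inner_add_right[OF fg assms] by (simp only: l2_inner_commute[of \<omega> "\<lambda>x. f x + g x", symmetric])
  also have "\<dots> = cnj (l2_inner \<omega> f f) + cnj (l2_inner \<omega> f g) + (cnj (l2_inner \<omega> g f) + cnj (l2_inner \<omega> g g))"
    by (simp add: l2_inner_add_right assms)
  also have "norm \<dots> \<le> (l2_norm \<omega> f)\<^sup>2 + l2_norm \<omega> f * l2_norm \<omega> g + (l2_norm \<omega> g * l2_norm \<omega> f + (l2_norm \<omega> g)\<^sup>2)"
    by (intro order_trans[OF norm_triangle_ineq] add_mono)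
      (auto simp: l2_inner_self norm_power l2_inner_le assms)
  finally show "(l2_norm \<omega> (\<lambda>x. f x + g x))\<^sup>2 \<le> (l2_norm \<omega> f + l2_norm \<omega> g)\<^sup>2"
    by (simp only: eq)
  show "0 \<le> l2_norm \<omega> f + l2_norm \<omega> g" by (intro add_nonneg_nonneg l2_norm_nonneg)
qed

lemma l2_norm_minus_commute: "l2_norm \<omega> (\<lambda>x. f x - g x) = l2_norm \<omega> (\<lambda>x. g x - f x)"
  unfolding l2_norm_def by (subst norm_minus_commute) (rule refl)

lemma l2_norm_triangle_diff:
  assumes "f \<in> L2 \<omega>" "g \<in> L2 \<omega>" "h \<in> L2 \<omega>"
  shows "l2_norm \<omega> (\<lambda>x. f x - h x) \<le> l2_norm \<omega> (\<lambda>x. f x - g x) + l2_norm \<omega> (\<lambda>x. g x - h x)"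
proof -
  have "(\<lambda>x. f x - h x) = (\<lambda>x. (f x - g x) + (g x - h x))" by (rule ext) simp
  moreover have "l2_norm \<omega> (\<lambda>x. (f x - g x) + (g x - h x))
    \<le> l2_norm \<omega> (\<lambda>x. f x - g x) + l2_norm \<omega> (\<lambda>x. g x - h x)"
    by (intro l2_norm_triangle L2_diff assms)
  ultimately show ?thesis by simp
qed

section \<open>Completeness and orthonormal expansions\<close>

lemma nn_integral_norm_sq:
  assumes "f \<in> L2 \<omega>"
  shows "(\<integral>\<^sup>+x. ennreal ((norm (f x))\<^sup>2) \<partial>Leb \<omega>) = ennreal ((l2_norm \<omega> f)\<^sup>2)"
  unfolding l2_norm_sq using assms by (intro nn_integral_eq_integral) (auto simp: L2_iff)

text \<open>A rapidly convergent subsequence converges almost everywhere, and Fatou's lemma turns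
  the Cauchy bound into convergence in norm. Completeness is what makes an orthonormal basis,
  defined only by totality, give expansions.\<close>

lemma L2_complete:
  assumes s: "\<And>n. s n \<in> L2 \<omega>"
    and cauchy: "\<And>\<epsilon>. 0 < \<epsilon> \<Longrightarrow> \<exists>N. \<forall>m\<ge>N. \<forall>n\<ge>N. l2_norm \<omega> (\<lambda>x. s m x - s n x) \<le> \<epsilon>"
  shows "\<exists>h\<in>L2 \<omega>. (\<lambda>n. l2_norm \<omega> (\<lambda>x. s n x - h x)) \<longlonglongrightarrow> 0"
proof -
  have sb[measurable]: "s n \<in> borel_measurable (Leb \<omega>)" for n using s by (simp add: L2_iff)
  have "\<forall>k. \<exists>N. \<forall>m\<ge>N. \<forall>n\<ge>N. l2_norm \<omega> (\<lambda>x. s m x - s n x) \<le> (1/2) ^ k"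
    by (intro allI cauchy) simp
  then obtain N where N: "l2_norm \<omega> (\<lambda>x. s m x - s n x) \<le> (1/2) ^ k" if "N k \<le> m" "N k \<le> n" for k m n
    by metis
  \<comment> \<open>Increasing indices that dominate \<open>N j\<close> for all
    \<open>j \<le> k\<close>; the summand \<open>k\<close> gives \<open>k \<le> r k\<close>, by
    which the Fatou argument leaves every fixed \<open>M\<close> behind.\<close>
  define r where "r k = k + (\<Sum>j\<le>k. N j)" for k
  have rN: "N k \<le> r k" for k
    unfolding r_def by (rule trans_le_add2[OF member_le_sum]) auto
  have r_mono: "r k \<le> r l" if "k \<le> l" for k l
    unfolding r_def using that by (intro add_mono sum_mono2) auto
  have rk: "N k \<le> r l" if "k \<le> l" for k l using rN[of k] r_mono[OF that] by linarith
  define d where "d k x = s (r (Suc k)) x - s (r k) x" for k x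
  have d: "d k \<in> L2 \<omega>" for k unfolding d_def by (intro L2_diff s)
  have [measurable]: "d k \<in> borel_measurable (Leb \<omega>)" for k using d by (simp add: L2_iff)
  \<comment> \<open>The interval has finite measure, so pairing with the constant 1 turns the norm
    bounds into summable integrals of the increments.\<close>
  have one: "(\<lambda>x. 1) \<in> L2 \<omega>" by (rule L2_bounded_measurable[where c = 1]) auto
  have dint: "(\<integral>\<^sup>+x. ennreal (norm (d k x)) \<partial>Leb \<omega>) \<le> ennreal (l2_norm \<omega> (\<lambda>x. 1) * (1/2) ^ k)" for k
  proof -
    have "(LINT x|Leb \<omega>. norm (1 * d k x)) \<le> l2_norm \<omega> (\<lambda>x. 1) * l2_norm \<omega> (d k)"
      by (rule L2_cauchy_schwarz[OF one d])
    also have "\<dots> \<le> l2_norm \<omega> (\<lambda>x. 1) * (1/2) ^ k"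
      using N[of k "r (Suc k)" "r k"] rk[of k "Suc k"] rk[of k k]
      by (intro mult_left_mono) (auto simp: d_def[abs_def])
    finally have "(LINT x|Leb \<omega>. norm (d k x)) \<le> l2_norm \<omega> (\<lambda>x. 1) * (1/2) ^ k" by simp
    moreover have "(\<integral>\<^sup>+x. ennreal (norm (d k x)) \<partial>Leb \<omega>) = ennreal (LINT x|Leb \<omega>. norm (d k x))"
      using L2_integrable[OF d] by (intro nn_integral_eq_integral) auto
    ultimately show ?thesis by (simp add: ennreal_leI)
  qed
  have "(\<integral>\<^sup>+x. (\<Sum>k. ennreal (norm (d k x))) \<partial>Leb \<omega>) = (\<Sum>k. \<integral>\<^sup>+x. ennreal (norm (d k x)) \<partial>Leb \<omega>)"
    by (rule nn_integral_suminf) simp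
  also have "\<dots> \<le> (\<Sum>k. ennreal (l2_norm \<omega> (\<lambda>x. 1) * (1/2) ^ k))"
    by (intro suminf_le dint) auto
  also have "\<dots> < \<infinity>"
    by (subst suminf_ennreal2) (auto intro!: summable_mult summable_geometric)
  finally have "AE x in Leb \<omega>. (\<Sum>k. ennreal (norm (d k x))) \<noteq> \<infinity>"
    by (intro nn_integral_PInf_AE) (auto simp: less_top)
  then have AEsum: "AE x in Leb \<omega>. summable (\<lambda>k. norm (d k x))"
    by eventually_elim (auto intro!: summable_suminf_not_top)
  have conv: "convergent (\<lambda>k. s (r k) x)" if "summable (\<lambda>k. norm (d k x))" for x
  proof -
    have "summable (\<lambda>k. d k x)" by (rule summable_norm_cancel[OF that])
    then have "(\<lambda>n. \<Sum>k<n. d k x) \<longlonglongrightarrow> (\<Sum>k. d k x)" by (rule summable_LIMSEQ)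
    moreover have "(\<Sum>k<n. d k x) = s (r n) x - s (r 0) x" for n
      unfolding d_def by (rule sum_lessThan_telescope)
    ultimately have "(\<lambda>n. s (r n) x - s (r 0) x) \<longlonglongrightarrow> (\<Sum>k. d k x)" by simp
    from tendsto_add[OF this tendsto_const[of "s (r 0) x"]] show ?thesis
      by (auto simp: convergent_def)
  qed
  define h where "h x = lim (\<lambda>k. s (r k) x)" for x
  have [measurable]: "h \<in> borel_measurable (Leb \<omega>)"
    unfolding h_def by (rule borel_measurable_lim_metric) simp
  have hlim: "AE x in Leb \<omega>. (\<lambda>k. s (r k) x) \<longlonglongrightarrow> h x"
    using AEsum by eventually_elim (simp add: h_def conv convergent_LIMSEQ_iff[symmetric])
  have fatou: "(\<integral>\<^sup>+x. ennreal ((norm (s n x - h x))\<^sup>2) \<partial>Leb \<omega>) \<le> ennreal (\<epsilon>\<^sup>2)"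
    if M: "\<forall>m\<ge>M. \<forall>n\<ge>M. l2_norm \<omega> (\<lambda>x. s m x - s n x) \<le> \<epsilon>" and n: "n \<ge> M" for n M \<epsilon>
  proof -
    have "(\<integral>\<^sup>+x. ennreal ((norm (s n x - h x))\<^sup>2) \<partial>Leb \<omega>)
      = (\<integral>\<^sup>+x. liminf (\<lambda>k. ennreal ((norm (s n x - s (r k) x))\<^sup>2)) \<partial>Leb \<omega>)"
    proof (rule nn_integral_cong_AE)
      show "AE x in Leb \<omega>. ennreal ((norm (s n x - h x))\<^sup>2) = liminf (\<lambda>k. ennreal ((norm (s n x - s (r k) x))\<^sup>2))"
        using hlim
      proof eventually_elim
        case (elim x)
        have "(\<lambda>k. ennreal ((norm (s n x - s (r k) x))\<^sup>2)) \<longlonglongrightarrow> ennreal ((norm (s n x - h x))\<^sup>2)"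
          by (intro tendsto_intros elim)
        then show ?case by (intro lim_imp_Liminf[symmetric]) auto
      qed
    qed
    also have "\<dots> \<le> liminf (\<lambda>k. \<integral>\<^sup>+x. ennreal ((norm (s n x - s (r k) x))\<^sup>2) \<partial>Leb \<omega>)"
      by (rule nn_integral_liminf) simp
    also have "\<dots> \<le> liminf (\<lambda>k. ennreal (\<epsilon>\<^sup>2))"
    proof (rule Liminf_mono, rule eventually_sequentiallyI[of M])
      fix k assume "M \<le> k"
      then have "l2_norm \<omega> (\<lambda>x. s n x - s (r k) x) \<le> \<epsilon>" using M n by (auto simp: r_def)
      then show "(\<integral>\<^sup>+x. ennreal ((norm (s n x - s (r k) x))\<^sup>2) \<partial>Leb \<omega>) \<le> ennreal (\<epsilon>\<^sup>2)"
        by (subst nn_integral_norm_sq) (auto intro!: L2_diff s ennreal_leI power_mono)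
    qed
    finally show ?thesis by (simp add: Liminf_const)
  qed
  obtain M1 where M1: "\<forall>m\<ge>M1. \<forall>n\<ge>M1. l2_norm \<omega> (\<lambda>x. s m x - s n x) \<le> 1"
    using cauchy[of 1] by auto
  have "(\<lambda>x. s M1 x - h x) \<in> L2 \<omega>"
    unfolding L2_iff
  proof
    show "integrable (Leb \<omega>) (\<lambda>x. (norm (s M1 x - h x))\<^sup>2)"
      using fatou[OF M1 order_refl] by (intro integrableI_nonneg) (auto simp: le_less_trans)
  qed simp
  from L2_diff[OF s[of M1] this] have h: "h \<in> L2 \<omega>" by simp
  have "(\<lambda>n. l2_norm \<omega> (\<lambda>x. s n x - h x)) \<longlonglongrightarrow> 0"
  proof (rule LIMSEQ_I)
    fix e :: real assume e: "0 < e"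
    obtain M where M: "\<forall>m\<ge>M. \<forall>n\<ge>M. l2_norm \<omega> (\<lambda>x. s m x - s n x) \<le> e / 2"
      using cauchy[of "e / 2"] e by auto
    have "norm (l2_norm \<omega> (\<lambda>x. s n x - h x) - 0) < e" if "n \<ge> M" for n
    proof -
      have "ennreal ((l2_norm \<omega> (\<lambda>x. s n x - h x))\<^sup>2) \<le> ennreal ((e / 2)\<^sup>2)"
        using fatou[OF M that] by (subst (asm) nn_integral_norm_sq) (auto intro!: L2_diff s h)
      then have "(l2_norm \<omega> (\<lambda>x. s n x - h x))\<^sup>2 \<le> (e / 2)\<^sup>2" by (subst (asm) ennreal_le_iff) auto
      then have "l2_norm \<omega> (\<lambda>x. s n x - h x) \<le> e / 2" by (rule power2_le_imp_le) (use e in auto)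
      then show ?thesis using e by simp
    qed
    then show "\<exists>M. \<forall>n\<ge>M. norm (l2_norm \<omega> (\<lambda>x. s n x - h x) - 0) < e" by blast
  qed
  with h show ?thesis by blast
qed

lemma l2_norm_sq_orthonormal_sum:
  assumes e: "orthonormal_basis \<omega> e" and I: "finite I"
  shows "(l2_norm \<omega> (\<lambda>x. \<Sum>i\<in>I. c i * e i x))\<^sup>2 = (\<Sum>i\<in>I. (norm (c i))\<^sup>2)"
proof -
  have eL: "e i \<in> L2 \<omega>" and eo: "l2_inner \<omega> (e i) (e j) = (if i = j then 1 else 0)" for i j
    using e by (auto simp: orthonormal_basis_def)
  let ?s = "\<lambda>x. \<Sum>i\<in>I. c i * e i x"
  have sL: "?s \<in> L2 \<omega>" by (intro L2_sum L2_scale eL)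
  have 1: "l2_inner \<omega> (e j) ?s = c j" if "j \<in> I" for j
    using I that by (simp add: l2_inner_sum_right[OF eL eL] eo if_distrib[of "\<lambda>x. _ * x"] cong: if_cong)
  have "l2_inner \<omega> ?s ?s = (\<Sum>i\<in>I. c i * cnj (l2_inner \<omega> (e i) ?s))"
    by (simp add: l2_inner_sum_right[OF sL eL] l2_inner_commute[of \<omega> ?s, symmetric])
  also have "\<dots> = (\<Sum>i\<in>I. of_real ((norm (c i))\<^sup>2))"
    by (intro sum.cong refl) (simp add: 1 complex_norm_square del: of_real_power)
  finally have "complex_of_real ((l2_norm \<omega> ?s)\<^sup>2) = of_real (\<Sum>i\<in>I. (norm (c i))\<^sup>2)"
    by (simp add: l2_inner_self del: of_real_power)
  then show ?thesis using of_real_eq_iff by blast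
qed

text \<open>The projection \<open>?s\<close> satisfies \<open>l2_inner \<omega> f ?s = B\<close> and
  has squared norm \<open>B\<close>, so Cauchy--Schwarz gives
  \<open>B \<le> l2_norm \<omega> f * sqrt B\<close>.\<close>

lemma bessel_inequality:
  assumes e: "orthonormal_basis \<omega> e" and I: "finite I" and f: "f \<in> L2 \<omega>"
  shows "(\<Sum>i\<in>I. (norm (l2_inner \<omega> (e i) f))\<^sup>2) \<le> (l2_norm \<omega> f)\<^sup>2"
proof -
  have eL: "e i \<in> L2 \<omega>" for i using e by (auto simp: orthonormal_basis_def)
  let ?c = "\<lambda>i. l2_inner \<omega> (e i) f"
  let ?s = "\<lambda>x. \<Sum>i\<in>I. ?c i * e i x"
  define B where "B = (\<Sum>i\<in>I. (norm (?c i))\<^sup>2)"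
  have sL: "?s \<in> L2 \<omega>" by (intro L2_sum L2_scale eL)
  have "l2_inner \<omega> f ?s = (\<Sum>i\<in>I. ?c i * cnj (?c i))"
    by (simp add: l2_inner_sum_right[OF f eL] l2_inner_commute[of \<omega> f, symmetric])
  also have "\<dots> = of_real B" by (simp add: B_def complex_norm_square[symmetric])
  finally have "l2_inner \<omega> f ?s = of_real B" .
  moreover have B0: "0 \<le> B" by (simp add: B_def sum_nonneg)
  ultimately have "B = norm (l2_inner \<omega> f ?s)" by simp
  also have "\<dots> \<le> l2_norm \<omega> f * l2_norm \<omega> ?s" by (rule l2_inner_le[OF f sL])
  also have "l2_norm \<omega> ?s = sqrt B"
    using l2_norm_sq_orthonormal_sum[OF e I, of ?c] by (simp add: B_def real_sqrt_unique)
  finally have *: "B \<le> l2_norm \<omega> f * sqrt B" .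
  show ?thesis
  proof (cases "B = 0")
    case False
    then have "0 < sqrt B" using B0 by simp
    moreover have "sqrt B * sqrt B \<le> l2_norm \<omega> f * sqrt B" using * B0 by simp
    ultimately have "sqrt B \<le> l2_norm \<omega> f" by (rule mult_right_le_imp_le[rotated])
    then have "(sqrt B)\<^sup>2 \<le> (l2_norm \<omega> f)\<^sup>2" by (intro power_mono) (auto simp: B0)
    then show ?thesis using B0 by (simp add: B_def)
  qed (simp flip: B_def)
qed

text \<open>The partial sums are Cauchy by Bessel's inequality and converge by completeness; the
  limit has the same coefficients as \<open>f\<close>, so totality identifies the two.\<close>

lemma orthonormal_basis_expansion:
  assumes e: "orthonormal_basis \<omega> e" and f: "f \<in> L2 \<omega>"
  shows "(\<lambda>N. l2_norm \<omega> (\<lambda>x. f x - (\<Sum>i<N. l2_inner \<omega> (e i) f * e i x))) \<longlonglongrightarrow> 0"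
proof -
  have eL: "e i \<in> L2 \<omega>" and eo: "l2_inner \<omega> (e i) (e j) = (if i = j then 1 else 0)" for i j
    using e by (auto simp: orthonormal_basis_def)
  define c where "c i = l2_inner \<omega> (e i) f" for i
  define s where "s N x = (\<Sum>i<N. c i * e i x)" for N x
  have sL: "s N \<in> L2 \<omega>" for N unfolding s_def[abs_def] by (intro L2_sum L2_scale eL)
  have "summable (\<lambda>i. (norm (c i))\<^sup>2)"
    by (rule summableI_nonneg_bounded[where x = "(l2_norm \<omega> f)\<^sup>2"])
      (auto simp: c_def intro: bessel_inequality[OF e _ f])
  then have C: "Cauchy (\<lambda>N. \<Sum>i<N. (norm (c i))\<^sup>2)"
    by (simp add: summable_iff_convergent Cauchy_convergent_iff)
  have sdiff: "(l2_norm \<omega> (\<lambda>x. s m x - s n x))\<^sup>2 = (\<Sum>i<m. (norm (c i))\<^sup>2) - (\<Sum>i<n. (norm (c i))\<^sup>2)"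
    if "n \<le> m" for m n
  proof -
    have "(\<lambda>x. s m x - s n x) = (\<lambda>x. \<Sum>i\<in>{n..<m}. c i * e i x)"
      unfolding s_def using that by (auto simp: lessThan_atLeast0 sum_diff_nat_ivl)
    then show ?thesis
      using that by (simp add: l2_norm_sq_orthonormal_sum[OF e] lessThan_atLeast0 sum_diff_nat_ivl)
  qed
  have "\<exists>N. \<forall>m\<ge>N. \<forall>n\<ge>N. l2_norm \<omega> (\<lambda>x. s m x - s n x) \<le> \<epsilon>" if \<epsilon>: "0 < \<epsilon>" for \<epsilon>
  proof -
    obtain N where N: "\<And>m n. m \<ge> N \<Longrightarrow> n \<ge> N \<Longrightarrow> norm ((\<Sum>i<m. (norm (c i))\<^sup>2) - (\<Sum>i<n. (norm (c i))\<^sup>2)) < \<epsilon>\<^sup>2"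
      using CauchyD[OF C, of "\<epsilon>\<^sup>2"] \<epsilon> by auto
    have le: "l2_norm \<omega> (\<lambda>x. s m x - s n x) \<le> \<epsilon>" if "n \<ge> N" "n \<le> m" for m n
    proof (rule power2_le_imp_le)
      show "(l2_norm \<omega> (\<lambda>x. s m x - s n x))\<^sup>2 \<le> \<epsilon>\<^sup>2"
        unfolding sdiff[OF that(2)] using N[of m n] that by auto
    qed (use \<epsilon> in simp)
    have "l2_norm \<omega> (\<lambda>x. s m x - s n x) \<le> \<epsilon>" if "m \<ge> N" "n \<ge> N" for m n
      using le[of n m] le[of m n] that l2_norm_minus_commute[of \<omega> "s m" "s n"] by (cases "n \<le> m") auto
    then show ?thesis by blast
  qed
  then obtain h where h: "h \<in> L2 \<omega>" and lim: "(\<lambda>n. l2_norm \<omega> (\<lambda>x. s n x - h x)) \<longlonglongrightarrow> 0"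
    using L2_complete[of s \<omega>, OF sL] by blast
  have "l2_inner \<omega> (e i) (\<lambda>x. f x - h x) = 0" for i
  proof -
    have "(\<lambda>n. l2_inner \<omega> (e i) (\<lambda>x. s n x - h x)) \<longlonglongrightarrow> 0"
    proof (rule Lim_null_comparison)
      show "\<forall>\<^sub>F n in sequentially. norm (l2_inner \<omega> (e i) (\<lambda>x. s n x - h x)) \<le> l2_norm \<omega> (e i) * l2_norm \<omega> (\<lambda>x. s n x - h x)"
        by (intro always_eventually allI l2_inner_le eL L2_diff sL h)
      show "(\<lambda>n. l2_norm \<omega> (e i) * l2_norm \<omega> (\<lambda>x. s n x - h x)) \<longlonglongrightarrow> 0"
        using tendsto_mult_right_zero[OF lim] by simp
    qed
    moreover have "\<forall>\<^sub>F n in sequentially. l2_inner \<omega> (e i) (\<lambda>x. s n x - h x) = l2_inner \<omega> (e i) (\<lambda>x. f x - h x)"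
    proof (rule eventually_sequentiallyI[of "Suc i"])
      fix n assume "Suc i \<le> n"
      then have "l2_inner \<omega> (e i) (s n) = c i"
        unfolding s_def[abs_def]
        by (simp add: l2_inner_sum_right[OF eL eL] eo if_distrib[of "\<lambda>x. _ * x"] cong: if_cong)
      then show "l2_inner \<omega> (e i) (\<lambda>x. s n x - h x) = l2_inner \<omega> (e i) (\<lambda>x. f x - h x)"
        by (simp add: l2_inner_diff_right eL sL h f c_def)
    qed
    ultimately have "(\<lambda>n. l2_inner \<omega> (e i) (\<lambda>x. f x - h x)) \<longlonglongrightarrow> 0"
      by (rule Lim_transform_eventually)
    then show ?thesis by (simp add: LIMSEQ_const_iff)
  qed
  then have "AE x in Leb \<omega>. f x - h x = 0"
    using e L2_diff[OF f h] unfolding orthonormal_basis_def by blast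
  then have "l2_norm \<omega> (\<lambda>x. f x - s n x) = l2_norm \<omega> (\<lambda>x. s n x - h x)" for n
    unfolding l2_norm_minus_commute[of \<omega> f]
    by (intro l2_norm_cong_AE borel_measurable_diff L2_borel sL h f) (auto elim!: eventually_mono)
  with lim show ?thesis by (simp add: s_def c_def)
qed

lemma parseval_identity:
  assumes e: "orthonormal_basis \<omega> e" and f: "f \<in> L2 \<omega>" and g: "g \<in> L2 \<omega>"
  shows "(\<lambda>N. \<Sum>i<N. l2_inner \<omega> g (e i) * l2_inner \<omega> (e i) f) \<longlonglongrightarrow> l2_inner \<omega> g f"
proof -
  have eL: "e i \<in> L2 \<omega>" for i using e by (auto simp: orthonormal_basis_def)
  let ?s = "\<lambda>N x. \<Sum>i<N. l2_inner \<omega> (e i) f * e i x"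
  have sL: "?s N \<in> L2 \<omega>" for N by (intro L2_sum L2_scale eL)
  have "(\<lambda>N. l2_inner \<omega> g (\<lambda>x. f x - ?s N x)) \<longlonglongrightarrow> 0"
  proof (rule Lim_null_comparison)
    show "\<forall>\<^sub>F N in sequentially. norm (l2_inner \<omega> g (\<lambda>x. f x - ?s N x)) \<le> l2_norm \<omega> g * l2_norm \<omega> (\<lambda>x. f x - ?s N x)"
      by (intro always_eventually allI l2_inner_le g L2_diff sL f)
    show "(\<lambda>N. l2_norm \<omega> g * l2_norm \<omega> (\<lambda>x. f x - ?s N x)) \<longlonglongrightarrow> 0"
      using tendsto_mult_right_zero[OF orthonormal_basis_expansion[OF e f]] by simp
  qed
  then have "(\<lambda>N. l2_inner \<omega> g f - l2_inner \<omega> g (\<lambda>x. f x - ?s N x)) \<longlonglongrightarrow> l2_inner \<omega> g f - 0"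
    by (intro tendsto_intros)
  moreover have "l2_inner \<omega> g f - l2_inner \<omega> g (\<lambda>x. f x - ?s N x) = (\<Sum>i<N. l2_inner \<omega> g (e i) * l2_inner \<omega> (e i) f)" for N
    unfolding l2_inner_diff_right[OF g f sL] l2_inner_sum_right[OF g eL] by (simp add: mult.commute)
  ultimately show ?thesis by simp
qed

lemma parseval_tail:
  assumes e: "orthonormal_basis \<omega> e" and f: "f \<in> L2 \<omega>" and \<epsilon>: "0 < \<epsilon>"
  shows "\<exists>N0. \<forall>N\<ge>N0. \<forall>M. (\<Sum>i\<in>{N..<M}. (norm (l2_inner \<omega> (e i) f))\<^sup>2) \<le> \<epsilon>"
proof -
  have "summable (\<lambda>i. (norm (l2_inner \<omega> (e i) f))\<^sup>2)"
    by (rule summableI_nonneg_bounded[where x = "(l2_norm \<omega> f)\<^sup>2"])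
      (auto intro: bessel_inequality[OF e _ f])
  then obtain N0 where "\<forall>m\<ge>N0. \<forall>n. norm (\<Sum>i\<in>{m..<n}. (norm (l2_inner \<omega> (e i) f))\<^sup>2) < \<epsilon>"
    unfolding summable_Cauchy using \<epsilon> by blast
  then have "\<bar>\<Sum>i\<in>{N..<M}. (norm (l2_inner \<omega> (e i) f))\<^sup>2\<bar> < \<epsilon>" if "N \<ge> N0" for N M
    using that by (simp only: real_norm_def)
  then show ?thesis by (meson abs_ge_self less_imp_le order_trans)
qed

section \<open>Absolutely continuous functions\<close>

lemma abs_continuous_onE:
  assumes "abs_continuous_on s t f" "0 < \<epsilon>"
  obtains \<delta> where "0 < \<delta>" "\<And>(n::nat) a b. (\<And>i. i < n \<Longrightarrow> s \<le> a i \<and> a i \<le> b i \<and> b i \<le> t) \<Longrightarrow>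
    disjoint_family_on (\<lambda>i. {a i<..<b i}) {..<n} \<Longrightarrow> (\<Sum>i<n. b i - a i) < \<delta> \<Longrightarrow>
    (\<Sum>i<n. norm (f (b i) - f (a i))) < \<epsilon>"
proof -
  obtain \<delta> where \<delta>: "0 < \<delta>" and *: "\<forall>(n::nat) a b. (\<forall>i<n. s \<le> a i \<and> a i \<le> b i \<and> b i \<le> t) \<longrightarrow>
    disjoint_family_on (\<lambda>i. {a i<..<b i}) {..<n} \<longrightarrow> (\<Sum>i<n. b i - a i) < \<delta> \<longrightarrow>
    (\<Sum>i<n. norm (f (b i) - f (a i))) < \<epsilon>"
    using assms(1)[unfolded abs_continuous_on_def, THEN spec, THEN mp, OF assms(2)] by (elim exE conjE)
  show ?thesis
  proof (rule that[OF \<delta>])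
    fix n :: nat and a b :: "nat \<Rightarrow> real"
    assume "\<And>i. i < n \<Longrightarrow> s \<le> a i \<and> a i \<le> b i \<and> b i \<le> t"
      "disjoint_family_on (\<lambda>i. {a i<..<b i}) {..<n}" "(\<Sum>i<n. b i - a i) < \<delta>"
    then show "(\<Sum>i<n. norm (f (b i) - f (a i))) < \<epsilon>" by (intro *[rule_format]) auto
  qed
qed

lemma abs_continuous_on_subset:
  assumes f: "abs_continuous_on s t f" and "s \<le> s'" "t' \<le> t"
  shows "abs_continuous_on s' t' f"
  unfolding abs_continuous_on_def
proof (intro allI impI)
  fix \<epsilon> :: real assume \<epsilon>: "0 < \<epsilon>"
  from abs_continuous_onE[OF f \<epsilon>] obtain \<delta> where \<delta>: "0 < \<delta>" "\<And>(n::nat) a b. (\<And>i. i < n \<Longrightarrow> s \<le> a i \<and> a i \<le> b i \<and> b i \<le> t) \<Longrightarrow>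
    disjoint_family_on (\<lambda>i. {a i<..<b i}) {..<n} \<Longrightarrow> (\<Sum>i<n. b i - a i) < \<delta> \<Longrightarrow>
    (\<Sum>i<n. norm (f (b i) - f (a i))) < \<epsilon>" by blast
  show "\<exists>\<delta>>0. \<forall>(n::nat) a b. (\<forall>i<n. s' \<le> a i \<and> a i \<le> b i \<and> b i \<le> t') \<longrightarrow>
    disjoint_family_on (\<lambda>i. {a i<..<b i}) {..<n} \<longrightarrow> (\<Sum>i<n. b i - a i) < \<delta> \<longrightarrow>
    (\<Sum>i<n. norm (f (b i) - f (a i))) < \<epsilon>"
    by (intro exI[of _ \<delta>] conjI allI impI \<delta>) (use assms(2,3) in force)+
qed

lemma abs_continuous_on_imp_continuous_on:
  assumes "abs_continuous_on s t f"
  shows "continuous_on {s..t} f"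
  unfolding continuous_on_iff
proof (intro ballI allI impI)
  fix x and \<epsilon> :: real assume x: "x \<in> {s..t}" and \<epsilon>: "0 < \<epsilon>"
  obtain \<delta> where \<delta>: "0 < \<delta>" "\<And>(n::nat) a b. (\<And>i. i < n \<Longrightarrow> s \<le> a i \<and> a i \<le> b i \<and> b i \<le> t) \<Longrightarrow>
    disjoint_family_on (\<lambda>i. {a i<..<b i}) {..<n} \<Longrightarrow> (\<Sum>i<n. b i - a i) < \<delta> \<Longrightarrow>
    (\<Sum>i<n. norm (f (b i) - f (a i))) < \<epsilon>"
    using abs_continuous_onE[OF assms \<epsilon>] by blast
  have *: "norm (f v - f u) < \<epsilon>" if "s \<le> u" "u \<le> v" "v \<le> t" "v - u < \<delta>" for u v
    using \<delta>(2)[of 1 "\<lambda>_. u" "\<lambda>_. v"] that by (simp add: disjoint_family_on_def)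
  show "\<exists>d>0. \<forall>x'\<in>{s..t}. dist x' x < d \<longrightarrow> dist (f x') (f x) < \<epsilon>"
  proof (intro exI conjI ballI impI)
    show "0 < \<delta>" by fact
    fix y assume "y \<in> {s..t}" "dist y x < \<delta>"
    then show "dist (f y) (f x) < \<epsilon>"
      using *[of x y] *[of y x] x by (cases "x \<le> y") (auto simp: dist_norm norm_minus_commute)
  qed
qed

lemma abs_continuous_on_lipschitz:
  assumes "\<And>x y. x \<in> {s..t} \<Longrightarrow> y \<in> {s..t} \<Longrightarrow> norm (f x - f y) \<le> C * \<bar>x - y\<bar>"
  shows "abs_continuous_on s t f"
  unfolding abs_continuous_on_def
proof (intro allI impI)
  fix \<epsilon> :: real assume \<epsilon>: "0 < \<epsilon>"
  define B where "B = max C 1"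
  have B: "0 < B" "C \<le> B" by (auto simp: B_def)
  show "\<exists>\<delta>>0. \<forall>(n::nat) a b. (\<forall>i<n. s \<le> a i \<and> a i \<le> b i \<and> b i \<le> t) \<longrightarrow>
    disjoint_family_on (\<lambda>i. {a i<..<b i}) {..<n} \<longrightarrow> (\<Sum>i<n. b i - a i) < \<delta> \<longrightarrow>
    (\<Sum>i<n. norm (f (b i) - f (a i))) < \<epsilon>"
  proof (intro exI[of _ "\<epsilon> / B"] conjI allI impI)
    show "0 < \<epsilon> / B" using \<epsilon> B by simp
    fix n :: nat and a b :: "nat \<Rightarrow> real"
    assume ab: "\<forall>i<n. s \<le> a i \<and> a i \<le> b i \<and> b i \<le> t" and l: "(\<Sum>i<n. b i - a i) < \<epsilon> / B"
    have "(\<Sum>i<n. norm (f (b i) - f (a i))) \<le> (\<Sum>i<n. B * (b i - a i))"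
    proof (rule sum_mono)
      fix i assume "i \<in> {..<n}"
      then have i: "s \<le> a i" "a i \<le> b i" "b i \<le> t" using ab by auto
      have "norm (f (b i) - f (a i)) \<le> C * \<bar>b i - a i\<bar>" by (rule assms) (use i in auto)
      also have "\<dots> \<le> B * (b i - a i)" using B i by (simp add: mult_right_mono)
      finally show "norm (f (b i) - f (a i)) \<le> B * (b i - a i)" .
    qed
    also have "\<dots> < \<epsilon>" using l B unfolding sum_distrib_left[symmetric] by (simp add: pos_less_divide_eq mult.commute)
    finally show "(\<Sum>i<n. norm (f (b i) - f (a i))) < \<epsilon>" .
  qed
qed

lemma vector_derivative_bound_lipschitz:
  fixes f :: "real \<Rightarrow> complex"
  assumes "\<And>x. x \<in> {s..t} \<Longrightarrow> (f has_vector_derivative f' x) (at x within {s..t})"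
    and "\<And>x. x \<in> {s..t} \<Longrightarrow> norm (f' x) \<le> B"
    and "x \<in> {s..t}" "y \<in> {s..t}"
  shows "norm (f x - f y) \<le> B * \<bar>x - y\<bar>"
proof -
  have "norm (f x - f y) \<le> B * norm (x - y)"
  proof (rule differentiable_bound[where S = "{s..t}" and f' = "\<lambda>x h. h *\<^sub>R f' x"])
    fix x assume x: "x \<in> {s..t}"
    then show "(f has_derivative (\<lambda>h. h *\<^sub>R f' x)) (at x within {s..t})"
      using assms(1) by (simp add: has_vector_derivative_def)
    show "onorm (\<lambda>h. h *\<^sub>R f' x) \<le> B"
    proof (rule onorm_le)
      fix h
      show "norm (h *\<^sub>R f' x) \<le> B * norm h"
        using mult_right_mono[OF assms(2)[OF x], of "\<bar>h\<bar>"] by (simp add: mult.commute)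
    qed
  qed (use assms in auto)
  then show ?thesis by simp
qed

lemma abs_continuous_on_C1:
  assumes "\<And>x. x \<in> {s..t} \<Longrightarrow> (f has_vector_derivative f' x) (at x within {s..t})"
    and "continuous_on {s..t} f'"
  shows "abs_continuous_on s t f"
proof -
  have "bounded (f' ` {s..t})"
    by (intro compact_imp_bounded compact_continuous_image assms) simp
  then obtain B where "\<And>x. x \<in> {s..t} \<Longrightarrow> norm (f' x) \<le> B" unfolding bounded_iff by blast
  then show ?thesis
    by (intro abs_continuous_on_lipschitz[of _ _ _ B] vector_derivative_bound_lipschitz[OF assms(1)])
qed

lemma abs_continuous_on_add:
  assumes f: "abs_continuous_on s t f" and g: "abs_continuous_on s t g"
  shows "abs_continuous_on s t (\<lambda>x. f x + g x)"
  unfolding abs_continuous_on_def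
proof (intro allI impI)
  fix \<epsilon> :: real assume "0 < \<epsilon>"
  then have \<epsilon>: "0 < \<epsilon> / 2" by simp
  from abs_continuous_onE[OF f \<epsilon>] obtain \<delta>1 where \<delta>1: "0 < \<delta>1" "\<And>(n::nat) a b. (\<And>i. i < n \<Longrightarrow> s \<le> a i \<and> a i \<le> b i \<and> b i \<le> t) \<Longrightarrow>
    disjoint_family_on (\<lambda>i. {a i<..<b i}) {..<n} \<Longrightarrow> (\<Sum>i<n. b i - a i) < \<delta>1 \<Longrightarrow>
    (\<Sum>i<n. norm (f (b i) - f (a i))) < \<epsilon> / 2" by blast
  from abs_continuous_onE[OF g \<epsilon>] obtain \<delta>2 where \<delta>2: "0 < \<delta>2" "\<And>(n::nat) a b. (\<And>i. i < n \<Longrightarrow> s \<le> a i \<and> a i \<le> b i \<and> b i \<le> t) \<Longrightarrow>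
    disjoint_family_on (\<lambda>i. {a i<..<b i}) {..<n} \<Longrightarrow> (\<Sum>i<n. b i - a i) < \<delta>2 \<Longrightarrow>
    (\<Sum>i<n. norm (g (b i) - g (a i))) < \<epsilon> / 2" by blast
  show "\<exists>\<delta>>0. \<forall>(n::nat) a b. (\<forall>i<n. s \<le> a i \<and> a i \<le> b i \<and> b i \<le> t) \<longrightarrow>
    disjoint_family_on (\<lambda>i. {a i<..<b i}) {..<n} \<longrightarrow> (\<Sum>i<n. b i - a i) < \<delta> \<longrightarrow>
    (\<Sum>i<n. norm (f (b i) + g (b i) - (f (a i) + g (a i)))) < \<epsilon>"
  proof (intro exI[of _ "min \<delta>1 \<delta>2"] conjI allI impI)
    show "0 < min \<delta>1 \<delta>2" using \<delta>1 \<delta>2 by simp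
    fix n :: nat and a b :: "nat \<Rightarrow> real"
    assume ab: "\<forall>i<n. s \<le> a i \<and> a i \<le> b i \<and> b i \<le> t" and d: "disjoint_family_on (\<lambda>i. {a i<..<b i}) {..<n}"
      and l: "(\<Sum>i<n. b i - a i) < min \<delta>1 \<delta>2"
    have "(\<Sum>i<n. norm (f (b i) + g (b i) - (f (a i) + g (a i))))
      \<le> (\<Sum>i<n. norm (f (b i) - f (a i)) + norm (g (b i) - g (a i)))"
      by (intro sum_mono) (simp add: add_diff_add norm_triangle_ineq)
    also have "\<dots> < \<epsilon> / 2 + \<epsilon> / 2"
      unfolding sum.distrib using ab d l by (intro add_strict_mono \<delta>1(2) \<delta>2(2)) auto
    finally show "(\<Sum>i<n. norm (f (b i) + g (b i) - (f (a i) + g (a i)))) < \<epsilon>" by simp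
  qed
qed

lemma abs_continuous_on_mult:
  assumes f: "abs_continuous_on s t f" and g: "abs_continuous_on s t g"
  shows "abs_continuous_on s t (\<lambda>x. f x * g x)"
proof -
  have "bounded (f ` {s..t})" "bounded (g ` {s..t})"
    using f g by (auto intro!: compact_imp_bounded compact_continuous_image abs_continuous_on_imp_continuous_on)
  then obtain B1 B2 where B12: "\<And>x. x \<in> {s..t} \<Longrightarrow> norm (f x) \<le> B1" "\<And>x. x \<in> {s..t} \<Longrightarrow> norm (g x) \<le> B2"
    unfolding bounded_iff by blast
  define B where "B = max (max B1 B2) 1"
  have B: "0 < B" "\<And>x. x \<in> {s..t} \<Longrightarrow> norm (f x) \<le> B" "\<And>x. x \<in> {s..t} \<Longrightarrow> norm (g x) \<le> B"
    using B12 unfolding B_def by (auto simp: le_max_iff_disj)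
  show ?thesis
    unfolding abs_continuous_on_def
  proof (intro allI impI)
    fix \<epsilon> :: real assume "0 < \<epsilon>"
    then have \<epsilon>: "0 < \<epsilon> / (2 * B)" using B by simp
    from abs_continuous_onE[OF f \<epsilon>] obtain \<delta>1 where \<delta>1: "0 < \<delta>1" "\<And>(n::nat) a b. (\<And>i. i < n \<Longrightarrow> s \<le> a i \<and> a i \<le> b i \<and> b i \<le> t) \<Longrightarrow>
      disjoint_family_on (\<lambda>i. {a i<..<b i}) {..<n} \<Longrightarrow> (\<Sum>i<n. b i - a i) < \<delta>1 \<Longrightarrow>
      (\<Sum>i<n. norm (f (b i) - f (a i))) < \<epsilon> / (2 * B)" by blast
    from abs_continuous_onE[OF g \<epsilon>] obtain \<delta>2 where \<delta>2: "0 < \<delta>2" "\<And>(n::nat) a b. (\<And>i. i < n \<Longrightarrow> s \<le> a i \<and> a i \<le> b i \<and> b i \<le> t) \<Longrightarrow>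
      disjoint_family_on (\<lambda>i. {a i<..<b i}) {..<n} \<Longrightarrow> (\<Sum>i<n. b i - a i) < \<delta>2 \<Longrightarrow>
      (\<Sum>i<n. norm (g (b i) - g (a i))) < \<epsilon> / (2 * B)" by blast
    show "\<exists>\<delta>>0. \<forall>(n::nat) a b. (\<forall>i<n. s \<le> a i \<and> a i \<le> b i \<and> b i \<le> t) \<longrightarrow>
      disjoint_family_on (\<lambda>i. {a i<..<b i}) {..<n} \<longrightarrow> (\<Sum>i<n. b i - a i) < \<delta> \<longrightarrow>
      (\<Sum>i<n. norm (f (b i) * g (b i) - f (a i) * g (a i))) < \<epsilon>"
    proof (intro exI[of _ "min \<delta>1 \<delta>2"] conjI allI impI)
      show "0 < min \<delta>1 \<delta>2" using \<delta>1 \<delta>2 by simp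
      fix n :: nat and a b :: "nat \<Rightarrow> real"
      assume ab: "\<forall>i<n. s \<le> a i \<and> a i \<le> b i \<and> b i \<le> t" and d: "disjoint_family_on (\<lambda>i. {a i<..<b i}) {..<n}"
        and l: "(\<Sum>i<n. b i - a i) < min \<delta>1 \<delta>2"
      have "(\<Sum>i<n. norm (f (b i) * g (b i) - f (a i) * g (a i)))
        \<le> (\<Sum>i<n. B * norm (f (b i) - f (a i)) + B * norm (g (b i) - g (a i)))"
      proof (rule sum_mono)
        fix i assume "i \<in> {..<n}"
        then have i: "a i \<in> {s..t}" "b i \<in> {s..t}" using ab by (auto intro: order_trans)
        have "f (b i) * g (b i) - f (a i) * g (a i) = g (b i) * (f (b i) - f (a i)) + f (a i) * (g (b i) - g (a i))"
          by (simp add: algebra_simps)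
        also have "norm \<dots> \<le> norm (g (b i)) * norm (f (b i) - f (a i)) + norm (f (a i)) * norm (g (b i) - g (a i))"
          by (rule order_trans[OF norm_triangle_ineq]) (simp add: norm_mult)
        also have "\<dots> \<le> B * norm (f (b i) - f (a i)) + B * norm (g (b i) - g (a i))"
          using B i by (intro add_mono mult_right_mono) auto
        finally show "norm (f (b i) * g (b i) - f (a i) * g (a i)) \<le> B * norm (f (b i) - f (a i)) + B * norm (g (b i) - g (a i))" .
      qed
      also have "\<dots> = B * (\<Sum>i<n. norm (f (b i) - f (a i))) + B * (\<Sum>i<n. norm (g (b i) - g (a i)))"
        by (simp add: sum.distrib sum_distrib_left)
      also have "\<dots> < B * (\<epsilon> / (2 * B)) + B * (\<epsilon> / (2 * B))"
        using ab d l B(1) by (intro add_strict_mono mult_strict_left_mono \<delta>1(2) \<delta>2(2)) auto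
      finally show "(\<Sum>i<n. norm (f (b i) * g (b i) - f (a i) * g (a i))) < \<epsilon>" using B(1) by simp
    qed
  qed
qed

text \<open>
  The Henstock--Kurzweil integral gives this directly: tags off the exceptional set are handled by
  the straddle estimate, tags in it by absolute continuity, the gauge there being a small open cover.
\<close>
theorem abs_continuous_on_ftc:
  assumes AC: "abs_continuous_on s t F" and st: "s \<le> t" and E: "negligible E"
    and der: "\<And>x. x \<in> {s..t} - E \<Longrightarrow> (F has_vector_derivative f x) (at x within {s..t})"
  shows "(f has_integral F t - F s) {s..t}"
proof -
  show ?thesis
  proof (cases "s = t")
    case True
    then show ?thesis using has_integral_refl(2)[of f s] by simp
  next
    case False
    then have lt: "s < t" using st by simp
  \<comment> \<open>With the value 0 on \<open>E\<close>, a tag in \<open>E\<close> contributes only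
    the increment of \<open>F\<close> over its interval.\<close>
  define f0 where "f0 x = (if x \<in> E then 0 else f x)" for x
  have "(f0 has_integral F t - F s) {s..t}"
    unfolding has_integral_factor_content_real
  proof (intro allI impI)
    fix e :: real assume e: "0 < e"
      \<comment> \<open>Half of the permitted error \<open>e * (t - s)\<close>; the other half goes
        to the tags outside \<open>E\<close>.\<close>
      define \<epsilon> where "\<epsilon> = e / 2 * (t - s)"
      have \<epsilon>: "0 < \<epsilon>" using e lt by (simp add: \<epsilon>_def)
      obtain \<delta> where \<delta>: "0 < \<delta>" "\<And>(n::nat) a b. (\<And>i. i < n \<Longrightarrow> s \<le> a i \<and> a i \<le> b i \<and> b i \<le> t) \<Longrightarrow>
        disjoint_family_on (\<lambda>i. {a i<..<b i}) {..<n} \<Longrightarrow> (\<Sum>i<n. b i - a i) < \<delta> \<Longrightarrow>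
        (\<Sum>i<n. norm (F (b i) - F (a i))) < \<epsilon>"
        using abs_continuous_onE[OF AC \<epsilon>] by blast
      have E0: "E \<in> sets lebesgue" "emeasure lebesgue E = 0"
        using E by (auto simp: negligible_iff_null_sets null_sets_def)
      \<comment> \<open>Outer regularity: \<open>U - E\<close> has measure below \<delta> and
        \<open>E\<close> is null, so disjoint intervals inside \<open>U\<close> have total length
        below \<delta>.\<close>
      obtain U where U: "open U" "E \<subseteq> U" "U - E \<in> lmeasurable" "emeasure lebesgue (U - E) < ennreal \<delta>"
        using sets_lebesgue_outer_open[OF E0(1) \<delta>(1)] by blast
      have Us: "U \<in> sets lebesgue" using U(1) by (simp add: borel_open)
      have emU: "emeasure lebesgue U < ennreal \<delta>"
        using U(4) E0 Us by (simp add: emeasure_Diff_null_set null_sets_def)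
      have Um1: "U \<in> lmeasurable"
        by (rule fmeasurableI[OF Us]) (use emU in \<open>auto intro: order.strict_trans\<close>)
      have Um2: "measure lebesgue U < \<delta>"
        using emU \<delta>(1) by (simp add: emeasure_eq_measure2[OF Um1] ennreal_less_iff)
      have "\<exists>d>0. \<forall>y\<in>{s..t}. \<bar>y - x\<bar> < d \<longrightarrow> norm (F y - F x - (y - x) *\<^sub>R f x) \<le> e / 2 * \<bar>y - x\<bar>"
        if "x \<in> {s..t} - E" for x
        using der[OF that] e unfolding has_vector_derivative_def has_derivative_within_alt
        by (metis half_gt_zero real_norm_def)
      then obtain D where D: "\<And>x. x \<in> {s..t} - E \<Longrightarrow> 0 < D x"
        "\<And>x y. x \<in> {s..t} - E \<Longrightarrow> y \<in> {s..t} \<Longrightarrow> \<bar>y - x\<bar> < D x \<Longrightarrow> norm (F y - F x - (y - x) *\<^sub>R f x) \<le> e / 2 * \<bar>y - x\<bar>"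
        by metis
      define d where "d x = (if x \<in> E then U else if x \<in> {s..t} then ball x (D x) else ball x 1)" for x
      have gd: "gauge d" using U D by (auto simp: gauge_def d_def)
      have main: "norm ((\<Sum>(x, k)\<in>p. measure lborel k *\<^sub>R f0 x) - (F t - F s)) \<le> e * measure lborel {s..t}"
        if p: "p tagged_division_of {s..t}" and fine: "d fine p" for p
      proof -
        have fp: "finite p" using p by auto
        have pk: "\<exists>a b. k = {a..b} \<and> a \<le> x \<and> x \<le> b \<and> {a..b} \<subseteq> {s..t} \<and> {a..b} \<subseteq> d x"
          if "(x, k) \<in> p" for x k
        proof -
          have *: "x \<in> k" "k \<subseteq> {s..t}" "k \<subseteq> d x" "\<exists>a b. k = cbox a b"
            using tagged_division_ofD(2,3,4)[OF p that] fineD[OF fine that] by auto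
          then obtain a b where k: "k = {a..b}" by auto
          show ?thesis using *(1-3) unfolding k by (intro exI[of _ a] exI[of _ b]) auto
        qed
        define p1 where "p1 = {xk \<in> p. fst xk \<notin> E}"
        define p2 where "p2 = {xk \<in> p. fst xk \<in> E}"
        have p12: "p = p1 \<union> p2" "p1 \<inter> p2 = {}" "finite p1" "finite p2" using fp by (auto simp: p1_def p2_def)
        define h where "h = (\<lambda>(x, k). measure lborel k *\<^sub>R f0 x - (F (Sup k) - F (Inf k)))"
        have "(\<Sum>(x, k)\<in>p. measure lborel k *\<^sub>R f0 x) - (F t - F s)
          = (\<Sum>(x, k)\<in>p. measure lborel k *\<^sub>R f0 x) - (\<Sum>(x, k)\<in>p. F (Sup k) - F (Inf k))"
          using additive_tagged_division_1[OF st p, of F] by simp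
        also have "\<dots> = sum h p" by (simp add: h_def sum_subtractf case_prod_unfold)
        also have "\<dots> = sum h p1 + sum h p2" using p12 by (simp add: sum.union_disjoint)
        finally have eq: "(\<Sum>(x, k)\<in>p. measure lborel k *\<^sub>R f0 x) - (F t - F s) = sum h p1 + sum h p2" .
        have "norm (sum h p1) \<le> (\<Sum>(x, k)\<in>p1. e / 2 * measure lborel k)"
        proof (rule sum_norm_le)
          fix xk assume "xk \<in> p1"
          then obtain x k where xk: "xk = (x, k)" "(x, k) \<in> p" "x \<notin> E"
            by (cases xk) (auto simp: p1_def)
          obtain A B where AB: "k = {A..B}" "A \<le> x" "x \<le> B" "{A..B} \<subseteq> {s..t}" "{A..B} \<subseteq> d x"
            using pk[OF xk(2)] by blast
          have IS: "Inf k = A" "Sup k = B" "measure lborel k = B - A" using AB by auto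
          have x: "x \<in> {s..t} - E" using AB xk by auto
          have "A \<in> {A..B}" "B \<in> {A..B}" using AB by auto
          then have *: "A \<in> {s..t}" "B \<in> {s..t}" "A \<in> ball x (D x)" "B \<in> ball x (D x)"
            using AB(4,5) x unfolding d_def by auto
          have nS: "norm (F (B) - F x - (B - x) *\<^sub>R f x) \<le> e / 2 * \<bar>B - x\<bar>"
            by (rule D(2)[OF x]) (use * in \<open>auto simp: dist_real_def\<close>)
          have nI: "norm (F (A) - F x - (A - x) *\<^sub>R f x) \<le> e / 2 * \<bar>A - x\<bar>"
            by (rule D(2)[OF x]) (use * in \<open>auto simp: dist_real_def\<close>)
          have hx: "h xk = (F (A) - F x - (A - x) *\<^sub>R f x) - (F (B) - F x - (B - x) *\<^sub>R f x)"
            using xk(1,3) by (simp add: h_def f0_def IS scaleR_diff_left)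
          have "norm (h xk) \<le> e / 2 * \<bar>A - x\<bar> + e / 2 * \<bar>B - x\<bar>"
            unfolding hx by (rule order_trans[OF norm_triangle_ineq4 add_mono[OF nI nS]])
          also have "\<dots> = e / 2 * (\<bar>A - x\<bar> + \<bar>B - x\<bar>)" by (simp only: distrib_left)
          also have "\<bar>A - x\<bar> + \<bar>B - x\<bar> = measure lborel k"
            using AB by (simp add: IS)
          finally show "norm (h xk) \<le> (case xk of (x, k) \<Rightarrow> e / 2 * measure lborel k)" using xk by simp
        qed
        also have "\<dots> \<le> (\<Sum>(x, k)\<in>p. e / 2 * measure lborel k)"
          using e fp p12 by (intro sum_mono2) auto
        also have "\<dots> = e / 2 * (\<Sum>(x, k)\<in>p. measure lborel k)"
          unfolding sum_distrib_left by (simp add: case_prod_unfold)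
        also have "(\<Sum>(x, k)\<in>p. measure lborel k) = t - s"
          using additive_content_tagged_division[of p s t] p st by simp
        finally have 1: "norm (sum h p1) \<le> e / 2 * (t - s)" .
        \<comment> \<open>\<open>abs_continuous_on\<close> speaks of families indexed by
          \<open>nat\<close>, so the intervals with tags in \<open>E\<close> are enumerated.\<close>
        obtain g where g: "bij_betw g {..<card p2} p2"
          using ex_bij_betw_nat_finite[OF p12(4)] by (auto simp: atLeast0LessThan)
        define a b where "a i = Inf (snd (g i))" and "b i = Sup (snd (g i))" for i
        have gp: "g i \<in> p2" if "i < card p2" for i using g that by (auto simp: bij_betw_def)
        have gk: "fst (g i) \<in> E \<and> snd (g i) = {a i..b i} \<and> a i \<le> b i \<and> {a i..b i} \<subseteq> {s..t} \<and> {a i..b i} \<subseteq> U"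
          if i: "i < card p2" for i
        proof -
          have "(fst (g i), snd (g i)) \<in> p" "fst (g i) \<in> E" using gp[OF i] by (auto simp: p2_def)
          then obtain A B where "snd (g i) = {A..B}" "A \<le> B" "{A..B} \<subseteq> {s..t}" "{A..B} \<subseteq> U" "fst (g i) \<in> E"
            using pk[of "fst (g i)" "snd (g i)"] by (auto simp: d_def)
          then show ?thesis by (simp add: a_def b_def)
        qed
        have dis: "disjoint_family_on (\<lambda>i. {a i<..<b i}) {..<card p2}"
          unfolding disjoint_family_on_def
        proof (intro ballI impI)
          fix i j assume ij: "i \<in> {..<card p2}" "j \<in> {..<card p2}" "i \<noteq> j"
          then have "g i \<noteq> g j" using g by (auto simp: bij_betw_def inj_on_def)
          moreover have "(fst (g i), snd (g i)) \<in> p" "(fst (g j), snd (g j)) \<in> p"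
            using gp ij by (auto simp: p2_def)
          ultimately have "interior (snd (g i)) \<inter> interior (snd (g j)) = {}"
            using tagged_division_ofD(5)[OF p] by (metis prod.collapse)
          then show "{a i<..<b i} \<inter> {a j<..<b j} = {}"
            using gk[of i] gk[of j] ij by simp
        qed
        have "(\<Sum>i<card p2. b i - a i) = (\<Sum>i<card p2. measure lebesgue {a i<..<b i})"
          using gk by (intro sum.cong) auto
        also have "\<dots> = measure lebesgue (\<Union>i<card p2. {a i<..<b i})"
        proof (rule measure_finite_Union[symmetric])
          fix i assume "i \<in> {..<card p2}"
          then show "emeasure lebesgue {a i<..<b i} \<noteq> \<infinity>" using gk[of i] by simp
        qed (use dis in auto)
        also have "\<dots> \<le> measure lebesgue U"
        proof (rule measure_mono_fmeasurable[OF _ _ Um1])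
          show "(\<Union>i<card p2. {a i<..<b i}) \<subseteq> U" using gk by fastforce
        qed auto
        finally have "(\<Sum>i<card p2. b i - a i) < \<delta>" using Um2 by simp
        then have "(\<Sum>i<card p2. norm (F (b i) - F (a i))) < \<epsilon>"
          using gk by (intro \<delta>(2) dis) auto
        moreover have "norm (sum h p2) \<le> (\<Sum>i<card p2. norm (F (b i) - F (a i)))"
        proof -
          have "sum h p2 = (\<Sum>i<card p2. h (g i))" by (rule sum.reindex_bij_betw[OF g, symmetric])
          also have "norm \<dots> \<le> (\<Sum>i<card p2. norm (F (b i) - F (a i)))"
          proof (rule sum_norm_le)
            fix i assume "i \<in> {..<card p2}"
            then have "fst (g i) \<in> E" using gk by auto
            then show "norm (h (g i)) \<le> norm (F (b i) - F (a i))"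
              by (simp add: h_def f0_def a_def b_def case_prod_unfold norm_minus_commute)
          qed
          finally show ?thesis .
        qed
        ultimately have 2: "norm (sum h p2) \<le> e / 2 * (t - s)" by (simp add: \<epsilon>_def)
        have "norm (sum h p1 + sum h p2) \<le> e / 2 * (t - s) + e / 2 * (t - s)"
          using norm_triangle_le[OF add_mono[OF 1 2]] .
        also have "\<dots> = e * measure lborel {s..t}" using st by simp
        finally show ?thesis unfolding eq .
      qed
      show "\<exists>d. gauge d \<and> (\<forall>p. p tagged_division_of {s..t} \<and> d fine p \<longrightarrow>
        norm ((\<Sum>(x, k)\<in>p. measure lborel k *\<^sub>R f0 x) - (F t - F s)) \<le> e * measure lborel {s..t})"
        by (intro exI[of _ d] conjI allI impI gd main) (elim conjE, assumption)+
  qed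
  then show ?thesis
    by (rule has_integral_spike[OF E, rotated]) (auto simp: f0_def)
  qed
qed

section \<open>Discretised Volterra equations\<close>

text \<open>Half-open, so that among positive \<open>t\<close> the cells with index below
  \<open>p\<close> cover exactly those with \<open>t < node \<omega> m p\<close>, each once.\<close>

definition cell :: "real \<Rightarrow> nat \<Rightarrow> nat \<Rightarrow> real set" where
  "cell \<omega> m q = {real q * \<omega> / real m..<real (Suc q) * \<omega> / real m}"

definition node :: "real \<Rightarrow> nat \<Rightarrow> nat \<Rightarrow> real" where
  "node \<omega> m q = real q * \<omega> / real m"

lemma node_0 [simp]: "node \<omega> m 0 = 0" by (simp add: node_def)

lemma node_last: "0 < m \<Longrightarrow> node \<omega> m m = \<omega>" by (simp add: node_def)

lemma node_in: "0 \<le> \<omega> \<Longrightarrow> p \<le> m \<Longrightarrow> node \<omega> m p \<in> {0..\<omega>}"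
  by (cases "m = 0") (auto simp: node_def pos_divide_le_eq mult.commute mult_left_mono)

lemma node_Suc: "node \<omega> m (Suc p) = node \<omega> m p + \<omega> / m"
  by (simp add: node_def add_divide_distrib distrib_right)

lemma node_mono: "0 \<le> \<omega> \<Longrightarrow> p \<le> q \<Longrightarrow> node \<omega> m p \<le> node \<omega> m q"
  unfolding node_def by (intro divide_right_mono mult_right_mono) auto

lemma cell_node: "cell \<omega> m q = {node \<omega> m q..<node \<omega> m (Suc q)}"
  by (simp add: cell_def node_def)

lemma cell_sets [measurable]: "cell \<omega> m q \<in> sets borel" by (simp add: cell_def)

lemma cell_measurable [measurable]: "indicat_real (cell \<omega> m q) \<in> borel_measurable (Leb \<omega>)"
proof -
  have "indicat_real (cell \<omega> m q) \<in> borel_measurable borel" by simp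
  then show ?thesis
    by (intro measurable_restrict_space1 measurable_completion) simp
qed

lemma sum_indicator_cell:
  assumes "0 < \<omega>" "0 < t"
  shows "(\<Sum>q<p. indicat_real (cell \<omega> m q) t) = (if t < node \<omega> m p then 1 else 0)"
proof (induction p)
  case (Suc p)
  have "node \<omega> m p \<le> node \<omega> m (Suc p)" using assms by (intro node_mono) auto
  then show ?case using Suc by (auto simp: cell_node)
qed (use assms in auto)

lemma cell_imp:
  assumes "0 < \<omega>" "0 < m" "t \<in> cell \<omega> m q"
  shows "\<bar>t - node \<omega> m q\<bar> \<le> \<omega> / m" "node \<omega> m q \<le> t"
  using assms by (auto simp: cell_node node_Suc)

lemma integrable_indicator_cell:
  fixes f :: "real \<Rightarrow> complex"
  assumes "integrable (Leb \<omega>) f"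
  shows "integrable (Leb \<omega>) (\<lambda>t. indicat_real (cell \<omega> m q) t *\<^sub>R f t)"
proof (rule Bochner_Integration.integrable_bound[OF assms])
  show "(\<lambda>t. indicat_real (cell \<omega> m q) t *\<^sub>R f t) \<in> borel_measurable (Leb \<omega>)"
    by (intro borel_measurable_scaleR cell_measurable borel_measurable_integrable[OF assms])
qed (auto simp: indicator_def)

lemma borel_measurable_lessThan [measurable]:
  fixes f :: "real \<Rightarrow> 'b::{real_normed_vector, second_countable_topology}"
  assumes "f \<in> borel_measurable (Leb \<omega>)"
  shows "(\<lambda>t. if t < x then f t else 0) \<in> borel_measurable (Leb \<omega>)"
proof (rule measurable_If[OF assms])
  have "{..<x} \<in> sets lebesgue" by simp
  then have "{0<..<\<omega>} \<inter> {..<x} \<in> sets (Leb \<omega>)" by (auto simp: sets_restrict_space)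
  moreover have "{t \<in> space (Leb \<omega>). t < x} = {0<..<\<omega>} \<inter> {..<x}" by auto
  ultimately show "{t \<in> space (Leb \<omega>). t < x} \<in> sets (Leb \<omega>)" by simp
qed simp

lemma integrable_lessThan:
  fixes f :: "real \<Rightarrow> complex"
  assumes "integrable (Leb \<omega>) f"
  shows "integrable (Leb \<omega>) (\<lambda>t. if t < x then f t else 0)"
  by (rule Bochner_Integration.integrable_bound[OF assms]) (auto intro: borel_measurable_lessThan borel_measurable_integrable[OF assms])

lemma integral_lessThan_node:
  fixes f :: "real \<Rightarrow> complex"
  assumes \<omega>: "0 < \<omega>" and f: "integrable (Leb \<omega>) f"
  shows "(LINT t|Leb \<omega>. (if t < node \<omega> m p then f t else 0))
    = (\<Sum>q<p. LINT t|Leb \<omega>. indicat_real (cell \<omega> m q) t *\<^sub>R f t)"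
proof -
  have "(LINT t|Leb \<omega>. (if t < node \<omega> m p then f t else 0))
    = (LINT t|Leb \<omega>. (\<Sum>q<p. indicat_real (cell \<omega> m q) t *\<^sub>R f t))"
  proof (intro Bochner_Integration.integral_cong refl)
    fix t assume "t \<in> space (Leb \<omega>)"
    then have "0 < t" by simp
    from sum_indicator_cell[OF \<omega> this, of m p]
    show "(if t < node \<omega> m p then f t else 0) = (\<Sum>q<p. indicat_real (cell \<omega> m q) t *\<^sub>R f t)"
      unfolding scaleR_left.sum[symmetric] by (auto split: if_splits)
  qed
  also have "\<dots> = (\<Sum>q<p. LINT t|Leb \<omega>. indicat_real (cell \<omega> m q) t *\<^sub>R f t)"
    by (intro Bochner_Integration.integral_sum integrable_indicator_cell f)
  finally show ?thesis .
qed

lemma integral_cells: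
  fixes f :: "real \<Rightarrow> complex"
  assumes \<omega>: "0 < \<omega>" and f: "integrable (Leb \<omega>) f" and m: "0 < m"
  shows "(LINT t|Leb \<omega>. f t) = (\<Sum>q<m. LINT t|Leb \<omega>. indicat_real (cell \<omega> m q) t *\<^sub>R f t)"
  unfolding integral_lessThan_node[OF \<omega> f, symmetric] using m
  by (intro Bochner_Integration.integral_cong) (auto simp: node_last)

text \<open>Stands in for a value of \<open>V\<close> at a node times the mesh width:
  \<open>V\<close> is only integrable, and its values at single points carry no information.\<close>

definition cell_mass :: "real \<Rightarrow> (real \<Rightarrow> complex) \<Rightarrow> nat \<Rightarrow> nat \<Rightarrow> complex" where
  "cell_mass \<omega> V m q = (LINT t|Leb \<omega>. indicat_real (cell \<omega> m q) t *\<^sub>R V t)"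

lemma sum_norm_cell_mass_le:
  assumes \<omega>: "0 < \<omega>" and V: "integrable (Leb \<omega>) V" and p: "p \<le> m"
  shows "(\<Sum>q<p. norm (cell_mass \<omega> V m q)) \<le> (LINT t|Leb \<omega>. norm (V t))"
proof -
  have int: "integrable (Leb \<omega>) (\<lambda>t. norm (indicat_real (cell \<omega> m q) t *\<^sub>R V t))" for q
    by (intro integrable_norm integrable_indicator_cell V)
  have "(\<Sum>q<p. norm (cell_mass \<omega> V m q)) \<le> (\<Sum>q<p. LINT t|Leb \<omega>. norm (indicat_real (cell \<omega> m q) t *\<^sub>R V t))"
    unfolding cell_mass_def by (intro sum_mono integral_norm_bound)
  also have "\<dots> = (LINT t|Leb \<omega>. (\<Sum>q<p. norm (indicat_real (cell \<omega> m q) t *\<^sub>R V t)))"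
    by (rule Bochner_Integration.integral_sum[symmetric]) (rule int)
  also have "\<dots> \<le> (LINT t|Leb \<omega>. norm (V t))"
  proof (rule integral_mono)
    fix t assume "t \<in> space (Leb \<omega>)"
    then have "0 < t" by simp
    have "(\<Sum>q<p. norm (indicat_real (cell \<omega> m q) t *\<^sub>R V t)) = (\<Sum>q<p. indicat_real (cell \<omega> m q) t) * norm (V t)"
      by (simp add: sum_distrib_right)
    then show "(\<Sum>q<p. norm (indicat_real (cell \<omega> m q) t *\<^sub>R V t)) \<le> norm (V t)"
      unfolding sum_indicator_cell[OF \<omega> \<open>0 < t\<close>] by auto
  qed (intro Bochner_Integration.integrable_sum int integrable_norm V)+
  finally show ?thesis .
qed

text \<open>Only the factor \<open>h\<close> is frozen on each cell while \<open>V\<close> is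
  integrated exactly; hence \<open>V\<close> enters the error through the integral of its modulus
  alone.\<close>

lemma integral_cells_approx:
  fixes V h :: "real \<Rightarrow> complex"
  assumes \<omega>: "0 < \<omega>" and V: "integrable (Leb \<omega>) V" and hV: "integrable (Leb \<omega>) (\<lambda>t. h t * V t)"
    and close: "\<And>q t. q < p \<Longrightarrow> t \<in> cell \<omega> m q \<Longrightarrow> t \<in> {0<..<\<omega>} \<Longrightarrow> norm (h t - g q) \<le> \<eta>"
    and p: "p \<le> m" and \<eta>: "0 \<le> \<eta>"
  shows "norm ((LINT t|Leb \<omega>. (if t < node \<omega> m p then h t * V t else 0)) - (\<Sum>q<p. g q * cell_mass \<omega> V m q))
    \<le> \<eta> * (LINT t|Leb \<omega>. norm (V t))"
proof -
  let ?I = "\<lambda>q. indicat_real (cell \<omega> m q)"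
  have int: "integrable (Leb \<omega>) (\<lambda>t. ?I q t *\<^sub>R ((h t - g q) * V t))" for q
    by (intro integrable_indicator_cell) (auto simp: left_diff_distrib intro!: Bochner_Integration.integrable_diff hV V)
  have eq: "(LINT t|Leb \<omega>. (if t < node \<omega> m p then h t * V t else 0)) - (\<Sum>q<p. g q * cell_mass \<omega> V m q)
    = (LINT t|Leb \<omega>. (\<Sum>q<p. ?I q t *\<^sub>R ((h t - g q) * V t)))"
  proof -
    have "(LINT t|Leb \<omega>. ?I q t *\<^sub>R (h t * V t)) - g q * cell_mass \<omega> V m q
      = (LINT t|Leb \<omega>. ?I q t *\<^sub>R ((h t - g q) * V t))" for q
    proof -
      have "g q * cell_mass \<omega> V m q = (LINT t|Leb \<omega>. g q * (?I q t *\<^sub>R V t))"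
        unfolding cell_mass_def by (rule integral_mult_right_zero[symmetric])
      also have "(LINT t|Leb \<omega>. ?I q t *\<^sub>R (h t * V t)) - \<dots>
        = (LINT t|Leb \<omega>. ?I q t *\<^sub>R (h t * V t) - g q * (?I q t *\<^sub>R V t))"
        by (intro Bochner_Integration.integral_diff[symmetric] integrable_indicator_cell hV
            integrable_mult_right integrable_indicator_cell V)
      finally show ?thesis
        by (simp add: algebra_simps scaleR_conv_of_real)
    qed
    then show ?thesis
      unfolding integral_lessThan_node[OF \<omega> hV] sum_subtractf[symmetric]
      by (subst Bochner_Integration.integral_sum) (auto intro: int)
  qed
  have "norm (LINT t|Leb \<omega>. (\<Sum>q<p. ?I q t *\<^sub>R ((h t - g q) * V t))) \<le> (LINT t|Leb \<omega>. \<eta> * norm (V t))"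
  proof (rule Bochner_Integration.integral_norm_bound_integral)
    fix t assume "t \<in> space (Leb \<omega>)"
    then have t: "0 < t" "t \<in> {0<..<\<omega>}" by auto
    have "norm (\<Sum>q<p. ?I q t *\<^sub>R ((h t - g q) * V t)) \<le> (\<Sum>q<p. ?I q t * (\<eta> * norm (V t)))"
    proof (rule sum_norm_le)
      fix q assume "q \<in> {..<p}"
      then show "norm (?I q t *\<^sub>R ((h t - g q) * V t)) \<le> ?I q t * (\<eta> * norm (V t))"
        using close[of q t] t by (auto simp: indicator_def norm_mult intro: mult_right_mono)
    qed
    also have "\<dots> = (\<Sum>q<p. ?I q t) * (\<eta> * norm (V t))" by (simp add: sum_distrib_right)
    also have "\<dots> \<le> \<eta> * norm (V t)" unfolding sum_indicator_cell[OF \<omega> t(1)] using \<eta> by auto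
    finally show "norm (\<Sum>q<p. ?I q t *\<^sub>R ((h t - g q) * V t)) \<le> \<eta> * norm (V t)" .
  qed (intro Bochner_Integration.integrable_sum int integrable_mult_right integrable_norm V)+
  then show ?thesis unfolding eq by simp
qed

text \<open>Forward substitution for a strictly lower triangular system, the grid form of a Volterra
  equation. The defining equation has a variable as its last argument and would make the simplifier
  loop, hence its removal below.\<close>

fun volterra_grid :: "(nat \<Rightarrow> complex) \<Rightarrow> (nat \<Rightarrow> nat \<Rightarrow> complex) \<Rightarrow> nat \<Rightarrow> complex" where
  "volterra_grid P t p = P p + (\<Sum>q<p. t p q * volterra_grid P t q)"

declare volterra_grid.simps [simp del]

text \<open>The sequence \<open>\<delta> * (\<Prod>i<p. 1 + w i)\<close> satisfies the recursion
  with equality, so by induction it dominates \<open>e\<close>; the product is at most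
  \<open>exp W\<close>.\<close>

lemma discrete_gronwall:
  fixes e w :: "nat \<Rightarrow> real"
  assumes e: "\<And>p. p \<le> m \<Longrightarrow> e p \<le> \<delta> + (\<Sum>q<p. w q * e q)" and w: "\<And>q. 0 \<le> w q" and \<delta>: "0 \<le> \<delta>"
    and W: "(\<Sum>q<m. w q) \<le> W" and p: "p \<le> m"
  shows "e p \<le> \<delta> * exp W"
proof -
  have prod: "(\<Sum>q<n. w q * (\<delta> * (\<Prod>i<q. 1 + w i))) + \<delta> = \<delta> * (\<Prod>i<n. 1 + w i)" for n
    by (induction n) (auto simp: algebra_simps)
  have le: "p \<le> m \<Longrightarrow> e p \<le> \<delta> * (\<Prod>i<p. 1 + w i)" for p
  proof (induction p rule: less_induct)
    case (less p)
    have "e p \<le> \<delta> + (\<Sum>q<p. w q * (\<delta> * (\<Prod>i<q. 1 + w i)))"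
      by (rule order_trans[OF e[OF less.prems]], intro add_left_mono sum_mono mult_left_mono w less.IH)
        (use less.prems in auto)
    then show ?case using prod[of p] by simp
  qed
  have "(\<Prod>i<p. 1 + w i) \<le> (\<Prod>i<p. exp (w i))"
    using w by (intro prod_mono) (auto intro: add_nonneg_nonneg exp_ge_add_one_self)
  also have "\<dots> = exp (\<Sum>i<p. w i)" by (simp add: exp_sum)
  also have "\<dots> \<le> exp W" using W sum_mono2[of "{..<m}" "{..<p}" w] w p by auto
  finally have "\<delta> * (\<Prod>i<p. 1 + w i) \<le> \<delta> * exp W" using \<delta> by (rule mult_left_mono)
  with le[OF p] show ?thesis by linarith
qed

lemma eventually_mesh_less:
  assumes "0 < d"
  shows "\<exists>m0>0. \<forall>m\<ge>m0. (\<omega>::real) / real m < d"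
proof -
  obtain m0 :: nat where m0: "max 0 (\<omega> / d) < m0" using reals_Archimedean2 by blast
  have "\<omega> / real m < d" if "m \<ge> m0" for m
  proof -
    have "max 0 (\<omega> / d) < real m" using m0 that by linarith
    then show ?thesis using assms by (simp add: field_simps)
  qed
  moreover have "0 < m0" using m0 by (cases m0) auto
  ultimately show ?thesis by blast
qed

text \<open>Freezing \<open>k x t * y t\<close> on the cells leaves a residual of size
  \<open>\<eta> * v\<close>. The error at the nodes then obeys \<open>discrete_gronwall\<close> with
  weights \<open>K * norm (cell_mass \<omega> V m q)\<close>, whose sum is at most
  \<open>K * v\<close> whatever the mesh; hence the uniformity in \<open>p\<close>.\<close>

lemma volterra_grid_converges:
  fixes V P y :: "real \<Rightarrow> complex" and k :: "real \<Rightarrow> real \<Rightarrow> complex"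
  assumes \<omega>: "0 < \<omega>" and V: "integrable (Leb \<omega>) V"
    and k: "continuous_on ({0..\<omega>} \<times> {0..\<omega>}) (\<lambda>(x, t). k x t)" and y: "continuous_on {0..\<omega>} y"
    and kVy: "\<And>x. x \<in> {0..\<omega>} \<Longrightarrow> integrable (Leb \<omega>) (\<lambda>t. k x t * V t * y t)"
    and eq: "\<And>x. x \<in> {0..\<omega>} \<Longrightarrow> y x = P x + (LINT t|Leb \<omega>. (if t < x then k x t * V t * y t else 0))"
    and \<epsilon>: "0 < \<epsilon>"
  shows "\<exists>m0>0. \<forall>m\<ge>m0. \<forall>p\<le>m.
    norm (y (node \<omega> m p) - volterra_grid (\<lambda>p. P (node \<omega> m p))
      (\<lambda>p q. k (node \<omega> m p) (node \<omega> m q) * cell_mass \<omega> V m q) p) \<le> \<epsilon>"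
proof -
  define v where "v = (LINT t|Leb \<omega>. norm (V t))"
  have v0: "0 \<le> v" by (simp add: v_def)
  have "bounded ((\<lambda>(x, t). k x t) ` ({0..\<omega>} \<times> {0..\<omega>}))"
    by (intro compact_imp_bounded compact_continuous_image k compact_Times) auto
  then obtain K0 where K0: "\<forall>z\<in>(\<lambda>(x, t). k x t) ` ({0..\<omega>} \<times> {0..\<omega>}). norm z \<le> K0"
    unfolding bounded_iff by blast
  define K where "K = max K0 0"
  have K: "norm (k x t) \<le> K" if "x \<in> {0..\<omega>}" "t \<in> {0..\<omega>}" for x t
  proof -
    have "(\<lambda>(x, t). k x t) (x, t) \<in> (\<lambda>(x, t). k x t) ` ({0..\<omega>} \<times> {0..\<omega>})" using that by (intro imageI) auto
    then show ?thesis using K0 by (auto simp: K_def le_max_iff_disj)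
  qed
  have KK: "0 \<le> K" by (simp add: K_def)
  \<comment> \<open>Chosen so that the Gronwall bound \<open>\<eta> * v * exp (K * v)\<close> is at
    most \<epsilon>; \<open>v + 1\<close> keeps the denominator positive when
    \<open>v = 0\<close>.\<close>
  define \<eta> where "\<eta> = \<epsilon> / (exp (K * v) * (v + 1))"
  have \<eta>: "0 < \<eta>" using \<epsilon> v0 by (simp add: \<eta>_def)
  have "continuous_on ({0..\<omega>} \<times> {0..\<omega>}) (\<lambda>z. (case z of (x, t) \<Rightarrow> k x t) * y (snd z))"
    by (intro continuous_intros k continuous_on_compose2[OF y]) auto
  then have ucont: "uniformly_continuous_on ({0..\<omega>} \<times> {0..\<omega>}) (\<lambda>z. (case z of (x, t) \<Rightarrow> k x t) * y (snd z))"
    by (intro compact_uniformly_continuous compact_Times) auto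
  obtain d where d: "0 < d" "\<And>z z'. z \<in> {0..\<omega>} \<times> {0..\<omega>} \<Longrightarrow> z' \<in> {0..\<omega>} \<times> {0..\<omega>} \<Longrightarrow> dist z' z < d \<Longrightarrow>
    dist ((case z' of (x, t) \<Rightarrow> k x t) * y (snd z')) ((case z of (x, t) \<Rightarrow> k x t) * y (snd z)) < \<eta>"
    by (rule uniformly_continuous_onE[OF ucont \<eta>]) blast
  have uc: "norm (k x t * y t - k x t' * y t') \<le> \<eta>" if "x \<in> {0..\<omega>}" "t \<in> {0..\<omega>}" "t' \<in> {0..\<omega>}" "\<bar>t - t'\<bar> < d" for x t t'
  proof -
    have "dist (x, t) (x, t') < d" using that by (simp add: dist_Pair_Pair dist_real_def)
    then show ?thesis using d(2)[of "(x, t')" "(x, t)"] that by (simp add: dist_norm)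
  qed
  obtain m0 where m0: "0 < m0" "\<And>m. m \<ge> m0 \<Longrightarrow> \<omega> / real m < d"
    using eventually_mesh_less[OF d(1), of \<omega>] by blast
  show ?thesis
  proof (intro exI[of _ m0] conjI allI impI m0(1))
    fix m p assume m: "m0 \<le> m" and p: "p \<le> m"
    have m': "0 < m" using m m0 by simp
    let ?x = "node \<omega> m" and ?W = "cell_mass \<omega> V m"
    define Y where "Y = volterra_grid (\<lambda>p. P (?x p)) (\<lambda>p q. k (?x p) (?x q) * ?W q)"
    have Y: "Y p = P (?x p) + (\<Sum>q<p. k (?x p) (?x q) * ?W q * Y q)" for p
      unfolding Y_def by (rule volterra_grid.simps)
    have x: "?x q \<in> {0..\<omega>}" if "q \<le> m" for q using node_in[of \<omega> q m] \<omega> that by auto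
    define e where "e q = norm (y (?x q) - Y q)" for q
    have "e p \<le> \<eta> * v + (\<Sum>q<p. K * norm (?W q) * e q)" if p: "p \<le> m" for p
    proof -
      have hV: "integrable (Leb \<omega>) (\<lambda>t. k (?x p) t * y t * V t)"
        using kVy[OF x[OF p]] by (simp add: mult_ac)
      have 1: "norm ((LINT t|Leb \<omega>. (if t < ?x p then k (?x p) t * y t * V t else 0)) - (\<Sum>q<p. k (?x p) (?x q) * y (?x q) * ?W q))
        \<le> \<eta> * v"
        unfolding v_def
      proof (rule integral_cells_approx[OF \<omega> V hV _ p])
        fix q t assume q: "q < p" "t \<in> cell \<omega> m q" "t \<in> {0<..<\<omega>}"
        have "\<bar>t - ?x q\<bar> < d" using cell_imp(1)[OF \<omega> m' q(2)] m0(2)[OF m] by linarith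
        then show "norm (k (?x p) t * y t - k (?x p) (?x q) * y (?x q)) \<le> \<eta>"
          using q p by (intro uc x) auto
      qed (use \<eta> in auto)
      define A where "A = (LINT t|Leb \<omega>. (if t < ?x p then k (?x p) t * y t * V t else 0)) - (\<Sum>q<p. k (?x p) (?x q) * y (?x q) * ?W q)"
      define B where "B = (\<Sum>q<p. k (?x p) (?x q) * ?W q * (y (?x q) - Y q))"
      have "(LINT t|Leb \<omega>. (if t < ?x p then k (?x p) t * y t * V t else 0))
        = (LINT t|Leb \<omega>. (if t < ?x p then k (?x p) t * V t * y t else 0))"
        by (intro Bochner_Integration.integral_cong) (auto simp: mult_ac)
      moreover have "B = (\<Sum>q<p. k (?x p) (?x q) * ?W q * y (?x q)) - (\<Sum>q<p. k (?x p) (?x q) * ?W q * Y q)"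
        unfolding B_def right_diff_distrib sum_subtractf ..
      moreover have "(\<Sum>q<p. k (?x p) (?x q) * ?W q * y (?x q)) = (\<Sum>q<p. k (?x p) (?x q) * y (?x q) * ?W q)"
        by (intro sum.cong refl) (simp add: mult_ac)
      ultimately have AB: "y (?x p) - Y p = A + B"
        unfolding eq[OF x[OF p]] Y[of p] A_def by simp
      have "norm B \<le> (\<Sum>q<p. K * norm (?W q) * e q)"
        unfolding B_def
        using p by (intro sum_norm_le) (auto simp: norm_mult e_def intro!: mult_right_mono K x)
      with 1 have "norm (A + B) \<le> \<eta> * v + (\<Sum>q<p. K * norm (?W q) * e q)"
        unfolding A_def[symmetric] by (intro norm_triangle_le add_mono)
      then show ?thesis unfolding e_def[of p] AB .
    qed
    moreover have "(\<Sum>q<m. K * norm (?W q)) \<le> K * v"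
      unfolding sum_distrib_left[symmetric] v_def
      by (intro mult_left_mono sum_norm_cell_mass_le \<omega> V KK) simp
    ultimately have "e p \<le> \<eta> * v * exp (K * v)"
      using KK \<eta> v0 p by (intro discrete_gronwall[where w = "\<lambda>q. K * norm (?W q)" and m = m]) auto
    also have "\<dots> \<le> \<eta> * (v + 1) * exp (K * v)" using \<eta> by (simp add: mult_right_mono)
    also have "\<dots> = \<epsilon>" using v0 by (simp add: \<eta>_def)
    finally show "norm (y (?x p) - volterra_grid (\<lambda>p. P (?x p)) (\<lambda>p q. k (?x p) (?x q) * ?W q) p) \<le> \<epsilon>"
      by (simp add: e_def Y_def)
  qed
qed

text \<open>Both solutions have the same grid solution, which \<open>volterra_grid_converges\<close>
  puts near each of them at the nodes; the nodes become dense and the solutions are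
  continuous.\<close>

lemma volterra_unique:
  fixes V P y1 y2 :: "real \<Rightarrow> complex" and k :: "real \<Rightarrow> real \<Rightarrow> complex"
  assumes \<omega>: "0 < \<omega>" and V: "integrable (Leb \<omega>) V"
    and k: "continuous_on ({0..\<omega>} \<times> {0..\<omega>}) (\<lambda>(x, t). k x t)"
    and y1: "continuous_on {0..\<omega>} y1" and y2: "continuous_on {0..\<omega>} y2"
    and kVy1: "\<And>x. x \<in> {0..\<omega>} \<Longrightarrow> integrable (Leb \<omega>) (\<lambda>t. k x t * V t * y1 t)"
    and kVy2: "\<And>x. x \<in> {0..\<omega>} \<Longrightarrow> integrable (Leb \<omega>) (\<lambda>t. k x t * V t * y2 t)"
    and eq1: "\<And>x. x \<in> {0..\<omega>} \<Longrightarrow> y1 x = P x + (LINT t|Leb \<omega>. (if t < x then k x t * V t * y1 t else 0))"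
    and eq2: "\<And>x. x \<in> {0..\<omega>} \<Longrightarrow> y2 x = P x + (LINT t|Leb \<omega>. (if t < x then k x t * V t * y2 t else 0))"
    and x: "x \<in> {0..\<omega>}"
  shows "y1 x = y2 x"
proof (rule ccontr)
  assume ne: "y1 x \<noteq> y2 x"
  \<comment> \<open>A quarter, since the triangle inequality below has three terms of size at most
    \<epsilon>.\<close>
  define \<epsilon> where "\<epsilon> = norm (y1 x - y2 x) / 4"
  have \<epsilon>: "0 < \<epsilon>" using ne by (simp add: \<epsilon>_def)
  have "continuous_on {0..\<omega>} (\<lambda>x. y1 x - y2 x)" by (intro continuous_intros y1 y2)
  then obtain d where d: "0 < d" "\<And>x'. x' \<in> {0..\<omega>} \<Longrightarrow> \<bar>x' - x\<bar> < d \<Longrightarrow> norm ((y1 x' - y2 x') - (y1 x - y2 x)) < \<epsilon>"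
    unfolding continuous_on_iff using x \<epsilon> by (metis dist_norm dist_real_def)
  obtain m1 where m1: "\<And>m p. m \<ge> m1 \<Longrightarrow> p \<le> m \<Longrightarrow> norm (y1 (node \<omega> m p) - volterra_grid (\<lambda>p. P (node \<omega> m p))
      (\<lambda>p q. k (node \<omega> m p) (node \<omega> m q) * cell_mass \<omega> V m q) p) \<le> \<epsilon>"
    using volterra_grid_converges[OF \<omega> V k y1 kVy1 eq1 \<epsilon>] by blast
  obtain m2 where m2: "\<And>m p. m \<ge> m2 \<Longrightarrow> p \<le> m \<Longrightarrow> norm (y2 (node \<omega> m p) - volterra_grid (\<lambda>p. P (node \<omega> m p))
      (\<lambda>p q. k (node \<omega> m p) (node \<omega> m q) * cell_mass \<omega> V m q) p) \<le> \<epsilon>"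
    using volterra_grid_converges[OF \<omega> V k y2 kVy2 eq2 \<epsilon>] by blast
  obtain m0 where m0: "0 < m0" "\<And>m. m \<ge> m0 \<Longrightarrow> \<omega> / real m < d"
    using eventually_mesh_less[OF d(1), of \<omega>] by blast
  define m where "m = max m0 (max m1 m2)"
  have m: "m \<ge> m0" "m \<ge> m1" "m \<ge> m2" "0 < m" using m0 by (auto simp: m_def)
  define p where "p = nat \<lfloor>x * m / \<omega>\<rfloor>"
  have xm: "0 \<le> x * m / \<omega>" "x * m / \<omega> \<le> m" using x \<omega> mult_right_mono[of x \<omega> "real m"] by (auto simp: divide_le_eq mult.commute)
  have fl: "real p \<le> x * m / \<omega>" "x * m / \<omega> < real p + 1" using xm by (auto simp: p_def)
  have p: "p \<le> m" using fl(1) xm(2) by linarith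
  have "\<bar>node \<omega> m p - x\<bar> \<le> \<omega> / m"
  proof -
    have "node \<omega> m p - x = (real p - x * m / \<omega>) * (\<omega> / m)"
      using \<omega> m by (simp add: node_def field_simps)
    also have "\<bar>\<dots>\<bar> \<le> 1 * (\<omega> / m)" unfolding abs_mult using fl \<omega> by (intro mult_mono) auto
    finally show ?thesis by simp
  qed
  then have "\<bar>node \<omega> m p - x\<bar> < d" using m0(2)[OF m(1)] by linarith
  then have 3: "norm ((y1 (node \<omega> m p) - y2 (node \<omega> m p)) - (y1 x - y2 x)) < \<epsilon>"
    using node_in[of \<omega> p m] \<omega> p by (intro d(2)) auto
  define Y where "Y = volterra_grid (\<lambda>p. P (node \<omega> m p)) (\<lambda>p q. k (node \<omega> m p) (node \<omega> m q) * cell_mass \<omega> V m q) p"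
  have tri: "norm (a - b) \<le> norm (a' - c) + norm (b' - c) + norm ((a' - b') - (a - b))" for a b c a' b' :: complex
  proof -
    have "norm (a - b) = norm ((a' - c) - (b' - c) - ((a' - b') - (a - b)))" by simp
    also have "\<dots> \<le> norm (a' - c) + norm (b' - c) + norm ((a' - b') - (a - b))"
      by (rule order_trans[OF norm_triangle_ineq4 add_right_mono[OF norm_triangle_ineq4]])
    finally show ?thesis .
  qed
  have "norm (y1 x - y2 x) \<le> norm (y1 (node \<omega> m p) - Y) + norm (y2 (node \<omega> m p) - Y)
    + norm ((y1 (node \<omega> m p) - y2 (node \<omega> m p)) - (y1 x - y2 x))"
    by (rule tri)
  moreover have "norm (y1 x - y2 x) = 4 * \<epsilon>" by (simp add: \<epsilon>_def)
  ultimately have "4 * \<epsilon> < 3 * \<epsilon>" using m1[OF m(2) p] m2[OF m(3) p] 3 unfolding Y_def by linarith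
  then show False using \<epsilon> by simp
qed

text \<open>Asks of \<open>Y\<close> only uniform closeness to \<open>y\<close> at the nodes. It
  serves for grid solutions of the Volterra equation and, with \<open>Q = 1\<close>, for the
  discretised Green's operator.\<close>

lemma integral_grid_converges:
  fixes V y Q :: "real \<Rightarrow> complex"
  assumes \<omega>: "0 < \<omega>" and V: "integrable (Leb \<omega>) V"
    and y: "continuous_on {0..\<omega>} y" and Q: "continuous_on {0..\<omega>} Q"
    and Vy: "integrable (Leb \<omega>) (\<lambda>t. Q t * y t * V t)"
    and Y: "\<And>\<epsilon>. 0 < \<epsilon> \<Longrightarrow> \<exists>m0. \<forall>m\<ge>m0. \<forall>p\<le>m. norm (y (node \<omega> m p) - Y m p) \<le> \<epsilon>"
  shows "(\<lambda>m. \<Sum>q<m. Q (node \<omega> m q) * cell_mass \<omega> V m q * Y m q) \<longlonglongrightarrow> (LINT t|Leb \<omega>. Q t * y t * V t)"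
proof (rule LIMSEQ_I)
  fix e :: real assume e: "0 < e"
  define v where "v = (LINT t|Leb \<omega>. norm (V t))"
  have v0: "0 \<le> v" by (simp add: v_def)
  have "bounded (Q ` {0..\<omega>})" by (intro compact_imp_bounded compact_continuous_image Q) auto
  then obtain K0 where K0: "\<forall>z\<in>Q ` {0..\<omega>}. norm z \<le> K0" unfolding bounded_iff by blast
  define K where "K = max K0 0"
  have K: "norm (Q t) \<le> K" if "t \<in> {0..\<omega>}" for t using K0 that by (auto simp: K_def le_max_iff_disj)
  have KK: "0 \<le> K" by (simp add: K_def)
  define \<eta> where "\<eta> = e / (2 * (v + 1))"
  have \<eta>: "0 < \<eta>" using e v0 by (simp add: \<eta>_def)
  define C where "C = (K + 1) * (v + 1)"
  have C: "0 < C" using v0 KK by (simp add: C_def)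
  define \<epsilon> where "\<epsilon> = e / (4 * C)"
  have \<epsilon>: "0 < \<epsilon>" using e C by (simp add: \<epsilon>_def)
  have "uniformly_continuous_on {0..\<omega>} (\<lambda>t. Q t * y t)"
    by (intro compact_uniformly_continuous continuous_intros y Q) auto
  then obtain d where d: "0 < d" "\<And>t t'. t \<in> {0..\<omega>} \<Longrightarrow> t' \<in> {0..\<omega>} \<Longrightarrow> dist t' t < d \<Longrightarrow> dist (Q t' * y t') (Q t * y t) < \<eta>"
    unfolding uniformly_continuous_on_def using \<eta> by blast
  obtain m0 where m0: "0 < m0" "\<And>m. m \<ge> m0 \<Longrightarrow> \<omega> / real m < d"
    using eventually_mesh_less[OF d(1), of \<omega>] by blast
  obtain m1 where m1: "\<And>m p. m \<ge> m1 \<Longrightarrow> p \<le> m \<Longrightarrow> norm (y (node \<omega> m p) - Y m p) \<le> \<epsilon>"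
    using Y[OF \<epsilon>] by blast
  have "norm ((\<Sum>q<m. Q (node \<omega> m q) * cell_mass \<omega> V m q * Y m q) - (LINT t|Leb \<omega>. Q t * y t * V t)) < e"
    if m: "m \<ge> max m0 m1" for m
  proof -
    have m': "0 < m" "m \<ge> m0" "m \<ge> m1" using m m0 by auto
    let ?x = "node \<omega> m" and ?W = "cell_mass \<omega> V m"
    have x: "?x q \<in> {0..\<omega>}" if "q \<le> m" for q using node_in[of \<omega> q m] \<omega> that by auto
    have 1: "norm ((LINT t|Leb \<omega>. (if t < ?x m then Q t * y t * V t else 0)) - (\<Sum>q<m. Q (?x q) * y (?x q) * ?W q)) \<le> \<eta> * v"
      unfolding v_def
    proof (rule integral_cells_approx[OF \<omega> V Vy])
      fix q t assume q: "q < m" "t \<in> cell \<omega> m q" "t \<in> {0<..<\<omega>}"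
      have "dist t (?x q) < d" using cell_imp(1)[OF \<omega> m'(1) q(2)] m0(2)[OF m'(2)] by (simp add: dist_real_def)
      then have "dist (Q t * y t) (Q (?x q) * y (?x q)) < \<eta>" using q by (intro d(2) x) auto
      then show "norm (Q t * y t - Q (?x q) * y (?x q)) \<le> \<eta>" by (simp add: dist_norm)
    qed (use \<eta> in auto)
    have "(LINT t|Leb \<omega>. (if t < ?x m then Q t * y t * V t else 0)) = (LINT t|Leb \<omega>. Q t * y t * V t)"
      using m' by (intro Bochner_Integration.integral_cong) (auto simp: node_last)
    with 1 have 1: "norm ((\<Sum>q<m. Q (?x q) * y (?x q) * ?W q) - (LINT t|Leb \<omega>. Q t * y t * V t)) \<le> \<eta> * v"
      by (simp add: norm_minus_commute)
    have "norm (\<Sum>q<m. Q (?x q) * ?W q * (Y m q - y (?x q))) \<le> (\<Sum>q<m. K * norm (?W q) * \<epsilon>)"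
    proof (rule sum_norm_le)
      fix q assume "q \<in> {..<m}"
      then have q: "q \<le> m" by simp
      show "norm (Q (?x q) * ?W q * (Y m q - y (?x q))) \<le> K * norm (?W q) * \<epsilon>"
        unfolding norm_mult using K[OF x[OF q]] m1[OF m'(3) q] KK
        by (intro mult_mono) (auto simp: norm_minus_commute)
    qed
    also have "\<dots> = K * (\<Sum>q<m. norm (?W q)) * \<epsilon>" by (simp add: sum_distrib_left sum_distrib_right)
    also have "\<dots> \<le> K * v * \<epsilon>"
      unfolding v_def using KK \<epsilon> by (intro mult_right_mono mult_left_mono sum_norm_cell_mass_le \<omega> V) auto
    finally have 2: "norm (\<Sum>q<m. Q (?x q) * ?W q * (Y m q - y (?x q))) \<le> K * v * \<epsilon>" .
    have "(\<Sum>q<m. Q (?x q) * ?W q * Y m q) - (LINT t|Leb \<omega>. Q t * y t * V t)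
      = (\<Sum>q<m. Q (?x q) * ?W q * (Y m q - y (?x q))) + ((\<Sum>q<m. Q (?x q) * y (?x q) * ?W q) - (LINT t|Leb \<omega>. Q t * y t * V t))"
      by (simp add: algebra_simps sum_subtractf)
    also have "norm \<dots> \<le> K * v * \<epsilon> + \<eta> * v" by (rule norm_triangle_le[OF add_mono[OF 2 1]])
    also have "\<dots> < e"
    proof -
      have "\<eta> * v \<le> e / 2" using e v0 by (simp add: \<eta>_def field_simps)
      moreover have "K * v * \<epsilon> \<le> e / 4"
      proof -
        have "K * v * \<epsilon> \<le> C * \<epsilon>"
          unfolding C_def using KK v0 \<epsilon> by (intro mult_right_mono mult_mono) auto
        also have "\<dots> = e / 4" using C by (simp add: \<epsilon>_def)
        finally show ?thesis .
      qed
      ultimately show ?thesis using e by linarith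
    qed
    finally show ?thesis .
  qed
  then show "\<exists>no. \<forall>m\<ge>no. norm ((\<Sum>q<m. Q (node \<omega> m q) * cell_mass \<omega> V m q * Y m q) - (LINT t|Leb \<omega>. Q t * y t * V t)) < e"
    by blast
qed

section \<open>The Green's function\<close>

lemma has_vector_derivative_exp_of_real:
  "((\<lambda>x. exp (k * complex_of_real x)) has_vector_derivative k * exp (k * of_real x)) (at x within S)"
proof -
  have "((\<lambda>w. exp (k * w)) has_field_derivative k * exp (k * of_real x)) (at (complex_of_real x))"
    by (auto intro!: derivative_eq_intros)
  then show ?thesis by (rule has_vector_derivative_real_field)
qed

lemma abs_continuous_on_exp: "abs_continuous_on s t (\<lambda>x. exp (k * complex_of_real x))"
  by (rule abs_continuous_on_C1[OF has_vector_derivative_exp_of_real]) (intro continuous_intros)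

lemma integrable_continuous_mult:
  fixes h q :: "real \<Rightarrow> complex"
  assumes h: "continuous_on {0..\<omega>} h" and q: "integrable (Leb \<omega>) q"
  shows "integrable (Leb \<omega>) (\<lambda>t. h t * q t)"
proof -
  have "bounded (h ` {0..\<omega>})" by (intro compact_imp_bounded compact_continuous_image h) auto
  then obtain B where B: "\<forall>z\<in>h ` {0..\<omega>}. norm z \<le> B" unfolding bounded_iff by blast
  have meas: "h \<in> borel_measurable (Leb \<omega>)"
    by (intro continuous_imp_measurable_on_sets_lebesgue continuous_on_subset[OF h]) auto
  have "integrable (Leb \<omega>) (\<lambda>t. of_real B * q t)" using q by simp
  then show ?thesis
  proof (rule Bochner_Integration.integrable_bound)
    show "(\<lambda>t. h t * q t) \<in> borel_measurable (Leb \<omega>)"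
      using meas borel_measurable_integrable[OF q] by (rule borel_measurable_times)
    show "AE t in Leb \<omega>. norm (h t * q t) \<le> norm (of_real B * q t)"
    proof (rule AE_I2)
      fix t assume "t \<in> space (Leb \<omega>)"
      then have "norm (h t) \<le> B" using B by auto
      then have "norm (h t) \<le> norm (complex_of_real B)" by simp
      then show "norm (h t * q t) \<le> norm (of_real B * q t)"
        unfolding norm_mult by (rule mult_right_mono) simp
    qed
  qed
qed

lemma AE_Leb_neq: "AE t in Leb \<omega>. t \<noteq> x"
proof -
  have "AE t in lebesgue. t \<noteq> x"
    by (rule AE_I'[of "{x}"]) auto
  then show ?thesis by (subst AE_restrict_space_iff) (auto elim: eventually_mono)
qed

lemma continuous_on_integral_lessThan:
  fixes f :: "real \<Rightarrow> complex"
  assumes f: "integrable (Leb \<omega>) f"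
  shows "continuous_on A (\<lambda>x. LINT t|Leb \<omega>. (if t < x then f t else 0))"
proof (rule continuous_on_sequentiallyI)
  fix u :: "nat \<Rightarrow> real" and x assume "\<forall>n. u n \<in> A" "x \<in> A" and u: "u \<longlonglongrightarrow> x"
  show "(\<lambda>n. LINT t|Leb \<omega>. (if t < u n then f t else 0)) \<longlonglongrightarrow> (LINT t|Leb \<omega>. (if t < x then f t else 0))"
  proof (rule integral_dominated_convergence[where w = "\<lambda>t. norm (f t)"])
    show "AE t in Leb \<omega>. (\<lambda>n. if t < u n then f t else 0) \<longlonglongrightarrow> (if t < x then f t else 0)"
      using AE_Leb_neq[of x \<omega>]
    proof eventually_elim
      case (elim t)
      show ?case
      proof (cases "t < x")
        case True
        then have "\<forall>\<^sub>F n in sequentially. t < u n" using u order_tendstoD(1) by blast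
        then have "\<forall>\<^sub>F n in sequentially. (if t < u n then f t else 0) = f t" by eventually_elim simp
        then show ?thesis using True by (simp add: tendsto_eventually)
      next
        case False
        then have "x < t" using elim by simp
        then have "\<forall>\<^sub>F n in sequentially. u n < t" using u order_tendstoD(2) by blast
        then have "\<forall>\<^sub>F n in sequentially. (if t < u n then f t else 0) = 0" by eventually_elim simp
        then show ?thesis using False by (simp add: tendsto_eventually)
      qed
    qed
  qed (use f in \<open>auto intro: borel_measurable_lessThan borel_measurable_integrable\<close>)
qed

text \<open>The fundamental theorem yields a gauge integral; the Lebesgue integral over
  \<open>Leb \<omega>\<close> is a gauge integral as well, and uniqueness compares the two.\<close>

lemma ftc_lessThan:
  fixes G q :: "real \<Rightarrow> complex"
  assumes \<omega>: "0 < \<omega>" and AC: "abs_continuous_on 0 \<omega> G"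
    and der: "AE x in Leb \<omega>. (G has_vector_derivative q x) (at x)"
    and q: "integrable (Leb \<omega>) q" and x: "x \<in> {0..\<omega>}"
  shows "G x - G 0 = (LINT t|Leb \<omega>. (if t < x then q t else 0))"
proof -
  let ?h = "\<lambda>t. if t < x then q t else 0"
  have "AE t in lebesgue. t \<in> {0<..<\<omega>} \<longrightarrow> (G has_vector_derivative q t) (at t)"
    using der by (subst (asm) AE_restrict_space_iff) auto
  then obtain N where N: "N \<in> null_sets lebesgue" "{t. \<not> (t \<in> {0<..<\<omega>} \<longrightarrow> (G has_vector_derivative q t) (at t))} \<subseteq> N"
    unfolding eventually_ae_filter by auto
  \<comment> \<open>Besides the null set \<open>N\<close>, the points where the integrands over
    \<open>{0..x}\<close> and \<open>{0<..<\<omega>}\<close> may differ.\<close>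
  define E where "E = N \<union> {0, x, \<omega>}"
  have E: "negligible E"
    using N(1) by (auto simp: E_def negligible_iff_null_sets intro!: null_sets.Un)
  have "(q has_integral G x - G 0) {0..x}"
  proof (rule abs_continuous_on_ftc[OF _ _ E])
    show "abs_continuous_on 0 x G" using abs_continuous_on_subset[OF AC] x by auto
    fix t assume "t \<in> {0..x} - E"
    then have "t \<in> {0<..<\<omega>}" "t \<notin> N" using x by (auto simp: E_def)
    then have "(G has_vector_derivative q t) (at t)" using N(2) by blast
    then show "(G has_vector_derivative q t) (at t within {0..x})" by (rule has_vector_derivative_at_within)
  qed (use x in auto)
  then have 1: "((\<lambda>t. if t \<in> {0..x} then q t else 0) has_integral G x - G 0) UNIV"
    by (subst has_integral_restrict_UNIV)
  have "(?h has_integral (LINT t|Leb \<omega>. ?h t)) {0<..<\<omega>}"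
    by (rule has_integral_integral_lebesgue_on[OF integrable_lessThan[OF q]]) auto
  then have 2: "((\<lambda>t. if t \<in> {0<..<\<omega>} then ?h t else 0) has_integral (LINT t|Leb \<omega>. ?h t)) UNIV"
    by (subst has_integral_restrict_UNIV)
  have "((\<lambda>t. if t \<in> {0<..<\<omega>} then ?h t else 0) has_integral G x - G 0) UNIV"
    by (rule has_integral_spike[OF E _ 1]) (use x in \<open>auto simp: E_def\<close>)
  with 2 show ?thesis using has_integral_unique by blast
qed

text \<open>The cut-off stands in the integrand and not in the measure: all partial moments are then
  integrals over the same \<open>Leb \<omega>\<close>, to which linearity and dominated convergence
  apply directly.\<close>

definition exp_moment :: "real \<Rightarrow> complex \<Rightarrow> (real \<Rightarrow> complex) \<Rightarrow> real \<Rightarrow> complex" where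
  "exp_moment \<omega> k q x = (LINT t|Leb \<omega>. (if t < x then exp (k * of_real t) * q t else 0))"

lemma integrable_exp_mult:
  fixes q :: "real \<Rightarrow> complex"
  shows "integrable (Leb \<omega>) q \<Longrightarrow> integrable (Leb \<omega>) (\<lambda>t. exp (k * of_real t) * q t)"
  by (intro integrable_continuous_mult continuous_intros)

lemma continuous_on_exp_moment:
  "integrable (Leb \<omega>) q \<Longrightarrow> continuous_on A (exp_moment \<omega> k q)"
  unfolding exp_moment_def[abs_def] by (intro continuous_on_integral_lessThan integrable_exp_mult)

lemma exp_moment_end: "exp_moment \<omega> k q \<omega> = (LINT t|Leb \<omega>. exp (k * of_real t) * q t)"
  unfolding exp_moment_def by (intro Bochner_Integration.integral_cong) auto

text \<open>The sine splits into exponentials that separate \<open>x\<close> from \<open>t\<close>.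
  The cut-off \<open>y\<close> is independent of \<open>x\<close> because the backward equation
  needs it at \<omega>.\<close>

lemma integral_free_kernel:
  assumes q: "integrable (Leb \<omega>) q" and r: "r \<noteq> 0"
  shows "(LINT t|Leb \<omega>. (if t < y then free_kernel r x t * q t else 0))
    = (exp (\<i> * r * of_real x) * exp_moment \<omega> (- \<i> * r) q y
      - exp (- \<i> * r * of_real x) * exp_moment \<omega> (\<i> * r) q y) / (2 * \<i> * r)"
proof -
  have "(LINT t|Leb \<omega>. (if t < y then free_kernel r x t * q t else 0))
    = (LINT t|Leb \<omega>. (exp (\<i> * r * of_real x) * (if t < y then exp (- \<i> * r * of_real t) * q t else 0)
      - exp (- \<i> * r * of_real x) * (if t < y then exp (\<i> * r * of_real t) * q t else 0)) / (2 * \<i> * r))"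
  proof (intro Bochner_Integration.integral_cong refl)
    fix t
    have "free_kernel r x t = (exp (\<i> * r * of_real x) * exp (- \<i> * r * of_real t)
      - exp (- \<i> * r * of_real x) * exp (\<i> * r * of_real t)) / (2 * \<i> * r)"
      unfolding free_kernel_def sin_exp_eq by (simp add: exp_add[symmetric] algebra_simps)
    then show "(if t < y then free_kernel r x t * q t else 0)
      = (exp (\<i> * r * of_real x) * (if t < y then exp (- \<i> * r * of_real t) * q t else 0)
      - exp (- \<i> * r * of_real x) * (if t < y then exp (\<i> * r * of_real t) * q t else 0)) / (2 * \<i> * r)"
      by (simp add: left_diff_distrib mult.assoc)
  qed
  also have "\<dots> = (LINT t|Leb \<omega>. exp (\<i> * r * of_real x) * (if t < y then exp (- \<i> * r * of_real t) * q t else 0)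
      - exp (- \<i> * r * of_real x) * (if t < y then exp (\<i> * r * of_real t) * q t else 0)) / (2 * \<i> * r)"
    by (rule integral_divide_zero)
  also have "(LINT t|Leb \<omega>. exp (\<i> * r * of_real x) * (if t < y then exp (- \<i> * r * of_real t) * q t else 0)
      - exp (- \<i> * r * of_real x) * (if t < y then exp (\<i> * r * of_real t) * q t else 0))
      = exp (\<i> * r * of_real x) * exp_moment \<omega> (- \<i> * r) q y - exp (- \<i> * r * of_real x) * exp_moment \<omega> (\<i> * r) q y"
    unfolding exp_moment_def
    by (subst Bochner_Integration.integral_diff)
      (auto intro!: integrable_mult_right integrable_lessThan integrable_exp_mult q simp del: integrable_mult_right_iff)
  finally show ?thesis .
qed

text \<open>
  The substitution \<open>w = exp (- k x) (g' + k g)\<close> with \<open>k\<^sup>2 = - z\<close> turns \<open>g'' + z g = q\<close> into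
  \<open>w' = exp (- k x) q\<close>.
\<close>
lemma exp_reduction:
  fixes g g' q :: "real \<Rightarrow> complex"
  assumes \<omega>: "0 < \<omega>" and ac: "ac_derivative_on \<omega> g g'" and q: "integrable (Leb \<omega>) q"
    and der: "AE x in Leb \<omega>. (g' has_vector_derivative (q x - z * g x)) (at x)"
    and k: "k\<^sup>2 = - z" and x: "x \<in> {0..\<omega>}"
  shows "exp (- k * of_real x) * (g' x + k * g x) = g' 0 + k * g 0 + exp_moment \<omega> (- k) q x"
proof -
  have acg: "abs_continuous_on 0 \<omega> g" "abs_continuous_on 0 \<omega> g'"
    and dg: "\<And>x. x \<in> {0..\<omega>} \<Longrightarrow> (g has_vector_derivative g' x) (at x within {0..\<omega>})"
    using ac by (auto simp: ac_derivative_on_def)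
  define G where "G x = exp (- k * of_real x) * (g' x + k * g x)" for x
  have kg: "abs_continuous_on 0 \<omega> (\<lambda>x. k * g x)"
    by (rule abs_continuous_on_mult[OF abs_continuous_on_lipschitz[of _ _ _ 0] acg(1)]) auto
  have AC: "abs_continuous_on 0 \<omega> G"
    unfolding G_def by (rule abs_continuous_on_mult[OF abs_continuous_on_exp abs_continuous_on_add[OF acg(2) kg]])
  have "AE x in Leb \<omega>. (G has_vector_derivative exp (- k * of_real x) * q x) (at x)"
    using der
  proof (rule AE_mp, intro AE_I2 impI)
    fix x assume xs: "x \<in> space (Leb \<omega>)" and d: "(g' has_vector_derivative (q x - z * g x)) (at x)"
    then have "(g has_vector_derivative g' x) (at x within {0..\<omega>})" by (intro dg) auto
    moreover have "x \<in> interior {0..\<omega>}" using xs by simp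
    ultimately have dgx: "(g has_vector_derivative g' x) (at x)"
      unfolding at_within_interior[OF \<open>x \<in> interior {0..\<omega>}\<close>] by simp
    have "((\<lambda>x. g' x + k * g x) has_vector_derivative (q x - z * g x + k * g' x)) (at x)"
      by (intro has_vector_derivative_add d has_vector_derivative_mult_right dgx)
    from has_vector_derivative_mult[OF has_vector_derivative_exp_of_real[of "- k"] this]
    have "(G has_vector_derivative exp (- k * of_real x) * (q x - z * g x + k * g' x)
      + - k * exp (- k * of_real x) * (g' x + k * g x)) (at x)"
      by (simp add: G_def[abs_def])
    moreover have "exp (- k * of_real x) * (q x - z * g x + k * g' x)
      + - k * exp (- k * of_real x) * (g' x + k * g x) = exp (- k * of_real x) * (q x - (z + k\<^sup>2) * g x)"
      by (simp add: algebra_simps power2_eq_square)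
    ultimately show "(G has_vector_derivative exp (- k * of_real x) * q x) (at x)" using k by simp
  qed
  from ftc_lessThan[OF \<omega> AC this integrable_exp_mult[OF q] x]
  show ?thesis by (simp add: G_def exp_moment_def algebra_simps)
qed

text \<open>The kernel of the free resolvent, with \<open>a\<close> and \<open>b\<close> the
  exponentials in its two denominators. The exponential of
  \<open>\<i> * r * \<bar>x - t\<bar>\<close> equals that of \<open>- \<i> * r * (x - t)\<close>,
  plus \<open>2 * \<i> * sin (r * (x - t))\<close> when \<open>t < x\<close>. The former is absorbed
  by \<open>b / (b - 1) = 1 + 1 / (b - 1)\<close>; the latter, times the prefactor
  \<open>\<i> / (2 * r)\<close>, is minus the Volterra kernel.\<close>

definition green :: "complex \<Rightarrow> complex \<Rightarrow> complex \<Rightarrow> real \<Rightarrow> real \<Rightarrow> complex" where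
  "green a b r x t = \<i> / (2 * r) * (1 / (a - 1) * exp (\<i> * r * of_real (x - t))
     + b / (b - 1) * exp (- \<i> * r * of_real (x - t))) - (if t < x then free_kernel r x t else 0)"

lemma integral_green:
  assumes q: "integrable (Leb \<omega>) q" and r: "r \<noteq> 0"
  shows "integrable (Leb \<omega>) (\<lambda>t. green a b r x t * q t)" (is ?I)
    and "(LINT t|Leb \<omega>. green a b r x t * q t)
    = \<i> / (2 * r) * (1 / (a - 1) * (exp (\<i> * r * of_real x) * exp_moment \<omega> (- \<i> * r) q \<omega>)
      + b / (b - 1) * (exp (- \<i> * r * of_real x) * exp_moment \<omega> (\<i> * r) q \<omega>)
      + exp (\<i> * r * of_real x) * exp_moment \<omega> (- \<i> * r) q x
      - exp (- \<i> * r * of_real x) * exp_moment \<omega> (\<i> * r) q x)" (is ?E)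
proof -
  define A where "A = \<i> / (2 * r) * (1 / (a - 1) * exp (\<i> * r * of_real x))"
  define B where "B = \<i> / (2 * r) * (b / (b - 1) * exp (- \<i> * r * of_real x))"
  have eq: "green a b r x t * q t = A * (exp (- \<i> * r * of_real t) * q t) + B * (exp (\<i> * r * of_real t) * q t)
    - (if t < x then free_kernel r x t * q t else 0)" for t
  proof -
    have "exp (\<i> * r * of_real (x - t)) = exp (\<i> * r * of_real x) * exp (- \<i> * r * of_real t)"
      "exp (- \<i> * r * of_real (x - t)) = exp (- \<i> * r * of_real x) * exp (\<i> * r * of_real t)"
      by (simp_all add: exp_add[symmetric] algebra_simps)
    then show ?thesis
      unfolding green_def A_def B_def by (simp add: algebra_simps)
  qed
  have fk: "integrable (Leb \<omega>) (\<lambda>t. if t < x then free_kernel r x t * q t else 0)"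
    unfolding free_kernel_def using r
    by (intro integrable_lessThan integrable_continuous_mult q continuous_intros) auto
  have ie: "integrable (Leb \<omega>) (\<lambda>t. A * (exp (- \<i> * r * of_real t) * q t))"
    "integrable (Leb \<omega>) (\<lambda>t. B * (exp (\<i> * r * of_real t) * q t))"
    by (intro integrable_mult_right integrable_exp_mult q)+
  show ?I unfolding eq by (intro Bochner_Integration.integrable_diff Bochner_Integration.integrable_add ie fk)
  have "(LINT t|Leb \<omega>. green a b r x t * q t) = (LINT t|Leb \<omega>. A * (exp (- \<i> * r * of_real t) * q t))
    + (LINT t|Leb \<omega>. B * (exp (\<i> * r * of_real t) * q t)) - (LINT t|Leb \<omega>. (if t < x then free_kernel r x t * q t else 0))"
    unfolding eq by (simp only: Bochner_Integration.integral_diff[OF Bochner_Integration.integrable_add[OF ie] fk] Bochner_Integration.integral_add[OF ie])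
  also have "\<dots> = A * exp_moment \<omega> (- \<i> * r) q \<omega> + B * exp_moment \<omega> (\<i> * r) q \<omega>
    - (exp (\<i> * r * of_real x) * exp_moment \<omega> (- \<i> * r) q x
      - exp (- \<i> * r * of_real x) * exp_moment \<omega> (\<i> * r) q x) / (2 * \<i> * r)"
    unfolding exp_moment_end integral_free_kernel[OF q r] by simp
  also have "\<dots> = \<i> / (2 * r) * (1 / (a - 1) * (exp (\<i> * r * of_real x) * exp_moment \<omega> (- \<i> * r) q \<omega>)
      + b / (b - 1) * (exp (- \<i> * r * of_real x) * exp_moment \<omega> (\<i> * r) q \<omega>)
      + exp (\<i> * r * of_real x) * exp_moment \<omega> (- \<i> * r) q x
      - exp (- \<i> * r * of_real x) * exp_moment \<omega> (\<i> * r) q x)"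
  proof -
    have "w / (2 * \<i> * r) = - (\<i> / (2 * r) * w)" for w using r by (simp add: field_simps)
    moreover have "\<kappa> * (c * p) * X + \<kappa> * (d * n) * Y - - (\<kappa> * (p * M - n * N))
      = \<kappa> * (c * (p * X) + d * (n * Y) + p * M - n * N)" for \<kappa> c d p n X Y M N :: complex
      by (simp add: algebra_simps)
    ultimately show ?thesis unfolding A_def B_def by metis
  qed
  finally show ?E .
qed

section \<open>The resolvent of the free operator\<close>

lemma resolventI: "(f, h) \<in> T \<Longrightarrow> ((\<lambda>x. h x - z * f x), f) \<in> resolvent T z"
  unfolding resolvent_def by blast

text \<open>Otherwise the exponential with rate \<open>k\<close> satisfies the boundary conditions
  and is an eigenfunction: the resolvent relates 0 to a nonzero function, against its norm bound.
  The cases \<open>k = \<i> * r\<close> and \<open>k = - \<i> * r\<close> give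
  \<open>a \<noteq> 1\<close> and \<open>b \<noteq> 1\<close>.\<close>

lemma not_in_spectrum_exp_neq:
  assumes \<omega>: "0 < \<omega>" and z: "z \<notin> op_spectrum \<omega> (H0 \<omega> \<theta>)" and k: "k\<^sup>2 = - z"
  shows "exp (k * of_real \<omega>) \<noteq> exp (\<i> * of_real \<theta>)"
proof
  assume e: "exp (k * of_real \<omega>) = exp (\<i> * of_real \<theta>)"
  define g where "g x = exp (k * complex_of_real x)" for x
  define g' where "g' x = k * exp (k * complex_of_real x)" for x
  have bm: "(\<lambda>x. c * exp (k * complex_of_real x)) \<in> L2 \<omega>" for c
  proof -
    have "continuous_on {0..\<omega>} (\<lambda>x. c * exp (k * complex_of_real x))" by (intro continuous_intros)
    then have "bounded ((\<lambda>x. c * exp (k * complex_of_real x)) ` {0..\<omega>})"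
      by (intro compact_imp_bounded compact_continuous_image) auto
    then obtain B where "\<forall>y\<in>(\<lambda>x. c * exp (k * complex_of_real x)) ` {0..\<omega>}. norm y \<le> B" unfolding bounded_iff by blast
    then show ?thesis
      by (intro L2_bounded_measurable[where c = B] continuous_imp_measurable_on_sets_lebesgue continuous_intros) auto
  qed
  have "(g, \<lambda>x. z * g x) \<in> H0 \<omega> \<theta>"
    unfolding H0_def mem_Collect_eq case_prod_conv
  proof (intro conjI, goal_cases)
    case 3
    show ?case
    proof (rule exI[of _ g], rule exI[of _ g'], intro conjI)
    show "ac_derivative_on \<omega> g g'"
      unfolding ac_derivative_on_def
    proof (intro conjI ballI)
      show "abs_continuous_on 0 \<omega> g" unfolding g_def by (rule abs_continuous_on_exp)
      show "abs_continuous_on 0 \<omega> g'"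
        unfolding g'_def
        by (rule abs_continuous_on_mult[OF abs_continuous_on_lipschitz[of _ _ _ 0] abs_continuous_on_exp]) auto
      show "(g has_vector_derivative g' x) (at x within {0..\<omega>})" for x
        unfolding g_def g'_def by (rule has_vector_derivative_exp_of_real)
    qed
    show "g \<omega> = exp (\<i> * of_real \<theta>) * g 0" "g' \<omega> = exp (\<i> * of_real \<theta>) * g' 0"
      by (simp_all add: g_def g'_def e)
    have "(g' has_vector_derivative - (z * g x)) (at x)" for x
    proof -
      have "(g' has_vector_derivative k * (k * exp (k * of_real x))) (at x)"
        unfolding g'_def by (intro has_vector_derivative_mult_right has_vector_derivative_exp_of_real)
      moreover have "k * (k * exp (k * of_real x)) = k\<^sup>2 * g x" by (simp add: g_def power2_eq_square)
      ultimately show ?thesis by (simp add: k)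
    qed
    then show "AE x in Leb \<omega>. (g' has_vector_derivative - (z * g x)) (at x)" by simp
    qed auto
  qed (use bm[of 1] bm[of z] in \<open>simp_all add: g_def[abs_def]\<close>)
  then have "((\<lambda>x. z * g x - z * g x), g) \<in> resolvent (H0 \<omega> \<theta>) z"
    by (rule resolventI)
  moreover obtain C where "\<forall>(f, h)\<in>resolvent (H0 \<omega> \<theta>) z. l2_norm \<omega> h \<le> C * l2_norm \<omega> f"
    using z unfolding op_spectrum_def bounded_operator_def by blast
  ultimately have "l2_norm \<omega> g \<le> C * l2_norm \<omega> (\<lambda>x. z * g x - z * g x)" by blast
  also have "l2_norm \<omega> (\<lambda>x. z * g x - z * g x) = 0" by (simp add: l2_norm_def)
  finally have "l2_norm \<omega> g = 0" using l2_norm_nonneg[of \<omega> g] by simp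
  moreover have "g \<in> L2 \<omega>" using bm[of 1] by (simp add: g_def[abs_def])
  ultimately have "AE x in Leb \<omega>. g x = 0" by (simp add: l2_norm_eq_0_iff)
  then have "AE x in Leb \<omega>. False" by (simp add: g_def)
  then have "AE x in Leb \<omega>. x \<notin> space (Leb \<omega>)" by eventually_elim simp
  then have "space (Leb \<omega>) \<in> null_sets (Leb \<omega>)"
    by (subst AE_iff_null_sets) auto
  then have "emeasure (Leb \<omega>) (space (Leb \<omega>)) = 0" by (simp only: null_setsD1)
  then show False using \<omega> by (simp add: emeasure_restrict_space)
qed

text \<open>The combinations \<open>g' + \<i> * r * g\<close> and \<open>g' - \<i> * r * g\<close>
  satisfy first order equations, which \<open>exp_reduction\<close> solves from the data at 0. The
  boundary conditions become one scalar equation for each of the initial values \<open>wp\<close>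
  and \<open>wm\<close>, solvable because \<open>a\<close> and \<open>b\<close> differ from
  1.\<close>

lemma resolvent_green:
  assumes \<omega>: "0 < \<omega>" and fg: "(f, g2) \<in> resolvent (H0 \<omega> \<theta>) (r\<^sup>2)" and r: "r \<noteq> 0"
    and a: "a = exp (\<i> * of_real \<theta>) * exp (- \<i> * r * of_real \<omega>)" "a \<noteq> 1"
    and b: "b = exp (- \<i> * of_real \<theta>) * exp (- \<i> * r * of_real \<omega>)" "b \<noteq> 1"
  shows "f \<in> L2 \<omega> \<and> g2 \<in> L2 \<omega> \<and> (AE x in Leb \<omega>. g2 x = (LINT t|Leb \<omega>. green a b r x t * f t))"
proof -
  obtain h where h: "(g2, h) \<in> H0 \<omega> \<theta>" and f: "f = (\<lambda>x. h x - r\<^sup>2 * g2 x)"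
    using fg by (auto simp: resolvent_def)
  obtain g g' where L2: "g2 \<in> L2 \<omega>" "h \<in> L2 \<omega>" and ac: "ac_derivative_on \<omega> g g'"
    and bc: "g \<omega> = exp (\<i> * of_real \<theta>) * g 0" "g' \<omega> = exp (\<i> * of_real \<theta>) * g' 0"
    and g2: "AE x in Leb \<omega>. g2 x = g x" and der: "AE x in Leb \<omega>. (g' has_vector_derivative - h x) (at x)"
    using h unfolding H0_def by blast
  have fL: "f \<in> L2 \<omega>" unfolding f by (intro L2_diff L2_scale L2)
  have fi: "integrable (Leb \<omega>) f" by (rule L2_integrable[OF fL])
  have fi': "integrable (Leb \<omega>) (\<lambda>x. - f x)" using fi by simp
  have der': "AE x in Leb \<omega>. (g' has_vector_derivative (- f x - r\<^sup>2 * g x)) (at x)"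
    using g2 der by eventually_elim (simp add: f)
  have neg: "exp_moment \<omega> k (\<lambda>x. - f x) x = - exp_moment \<omega> k f x" for k x
  proof -
    have "exp_moment \<omega> k (\<lambda>x. - f x) x = (LINT t|Leb \<omega>. - (if t < x then exp (k * of_real t) * f t else 0))"
      unfolding exp_moment_def by (intro Bochner_Integration.integral_cong) auto
    then show ?thesis by (simp add: exp_moment_def)
  qed
  have k: "(\<i> * r)\<^sup>2 = - (r\<^sup>2)" "(- \<i> * r)\<^sup>2 = - (r\<^sup>2)" by (simp_all add: power_mult_distrib)
  note red = exp_reduction[OF \<omega> ac fi' der' k(1), unfolded neg] exp_reduction[OF \<omega> ac fi' der' k(2), unfolded neg]
  define e where "e x = exp (\<i> * r * complex_of_real x)" for x
  have e0: "e x \<noteq> 0" for x by (simp add: e_def)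
  have em: "exp (- (\<i> * r) * complex_of_real x) = inverse (e x)" "exp (- \<i> * r * complex_of_real x) = inverse (e x)"
    "exp (- (- \<i> * r) * complex_of_real x) = e x" for x
    by (simp_all add: e_def exp_minus)
  define Fp where "Fp x = exp_moment \<omega> (- \<i> * r) f x" for x
  define Fm where "Fm x = exp_moment \<omega> (\<i> * r) f x" for x
  define wp where "wp = g' 0 + \<i> * r * g 0"
  define wm where "wm = g' 0 - \<i> * r * g 0"
  have Rp: "g' x + \<i> * r * g x = e x * (wp - Fp x)" if "x \<in> {0..\<omega>}" for x
  proof -
    have "inverse (e x) * (g' x + \<i> * r * g x) = wp - Fp x"
      using red(1)[OF that] unfolding em by (simp add: wp_def Fp_def)
    then show ?thesis using e0[of x] by (simp add: field_simps)
  qed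
  have Rm: "g' x - \<i> * r * g x = inverse (e x) * (wm - Fm x)" if "x \<in> {0..\<omega>}" for x
  proof -
    have "e x * (g' x - \<i> * r * g x) = wm - Fm x"
      using red(2)[OF that] unfolding em by (simp add: wm_def Fm_def)
    then show ?thesis using e0[of x] by (simp add: field_simps)
  qed
  define \<rho> where "\<rho> = exp (\<i> * complex_of_real \<theta>)"
  have \<rho>0: "\<rho> \<noteq> 0" by (simp add: \<rho>_def)
  have \<rho>i: "exp (- \<i> * complex_of_real \<theta>) = inverse \<rho>" by (simp add: \<rho>_def exp_minus)
  have ab: "a = \<rho> * inverse (e \<omega>)" "b = inverse \<rho> * inverse (e \<omega>)"
    unfolding a(1) b(1) \<rho>i em(2) by (simp_all add: \<rho>_def)
  \<comment> \<open>Both boundary conditions together say that each combination is multiplied by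
    \<rho> between 0 and \<omega>.\<close>
  have "\<rho> * wp = e \<omega> * (wp - Fp \<omega>)"
    using Rp[of \<omega>] \<omega> bc by (simp add: wp_def \<rho>_def algebra_simps)
  then have "a * wp = wp - Fp \<omega>" using e0[of \<omega>] by (simp add: ab field_simps)
  then have wp: "wp = - Fp \<omega> / (a - 1)" using a(2) by (simp add: field_simps)
  have "\<rho> * wm = inverse (e \<omega>) * (wm - Fm \<omega>)"
    using Rm[of \<omega>] \<omega> bc by (simp add: wm_def \<rho>_def algebra_simps)
  then have "wm = b * (wm - Fm \<omega>)" using e0[of \<omega>] \<rho>0 by (simp add: ab field_simps)
  then have wm: "wm = b / (b - 1) * Fm \<omega>" using b(2) by (simp add: field_simps)
  have "g x = (LINT t|Leb \<omega>. green a b r x t * f t)" if x: "x \<in> {0..\<omega>}" for x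
  proof -
    have "2 * \<i> * r * g x = e x * (wp - Fp x) - inverse (e x) * (wm - Fm x)"
      unfolding Rp[OF x, symmetric] Rm[OF x, symmetric] by simp
    then have "\<i> / (2 * r) * (2 * \<i> * r * g x) = \<i> / (2 * r) * (e x * (wp - Fp x) - inverse (e x) * (wm - Fm x))" by simp
    moreover have "\<i> / (2 * r) * (2 * \<i> * r * g x) = - g x" using r by (simp add: field_simps)
    ultimately have "g x = - (\<i> / (2 * r) * (e x * (wp - Fp x) - inverse (e x) * (wm - Fm x)))" by simp
    also have "\<dots> = \<i> / (2 * r) * (1 / (a - 1) * (e x * Fp \<omega>) + b / (b - 1) * (inverse (e x) * Fm \<omega>)
      + e x * Fp x - inverse (e x) * Fm x)"
      unfolding wp wm by (simp add: algebra_simps)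
    finally show ?thesis
      unfolding integral_green(2)[OF fi r] Fp_def Fm_def em(2) e_def[symmetric] by (simp add: mult_ac)
  qed
  then have "AE x in Leb \<omega>. g x = (LINT t|Leb \<omega>. green a b r x t * f t)" by (intro AE_I2) simp
  with g2 have "AE x in Leb \<omega>. g2 x = (LINT t|Leb \<omega>. green a b r x t * f t)"
    by eventually_elim simp
  then show ?thesis using fL L2 by blast
qed

text \<open>The kernel depends on \<open>s = x - t\<close> only, as a smooth \<open>p s\<close>
  minus \<open>n (max 0 s)\<close>. Since \<open>n\<close> vanishes at 0, the cut-off causes a kink
  but no jump, and \<open>max 0\<close> is Lipschitz with constant one.\<close>

lemma norm_green_bound:
  assumes \<omega>: "0 < \<omega>" and r: "r \<noteq> 0"
  obtains C where "0 < C" "\<And>x t. x \<in> {0..\<omega>} \<Longrightarrow> t \<in> {0..\<omega>} \<Longrightarrow> norm (green a b r x t) \<le> C"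
    and "\<And>x x' t. x \<in> {0..\<omega>} \<Longrightarrow> x' \<in> {0..\<omega>} \<Longrightarrow> t \<in> {0..\<omega>} \<Longrightarrow> norm (green a b r x t - green a b r x' t) \<le> C * \<bar>x - x'\<bar>"
    and "\<And>x t t'. x \<in> {0..\<omega>} \<Longrightarrow> t \<in> {0..\<omega>} \<Longrightarrow> t' \<in> {0..\<omega>} \<Longrightarrow> norm (green a b r x t - green a b r x t') \<le> C * \<bar>t - t'\<bar>"
proof -
  define \<alpha> where "\<alpha> = 1 / (a - 1)"
  define \<beta> where "\<beta> = b / (b - 1)"
  define \<kappa> where "\<kappa> = \<i> / (2 * r)"
  define p where "p s = \<kappa> * (\<alpha> * exp (\<i> * r * complex_of_real s) + \<beta> * exp (- \<i> * r * of_real s))" for s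
  define p' where "p' s = \<kappa> * (\<alpha> * (\<i> * r * exp (\<i> * r * complex_of_real s)) + \<beta> * (- \<i> * r * exp (- \<i> * r * of_real s)))" for s
  define n where "n s = sin (r * complex_of_real s) / r" for s
  define n' where "n' s = cos (r * complex_of_real s)" for s
  have G: "green a b r x t = p (x - t) - n (max 0 (x - t))" for x t
    by (auto simp: green_def p_def n_def \<alpha>_def \<beta>_def \<kappa>_def free_kernel_def max_def)
  have dp: "(p has_vector_derivative p' s) (at s within S)" for s S
    unfolding p_def p'_def
    by (intro has_vector_derivative_mult_right has_vector_derivative_add has_vector_derivative_exp_of_real)
  have dn: "(n has_vector_derivative n' s) (at s within S)" for s S
  proof -
    have "((\<lambda>w. sin (r * w) / r) has_field_derivative n' s) (at (complex_of_real s))"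
      unfolding n'_def using r by (auto intro!: derivative_eq_intros)
    then show ?thesis unfolding n_def by (rule has_vector_derivative_real_field)
  qed
  have bdd: "\<exists>B>0. \<forall>s\<in>{-\<omega>..\<omega>}. norm (f s) \<le> B" if "continuous_on {-\<omega>..\<omega>} f" for f :: "real \<Rightarrow> complex"
  proof -
    have "bounded (f ` {-\<omega>..\<omega>})" by (intro compact_imp_bounded compact_continuous_image that) auto
    then show ?thesis unfolding bounded_pos by auto
  qed
  have c: "continuous_on {-\<omega>..\<omega>} p" "continuous_on {-\<omega>..\<omega>} p'" "continuous_on {-\<omega>..\<omega>} n" "continuous_on {-\<omega>..\<omega>} n'"
    unfolding p_def p'_def n_def n'_def using r by (auto intro!: continuous_intros)
  obtain B1 where B1: "B1 > 0" "\<forall>s\<in>{-\<omega>..\<omega>}. norm (p s) \<le> B1" using bdd[OF c(1)] by blast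
  obtain B2 where B2: "B2 > 0" "\<forall>s\<in>{-\<omega>..\<omega>}. norm (p' s) \<le> B2" using bdd[OF c(2)] by blast
  obtain B3 where B3: "B3 > 0" "\<forall>s\<in>{-\<omega>..\<omega>}. norm (n s) \<le> B3" using bdd[OF c(3)] by blast
  obtain B4 where B4: "B4 > 0" "\<forall>s\<in>{-\<omega>..\<omega>}. norm (n' s) \<le> B4" using bdd[OF c(4)] by blast
  have lip: "norm (p s - n (max 0 s) - (p s' - n (max 0 s'))) \<le> (B2 + B4) * \<bar>s - s'\<bar>"
    if s: "s \<in> {-\<omega>..\<omega>}" "s' \<in> {-\<omega>..\<omega>}" for s s'
  proof -
    have 1: "norm (p s - p s') \<le> B2 * \<bar>s - s'\<bar>"
      by (rule vector_derivative_bound_lipschitz[OF dp _ s]) (use B2 in auto)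
    have "norm (n (max 0 s) - n (max 0 s')) \<le> B4 * \<bar>max 0 s - max 0 s'\<bar>"
      by (rule vector_derivative_bound_lipschitz[OF dn]) (use B4 s in auto)
    also have "\<dots> \<le> B4 * \<bar>s - s'\<bar>" using B4(1) by (intro mult_left_mono) auto
    finally have 2: "norm (n (max 0 s) - n (max 0 s')) \<le> B4 * \<bar>s - s'\<bar>" .
    have "p s - n (max 0 s) - (p s' - n (max 0 s')) = (p s - p s') - (n (max 0 s) - n (max 0 s'))" by simp
    then show ?thesis
      using order_trans[OF norm_triangle_ineq4 add_mono[OF 1 2]] by (simp only: distrib_right)
  qed
  show ?thesis
  proof (rule that[of "B1 + B2 + B3 + B4"])
    show "0 < B1 + B2 + B3 + B4" using B1 B2 B3 B4 by simp
    fix x t assume xt: "x \<in> {0..\<omega>}" "t \<in> {0..\<omega>}"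
    have "norm (green a b r x t) \<le> B1 + B3"
      unfolding G using xt B1 B3 by (intro order_trans[OF norm_triangle_ineq4] add_mono) auto
    then show "norm (green a b r x t) \<le> B1 + B2 + B3 + B4" using B2 B4 by linarith
  next
    fix x x' t assume xt: "x \<in> {0..\<omega>}" "x' \<in> {0..\<omega>}" "t \<in> {0..\<omega>}"
    have "norm (green a b r x t - green a b r x' t) \<le> (B2 + B4) * \<bar>(x - t) - (x' - t)\<bar>"
      unfolding G using xt by (intro lip) auto
    also have "\<dots> \<le> (B1 + B2 + B3 + B4) * \<bar>x - x'\<bar>" using B1 B3 by (simp add: mult_right_mono)
    finally show "norm (green a b r x t - green a b r x' t) \<le> (B1 + B2 + B3 + B4) * \<bar>x - x'\<bar>" .
  next
    fix x t t' assume xt: "x \<in> {0..\<omega>}" "t \<in> {0..\<omega>}" "t' \<in> {0..\<omega>}"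
    have "norm (green a b r x t - green a b r x t') \<le> (B2 + B4) * \<bar>(x - t) - (x - t')\<bar>"
      unfolding G using xt by (intro lip) auto
    also have "\<dots> \<le> (B1 + B2 + B3 + B4) * \<bar>t - t'\<bar>" using B1 B3 by (simp add: mult_right_mono abs_minus_commute)
    finally show "norm (green a b r x t - green a b r x t') \<le> (B1 + B2 + B3 + B4) * \<bar>t - t'\<bar>" .
  qed
qed

section \<open>The factors of the potential and the Green's operator\<close>

lemma v_factor_L2:
  assumes "integrable (Leb \<omega>) V"
  shows "v_factor V \<in> L2 \<omega>"
  unfolding L2_iff v_factor_def using assms by auto

text \<open>Trades \<open>Arg\<close> for a quotient, from which the measurability of
  \<open>u_factor V\<close> can be read off.\<close>

lemma u_factor_eq: "u_factor V x = (if V x = 0 then 0 else V x / of_real (sqrt (norm (V x))))"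
proof (cases "V x = 0")
  case False
  have "V x = of_real (norm (V x)) * exp (\<i> * of_real (Arg (V x)))"
    using Arg_eq[OF False] by simp
  moreover have "complex_of_real (norm (V x)) = of_real (sqrt (norm (V x))) * of_real (sqrt (norm (V x)))"
    by (simp flip: of_real_mult)
  ultimately show ?thesis
    using False unfolding u_factor_def by (simp add: field_simps)
qed (simp add: u_factor_def)

lemma norm_u_factor: "norm (u_factor V x) = norm (v_factor V x)"
  by (simp add: u_factor_def v_factor_def norm_mult)

lemma u_times_v_factor: "u_factor V x * v_factor V x = V x"
  by (simp add: u_factor_eq v_factor_def)

lemma u_factor_L2:
  assumes V: "integrable (Leb \<omega>) V"
  shows "u_factor V \<in> L2 \<omega>"
proof (rule L2_bound[OF _ v_factor_L2[OF V], where c = 1])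
  have [measurable]: "V \<in> borel_measurable (Leb \<omega>)" using V by auto
  show "u_factor V \<in> borel_measurable (Leb \<omega>)"
    unfolding u_factor_eq[abs_def] by measurable
qed (simp add: norm_u_factor)

definition green_operator :: "complex \<Rightarrow> complex \<Rightarrow> complex \<Rightarrow> real \<Rightarrow> (real \<Rightarrow> complex) \<Rightarrow> real \<Rightarrow> complex" where
  "green_operator a b r \<omega> q x = (LINT t|Leb \<omega>. green a b r x t * q t)"

lemma continuous_on_green_operator:
  assumes q: "integrable (Leb \<omega>) q" and r: "r \<noteq> 0"
  shows "continuous_on A (green_operator a b r \<omega> q)"
  unfolding green_operator_def[abs_def] integral_green(2)[OF q r]
  by (intro continuous_intros continuous_on_exp_moment q)

lemma green_operator_measurable:
  assumes q: "integrable (Leb \<omega>) q" and r: "r \<noteq> 0"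
  shows "green_operator a b r \<omega> q \<in> borel_measurable (Leb \<omega>)"
  by (intro continuous_imp_measurable_on_sets_lebesgue continuous_on_green_operator assms) auto

lemma norm_green_operator_le:
  assumes C: "\<And>x t. x \<in> {0..\<omega>} \<Longrightarrow> t \<in> {0..\<omega>} \<Longrightarrow> norm (green a b r x t) \<le> C"
    and q: "integrable (Leb \<omega>) q" and r: "r \<noteq> 0" and x: "x \<in> {0..\<omega>}"
  shows "norm (green_operator a b r \<omega> q x) \<le> C * (LINT t|Leb \<omega>. norm (q t))"
proof -
  have "norm (green_operator a b r \<omega> q x) \<le> (LINT t|Leb \<omega>. C * norm (q t))"
    unfolding green_operator_def
  proof (rule Bochner_Integration.integral_norm_bound_integral)
    show "integrable (Leb \<omega>) (\<lambda>t. green a b r x t * q t)" by (rule integral_green(1)[OF q r])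
    show "integrable (Leb \<omega>) (\<lambda>t. C * norm (q t))" using q by simp
    fix t assume "t \<in> space (Leb \<omega>)"
    then show "norm (green a b r x t * q t) \<le> C * norm (q t)"
      using C[of x t] x by (auto simp: norm_mult intro: mult_right_mono)
  qed
  then show ?thesis by simp
qed

section \<open>The Birman--Schwinger operator\<close>

locale birman_schwinger =
  fixes \<omega> \<theta> :: real and V :: "real \<Rightarrow> complex" and r a b :: complex
  assumes omega: "0 < \<omega>" and V: "integrable (Leb \<omega>) V" and r0: "r \<noteq> 0"
    and a_eq: "a = exp (\<i> * of_real \<theta>) * exp (- \<i> * r * of_real \<omega>)"
    and b_eq: "b = exp (- \<i> * of_real \<theta>) * exp (- \<i> * r * of_real \<omega>)"
    and spec: "r\<^sup>2 \<notin> op_spectrum \<omega> (H0 \<omega> \<theta>)"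
begin

lemma a1: "a \<noteq> 1"
proof
  assume "a = 1"
  then have "exp (\<i> * r * of_real \<omega>) = exp (\<i> * r * of_real \<omega>) * a" by simp
  also have "\<dots> = exp (\<i> * of_real \<theta>)" by (simp add: a_eq exp_minus)
  finally show False
    using not_in_spectrum_exp_neq[OF omega spec, of "\<i> * r"] by (simp add: power_mult_distrib)
qed

lemma b1: "b \<noteq> 1"
proof
  assume "b = 1"
  then have "exp (\<i> * of_real \<theta>) = exp (\<i> * of_real \<theta>) * b" by simp
  also have "\<dots> = exp (- \<i> * r * of_real \<omega>)" by (simp add: b_eq exp_minus)
  finally show False
    using not_in_spectrum_exp_neq[OF omega spec, of "- \<i> * r"] by (simp add: power_mult_distrib)
qed

abbreviation "u \<equiv> u_factor V"
abbreviation "v \<equiv> v_factor V"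
abbreviation "G \<equiv> green_operator a b r \<omega>"

text \<open>The integral operator with kernel \<open>- u x * green a b r x t * v t\<close>, acting
  on representatives. By \<open>K_op_iff\<close>, \<open>K_op\<close> consists of the pairs of
  square integrable functions that agree with it almost everywhere.\<close>

definition K :: "(real \<Rightarrow> complex) \<Rightarrow> real \<Rightarrow> complex" where
  "K f x = - (u x * G (\<lambda>t. v t * f t) x)"

definition green_const :: real where
  "green_const = (SOME C. 0 < C \<and> (\<forall>x\<in>{0..\<omega>}. \<forall>t\<in>{0..\<omega>}. norm (green a b r x t) \<le> C)
    \<and> (\<forall>x\<in>{0..\<omega>}. \<forall>x'\<in>{0..\<omega>}. \<forall>t\<in>{0..\<omega>}. norm (green a b r x t - green a b r x' t) \<le> C * \<bar>x - x'\<bar>)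
    \<and> (\<forall>x\<in>{0..\<omega>}. \<forall>t\<in>{0..\<omega>}. \<forall>t'\<in>{0..\<omega>}. norm (green a b r x t - green a b r x t') \<le> C * \<bar>t - t'\<bar>))"

lemma green_const:
  shows green_const_pos: "0 < green_const"
    and green_le: "\<And>x t. x \<in> {0..\<omega>} \<Longrightarrow> t \<in> {0..\<omega>} \<Longrightarrow> norm (green a b r x t) \<le> green_const"
    and green_lipschitz_left: "\<And>x x' t. x \<in> {0..\<omega>} \<Longrightarrow> x' \<in> {0..\<omega>} \<Longrightarrow> t \<in> {0..\<omega>} \<Longrightarrow> norm (green a b r x t - green a b r x' t) \<le> green_const * \<bar>x - x'\<bar>"
    and green_lipschitz_right: "\<And>x t t'. x \<in> {0..\<omega>} \<Longrightarrow> t \<in> {0..\<omega>} \<Longrightarrow> t' \<in> {0..\<omega>} \<Longrightarrow> norm (green a b r x t - green a b r x t') \<le> green_const * \<bar>t - t'\<bar>"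
proof -
  have "\<exists>C. 0 < C \<and> (\<forall>x\<in>{0..\<omega>}. \<forall>t\<in>{0..\<omega>}. norm (green a b r x t) \<le> C)
    \<and> (\<forall>x\<in>{0..\<omega>}. \<forall>x'\<in>{0..\<omega>}. \<forall>t\<in>{0..\<omega>}. norm (green a b r x t - green a b r x' t) \<le> C * \<bar>x - x'\<bar>)
    \<and> (\<forall>x\<in>{0..\<omega>}. \<forall>t\<in>{0..\<omega>}. \<forall>t'\<in>{0..\<omega>}. norm (green a b r x t - green a b r x t') \<le> C * \<bar>t - t'\<bar>)"
    by (rule norm_green_bound[OF omega r0, of a b]) blast
  from someI_ex[OF this, folded green_const_def]
  show "0 < green_const"
    "\<And>x t. x \<in> {0..\<omega>} \<Longrightarrow> t \<in> {0..\<omega>} \<Longrightarrow> norm (green a b r x t) \<le> green_const"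
    "\<And>x x' t. x \<in> {0..\<omega>} \<Longrightarrow> x' \<in> {0..\<omega>} \<Longrightarrow> t \<in> {0..\<omega>} \<Longrightarrow> norm (green a b r x t - green a b r x' t) \<le> green_const * \<bar>x - x'\<bar>"
    "\<And>x t t'. x \<in> {0..\<omega>} \<Longrightarrow> t \<in> {0..\<omega>} \<Longrightarrow> t' \<in> {0..\<omega>} \<Longrightarrow> norm (green a b r x t - green a b r x t') \<le> green_const * \<bar>t - t'\<bar>"
    by blast+
qed

lemma uL2: "u \<in> L2 \<omega>" by (rule u_factor_L2[OF V])
lemma vL2: "v \<in> L2 \<omega>" by (rule v_factor_L2[OF V])

lemma vf_integrable: "f \<in> L2 \<omega> \<Longrightarrow> integrable (Leb \<omega>) (\<lambda>t. v t * f t)"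
  by (rule L2_mult_integrable[OF vL2])

lemma K_pointwise:
  assumes f: "f \<in> L2 \<omega>" and x: "x \<in> {0<..<\<omega>}"
  shows "norm (K f x) \<le> norm (of_real (green_const * (l2_norm \<omega> v * l2_norm \<omega> f)) * u x)"
proof -
  have "norm (G (\<lambda>t. v t * f t) x) \<le> green_const * (LINT t|Leb \<omega>. norm (v t * f t))"
    by (rule norm_green_operator_le[OF green_le vf_integrable[OF f] r0]) (use x in auto)
  also have "\<dots> \<le> green_const * (l2_norm \<omega> v * l2_norm \<omega> f)"
    using green_const_pos by (intro mult_left_mono L2_cauchy_schwarz vL2 f) auto
  finally have "norm (u x) * norm (G (\<lambda>t. v t * f t) x) \<le> norm (u x) * (green_const * (l2_norm \<omega> v * l2_norm \<omega> f))"
    by (rule mult_left_mono) simp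
  then show ?thesis using green_const_pos by (simp add: K_def norm_mult abs_of_nonneg mult_ac)
qed

lemma K_measurable: "f \<in> L2 \<omega> \<Longrightarrow> K f \<in> borel_measurable (Leb \<omega>)"
  unfolding K_def[abs_def]
  by (intro borel_measurable_uminus borel_measurable_times L2_borel[OF uL2] green_operator_measurable vf_integrable r0)

lemma K_L2: "f \<in> L2 \<omega> \<Longrightarrow> K f \<in> L2 \<omega>"
  by (rule L2_bound[OF K_measurable L2_scale[OF uL2], where c = 1])
    (auto intro!: AE_I2 order_trans[OF K_pointwise])

lemma K_norm: "f \<in> L2 \<omega> \<Longrightarrow> l2_norm \<omega> (K f) \<le> green_const * l2_norm \<omega> v * l2_norm \<omega> u * l2_norm \<omega> f"
proof -
  assume f: "f \<in> L2 \<omega>"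
  have "l2_norm \<omega> (K f) \<le> l2_norm \<omega> (\<lambda>x. of_real (green_const * (l2_norm \<omega> v * l2_norm \<omega> f)) * u x)"
    by (rule l2_norm_mono[OF K_measurable[OF f] L2_scale[OF uL2]]) (intro AE_I2 K_pointwise f, simp)
  also have "\<dots> = green_const * l2_norm \<omega> v * l2_norm \<omega> u * l2_norm \<omega> f"
    unfolding l2_norm_scale using green_const_pos by (simp add: norm_mult abs_of_nonneg mult_ac)
  finally show ?thesis .
qed

lemma K_lin:
  assumes "f \<in> L2 \<omega>" "g \<in> L2 \<omega>"
  shows "K (\<lambda>x. c * f x + d * g x) x = c * K f x + d * K g x"
proof -
  have i: "integrable (Leb \<omega>) (\<lambda>t. green a b r x t * (v t * f t))" "integrable (Leb \<omega>) (\<lambda>t. green a b r x t * (v t * g t))"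
    by (intro integral_green(1) vf_integrable assms r0)+
  have "G (\<lambda>t. v t * (c * f t + d * g t)) x
    = (LINT t|Leb \<omega>. c * (green a b r x t * (v t * f t)) + d * (green a b r x t * (v t * g t)))"
    unfolding green_operator_def by (intro Bochner_Integration.integral_cong refl) (simp add: algebra_simps)
  also have "\<dots> = c * G (\<lambda>t. v t * f t) x + d * G (\<lambda>t. v t * g t) x"
    unfolding green_operator_def
    by (subst Bochner_Integration.integral_add) (auto intro: i integrable_mult_right)
  finally show ?thesis by (simp add: K_def algebra_simps)
qed

lemma K_diff:
  assumes "f \<in> L2 \<omega>" "g \<in> L2 \<omega>"
  shows "K (\<lambda>x. f x - g x) x = K f x - K g x"
  using K_lin[OF assms, of 1 "-1"] by simp

section \<open>Closure of the product of the resolvent with the two factors\<close>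

abbreviation "T0 \<equiv> mult_op \<omega> v O resolvent (H0 \<omega> \<theta>) (r\<^sup>2) O mult_op \<omega> u"

lemma green_operator_cong_AE:
  assumes "AE x in Leb \<omega>. q x = q' x" "integrable (Leb \<omega>) q" "integrable (Leb \<omega>) q'"
  shows "G q x = G q' x"
  unfolding green_operator_def
proof (rule integral_cong_AE)
  show "(\<lambda>t. green a b r x t * q t) \<in> borel_measurable (Leb \<omega>)" "(\<lambda>t. green a b r x t * q' t) \<in> borel_measurable (Leb \<omega>)"
    by (intro borel_measurable_integrable integral_green(1) assms r0)+
  show "AE t in Leb \<omega>. green a b r x t * q t = green a b r x t * q' t"
    using assms(1) by eventually_elim simp
qed

lemma T0_D:
  assumes "(f, h) \<in> T0"
  shows "f \<in> L2 \<omega> \<and> h \<in> L2 \<omega> \<and> (AE x in Leb \<omega>. h x = - K f x)"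
proof -
  obtain w g2 where w: "(f, w) \<in> mult_op \<omega> v" and g2: "(w, g2) \<in> resolvent (H0 \<omega> \<theta>) (r\<^sup>2)"
    and h: "(g2, h) \<in> mult_op \<omega> u" using assms by auto
  have f: "f \<in> L2 \<omega>" "w \<in> L2 \<omega>" "AE x in Leb \<omega>. w x = v x * f x" using w by (auto simp: mult_op_def)
  have G: "AE x in Leb \<omega>. g2 x = G w x"
    using resolvent_green[OF omega g2 r0 a_eq a1 b_eq b1] by (simp add: green_operator_def)
  have "G w x = G (\<lambda>t. v t * f t) x" for x
    by (rule green_operator_cong_AE[OF f(3) L2_integrable[OF f(2)] vf_integrable[OF f(1)]])
  moreover have h': "h \<in> L2 \<omega>" "AE x in Leb \<omega>. h x = u x * g2 x" using h by (auto simp: mult_op_def)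
  ultimately have "AE x in Leb \<omega>. h x = - K f x"
    using G h'(2) by (auto simp: K_def elim!: eventually_elim2)
  then show ?thesis using f h' by blast
qed

text \<open>\<open>resolvent_green\<close> only computes values of the resolvent; that there is a
  value at \<open>v x * f x\<close> is the spectral hypothesis.\<close>

lemma T0_I:
  assumes f: "f \<in> L2 \<omega>" and vf: "(\<lambda>x. v x * f x) \<in> L2 \<omega>"
  shows "(f, \<lambda>x. - K f x) \<in> T0"
proof -
  have "\<exists>g2. ((\<lambda>x. v x * f x), g2) \<in> resolvent (H0 \<omega> \<theta>) (r\<^sup>2)"
    using spec vf unfolding op_spectrum_def bounded_operator_def by blast
  then obtain g2 where g2: "((\<lambda>x. v x * f x), g2) \<in> resolvent (H0 \<omega> \<theta>) (r\<^sup>2)" ..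
  have G: "g2 \<in> L2 \<omega>" "AE x in Leb \<omega>. g2 x = G (\<lambda>t. v t * f t) x"
    using resolvent_green[OF omega g2 r0 a_eq a1 b_eq b1] by (auto simp: green_operator_def)
  have "(\<lambda>x. - K f x) \<in> L2 \<omega>" using L2_scale[OF K_L2[OF f], of "-1"] by simp
  then have "(g2, \<lambda>x. - K f x) \<in> mult_op \<omega> u"
    using G by (auto simp: mult_op_def K_def elim!: eventually_mono)
  moreover have "(f, \<lambda>x. v x * f x) \<in> mult_op \<omega> v" using f vf by (simp add: mult_op_def)
  ultimately show ?thesis using g2 by blast
qed

text \<open>The unclosed product is defined only for \<open>f\<close> with \<open>v x * f x\<close>
  square integrable. Cutting \<open>f\<close> off where \<open>norm (V x) > n\<close> lands in this
  domain and approximates \<open>f\<close>; boundedness of \<open>K\<close> carries the formula to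
  the limit in both directions.\<close>

lemma closure_T0: "(f, h) \<in> op_closure \<omega> T0 \<longleftrightarrow> f \<in> L2 \<omega> \<and> h \<in> L2 \<omega> \<and> (AE x in Leb \<omega>. h x = - K f x)"
proof
  assume "(f, h) \<in> op_closure \<omega> T0"
  then obtain F H where f: "f \<in> L2 \<omega>" "h \<in> L2 \<omega>" and FH: "\<And>n::nat. (F n, H n) \<in> T0"
    and limF: "(\<lambda>n. l2_norm \<omega> (\<lambda>x. F n x - f x)) \<longlonglongrightarrow> 0"
    and limH: "(\<lambda>n. l2_norm \<omega> (\<lambda>x. H n x - h x)) \<longlonglongrightarrow> 0"
    unfolding op_closure_def by blast
  have FL: "F n \<in> L2 \<omega>" and HL: "H n \<in> L2 \<omega>" and HK: "AE x in Leb \<omega>. H n x = - K (F n) x" for n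
    using T0_D[OF FH[of n]] by auto
  have mK: "(\<lambda>x. - K f x) \<in> L2 \<omega>" using L2_scale[OF K_L2[OF f(1)], of "-1"] by simp
  define C where "C = green_const * l2_norm \<omega> v * l2_norm \<omega> u"
  have le: "l2_norm \<omega> (\<lambda>x. h x - - K f x) \<le> l2_norm \<omega> (\<lambda>x. H n x - h x) + C * l2_norm \<omega> (\<lambda>x. F n x - f x)" for n
  proof -
    have "l2_norm \<omega> (\<lambda>x. h x - - K f x) \<le> l2_norm \<omega> (\<lambda>x. h x - H n x) + l2_norm \<omega> (\<lambda>x. H n x - - K f x)"
      by (rule l2_norm_triangle_diff[OF f(2) HL mK])
    moreover have "l2_norm \<omega> (\<lambda>x. H n x - - K f x) \<le> l2_norm \<omega> (K (\<lambda>x. F n x - f x))"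
    proof (rule l2_norm_mono)
      show "(\<lambda>x. H n x - - K f x) \<in> borel_measurable (Leb \<omega>)" by (intro L2_borel L2_diff HL mK)
      show "K (\<lambda>x. F n x - f x) \<in> L2 \<omega>" by (intro K_L2 L2_diff FL f)
      show "AE x in Leb \<omega>. norm (H n x - - K f x) \<le> norm (K (\<lambda>x. F n x - f x) x)"
        using HK[of n] by eventually_elim (simp add: K_diff FL f norm_minus_commute)
    qed
    moreover have "l2_norm \<omega> (K (\<lambda>x. F n x - f x)) \<le> C * l2_norm \<omega> (\<lambda>x. F n x - f x)"
      unfolding C_def by (intro K_norm L2_diff FL f)
    ultimately show ?thesis using l2_norm_minus_commute[of \<omega> h "H n"] by linarith
  qed
  have "(\<lambda>n. l2_norm \<omega> (\<lambda>x. H n x - h x) + C * l2_norm \<omega> (\<lambda>x. F n x - f x)) \<longlonglongrightarrow> 0 + C * 0"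
    by (intro tendsto_intros limF limH)
  then have "l2_norm \<omega> (\<lambda>x. h x - - K f x) \<le> 0 + C * 0"
    by (rule LIMSEQ_le_const) (use le in blast)
  then have "l2_norm \<omega> (\<lambda>x. h x - - K f x) = 0" by (intro antisym l2_norm_nonneg) simp
  then have "AE x in Leb \<omega>. h x - - K f x = 0" by (subst (asm) l2_norm_eq_0_iff) (intro L2_diff f mK)
  then have "AE x in Leb \<omega>. h x = - K f x" by eventually_elim (simp add: eq_neg_iff_add_eq_0)
  then show "f \<in> L2 \<omega> \<and> h \<in> L2 \<omega> \<and> (AE x in Leb \<omega>. h x = - K f x)" using f by blast
next
  assume "f \<in> L2 \<omega> \<and> h \<in> L2 \<omega> \<and> (AE x in Leb \<omega>. h x = - K f x)"
  then have f: "f \<in> L2 \<omega>" "h \<in> L2 \<omega>" and h: "AE x in Leb \<omega>. h x = - K f x" by auto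
  define F where "F n x = (if norm (V x) \<le> real n then f x else 0)" for n x
  have [measurable]: "V \<in> borel_measurable (Leb \<omega>)" "f \<in> borel_measurable (Leb \<omega>)" "v \<in> borel_measurable (Leb \<omega>)"
    using V f vL2 by (auto simp: L2_iff)
  have Fm[measurable]: "F n \<in> borel_measurable (Leb \<omega>)" for n unfolding F_def by measurable
  have FL: "F n \<in> L2 \<omega>" for n
    by (rule L2_bound[OF Fm f(1), where c = 1]) (auto simp: F_def)
  have vF: "(\<lambda>x. v x * F n x) \<in> L2 \<omega>" for n
  proof (rule L2_bound[OF _ f(1), where c = "sqrt n"])
    show "AE x in Leb \<omega>. norm (v x * F n x) \<le> sqrt n * norm (f x)"
      by (intro AE_I2) (auto simp: F_def v_factor_def norm_mult intro!: mult_right_mono)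
  qed measurable
  have limF: "(\<lambda>n. l2_norm \<omega> (\<lambda>x. F n x - f x)) \<longlonglongrightarrow> 0"
  proof -
    have "(\<lambda>n. LINT x|Leb \<omega>. (norm (F n x - f x))\<^sup>2) \<longlonglongrightarrow> (LINT x|Leb \<omega>. 0)"
    proof (rule integral_dominated_convergence[where w = "\<lambda>x. (norm (f x))\<^sup>2"])
      show "integrable (Leb \<omega>) (\<lambda>x. (norm (f x))\<^sup>2)" using f by (simp add: L2_iff)
      show "AE x in Leb \<omega>. (\<lambda>n. (norm (F n x - f x))\<^sup>2) \<longlonglongrightarrow> 0"
      proof (rule AE_I2)
        fix x
        obtain N :: nat where N: "norm (V x) \<le> N" using real_arch_simple by blast
        have "\<forall>\<^sub>F n in sequentially. (norm (F n x - f x))\<^sup>2 = 0"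
          by (rule eventually_sequentiallyI[of N]) (use N in \<open>auto simp: F_def\<close>)
        then show "(\<lambda>n. (norm (F n x - f x))\<^sup>2) \<longlonglongrightarrow> 0" by (rule tendsto_eventually)
      qed
    qed (auto simp: F_def)
    then have "(\<lambda>n. sqrt (LINT x|Leb \<omega>. (norm (F n x - f x))\<^sup>2)) \<longlonglongrightarrow> sqrt 0"
      by (intro tendsto_real_sqrt) simp
    then show ?thesis by (simp add: l2_norm_def)
  qed
  have limH: "(\<lambda>n. l2_norm \<omega> (\<lambda>x. - K (F n) x - h x)) \<longlonglongrightarrow> 0"
  proof (rule Lim_null_comparison)
    show "\<forall>\<^sub>F n in sequentially. norm (l2_norm \<omega> (\<lambda>x. - K (F n) x - h x))
      \<le> green_const * l2_norm \<omega> v * l2_norm \<omega> u * l2_norm \<omega> (\<lambda>x. F n x - f x)"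
    proof (intro always_eventually allI)
      fix n
      have mK: "(\<lambda>x. - K (F n) x) \<in> L2 \<omega>" using L2_scale[OF K_L2[OF FL], of "-1"] by simp
      have "l2_norm \<omega> (\<lambda>x. - K (F n) x - h x) \<le> l2_norm \<omega> (K (\<lambda>x. F n x - f x))"
      proof (rule l2_norm_mono)
        show "(\<lambda>x. - K (F n) x - h x) \<in> borel_measurable (Leb \<omega>)" by (intro L2_borel L2_diff mK f)
        show "K (\<lambda>x. F n x - f x) \<in> L2 \<omega>" by (intro K_L2 L2_diff FL f)
        show "AE x in Leb \<omega>. norm (- K (F n) x - h x) \<le> norm (K (\<lambda>x. F n x - f x) x)"
          using h by eventually_elim (simp add: K_diff FL f norm_minus_commute)
      qed
      also have "\<dots> \<le> green_const * l2_norm \<omega> v * l2_norm \<omega> u * l2_norm \<omega> (\<lambda>x. F n x - f x)"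
        by (intro K_norm L2_diff FL f)
      finally show "norm (l2_norm \<omega> (\<lambda>x. - K (F n) x - h x)) \<le> green_const * l2_norm \<omega> v * l2_norm \<omega> u * l2_norm \<omega> (\<lambda>x. F n x - f x)"
        by simp
    qed
    show "(\<lambda>n. green_const * l2_norm \<omega> v * l2_norm \<omega> u * l2_norm \<omega> (\<lambda>x. F n x - f x)) \<longlonglongrightarrow> 0"
      using tendsto_mult_right_zero[OF limF] by simp
  qed
  have T0n: "(F n, \<lambda>x. - K (F n) x) \<in> T0" for n by (rule T0_I[OF FL vF])
  show "(f, h) \<in> op_closure \<omega> T0"
    unfolding op_closure_def mem_Collect_eq case_prod_conv
    by (intro conjI f, rule exI[of _ F], rule exI[of _ "\<lambda>n x. - K (F n) x"]) (intro conjI allI T0n limF limH)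
qed

lemma K_op_iff: "(f, h) \<in> K_op \<omega> \<theta> V (r\<^sup>2) \<longleftrightarrow> f \<in> L2 \<omega> \<and> h \<in> L2 \<omega> \<and> (AE x in Leb \<omega>. h x = K f x)"
proof -
  have "(f, h) \<in> K_op \<omega> \<theta> V (r\<^sup>2) \<longleftrightarrow> (f, \<lambda>x. - h x) \<in> op_closure \<omega> T0"
  proof
    assume "(f, h) \<in> K_op \<omega> \<theta> V (r\<^sup>2)"
    then show "(f, \<lambda>x. - h x) \<in> op_closure \<omega> T0" by (auto simp: K_op_def op_uminus_def)
  next
    assume *: "(f, \<lambda>x. - h x) \<in> op_closure \<omega> T0"
    have "(f, \<lambda>x. - (- h x)) \<in> op_uminus (op_closure \<omega> T0)"
      unfolding op_uminus_def by (rule CollectI, rule exI[of _ f], rule exI[of _ "\<lambda>x. - h x"]) (use * in simp)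
    then show "(f, h) \<in> K_op \<omega> \<theta> V (r\<^sup>2)" by (simp add: K_op_def)
  qed
  also have "\<dots> \<longleftrightarrow> f \<in> L2 \<omega> \<and> h \<in> L2 \<omega> \<and> (AE x in Leb \<omega>. h x = K f x)"
    unfolding closure_T0 using L2_scale[of h \<omega> "-1"] L2_scale[of "\<lambda>x. - h x" \<omega> "-1"] by auto
  finally show ?thesis .
qed

lemma bounded_K_op: "bounded_operator \<omega> (K_op \<omega> \<theta> V (r\<^sup>2))"
  unfolding bounded_operator_def
proof (intro conjI ballI allI impI)
  show "K_op \<omega> \<theta> V (r\<^sup>2) \<subseteq> L2 \<omega> \<times> L2 \<omega>" using K_op_iff by auto
  show "\<exists>h. (f, h) \<in> K_op \<omega> \<theta> V (r\<^sup>2)" if "f \<in> L2 \<omega>" for f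
    using that K_L2 by (intro exI[of _ "K f"]) (simp add: K_op_iff)
  show "((\<lambda>x. c * f x + d * f' x), (\<lambda>x. c * h x + d * h' x)) \<in> K_op \<omega> \<theta> V (r\<^sup>2)"
    if "(f, h) \<in> K_op \<omega> \<theta> V (r\<^sup>2)" "(f', h') \<in> K_op \<omega> \<theta> V (r\<^sup>2)" for f h f' h' c d
  proof -
    have *: "f \<in> L2 \<omega>" "h \<in> L2 \<omega>" "f' \<in> L2 \<omega>" "h' \<in> L2 \<omega>"
      "AE x in Leb \<omega>. h x = K f x" "AE x in Leb \<omega>. h' x = K f' x" using that by (auto simp: K_op_iff)
    have "AE x in Leb \<omega>. c * h x + d * h' x = K (\<lambda>x. c * f x + d * f' x) x"
      using *(5,6) by eventually_elim (simp add: K_lin *)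
    then show ?thesis using * by (auto simp: K_op_iff intro!: L2_add L2_scale)
  qed
  show "\<exists>C. \<forall>(f, h)\<in>K_op \<omega> \<theta> V (r\<^sup>2). l2_norm \<omega> h \<le> C * l2_norm \<omega> f"
  proof (intro exI[of _ "green_const * l2_norm \<omega> v * l2_norm \<omega> u"] ballI, clarify)
    fix f h assume "(f, h) \<in> K_op \<omega> \<theta> V (r\<^sup>2)"
    then have *: "f \<in> L2 \<omega>" "h \<in> L2 \<omega>" "AE x in Leb \<omega>. h x = K f x" by (auto simp: K_op_iff)
    have "l2_norm \<omega> h = l2_norm \<omega> (K f)"
      by (rule l2_norm_cong_AE[OF *(3) L2_borel[OF *(2)] L2_borel[OF K_L2[OF *(1)]]])
    then show "l2_norm \<omega> h \<le> green_const * l2_norm \<omega> v * l2_norm \<omega> u * l2_norm \<omega> f" using K_norm[OF *(1)] by simp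
  qed
qed

text \<open>The choice in \<open>op_app\<close> is determined only almost everywhere, which inner
  products do not notice.\<close>

lemma inner_op_app_K:
  assumes "f \<in> L2 \<omega>" "g \<in> L2 \<omega>"
  shows "l2_inner \<omega> g (op_app (K_op \<omega> \<theta> V (r\<^sup>2)) f) = l2_inner \<omega> g (K f)"
proof -
  have "(f, K f) \<in> K_op \<omega> \<theta> V (r\<^sup>2)" using assms K_L2 by (simp add: K_op_iff)
  then have "(f, op_app (K_op \<omega> \<theta> V (r\<^sup>2)) f) \<in> K_op \<omega> \<theta> V (r\<^sup>2)"
    unfolding op_app_def by (rule someI[of "\<lambda>h. (f, h) \<in> K_op \<omega> \<theta> V (r\<^sup>2)"])
  then have "op_app (K_op \<omega> \<theta> V (r\<^sup>2)) f \<in> L2 \<omega>" "AE x in Leb \<omega>. op_app (K_op \<omega> \<theta> V (r\<^sup>2)) f x = K f x"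
    by (auto simp: K_op_iff)
  then show ?thesis by (intro l2_inner_cong_AE K_L2 assms)
qed

end

section \<open>Uniform decay of the basis coefficients of cut-offs of u\<close>

lemma node_close:
  assumes \<omega>: "0 < \<omega>" and m: "0 < m" and x: "x \<in> {0..\<omega>}"
  shows "\<exists>p\<le>m. \<bar>node \<omega> m p - x\<bar> \<le> \<omega> / m"
proof -
  define p where "p = nat \<lfloor>x * m / \<omega>\<rfloor>"
  have xm: "0 \<le> x * m / \<omega>" "x * m / \<omega> \<le> m"
    using x \<omega> mult_right_mono[of x \<omega> "real m"] by (auto simp: divide_le_eq mult.commute)
  have fl: "real p \<le> x * m / \<omega>" "x * m / \<omega> < real p + 1" using xm by (auto simp: p_def)
  have p: "p \<le> m" using fl(1) xm(2) by linarith
  have "node \<omega> m p - x = (real p - x * m / \<omega>) * (\<omega> / m)"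
    using \<omega> m by (simp add: node_def field_simps)
  also have "\<bar>\<dots>\<bar> \<le> 1 * (\<omega> / m)" unfolding abs_mult using fl \<omega> by (intro mult_mono) auto
  finally show ?thesis using p by auto
qed

lemma integral_restrict_lessThan:
  fixes q :: "real \<Rightarrow> complex"
  assumes "x \<in> {0..\<omega>}"
  shows "(LINT t|lebesgue_on {0<..<x}. q t) = (LINT t|Leb \<omega>. (if t < x then q t else 0))"
proof -
  have "(LINT t|lebesgue_on {0<..<x}. q t) = (LINT t|lebesgue. indicator {0<..<x} t *\<^sub>R q t)"
    by (rule integral_restrict_space) simp
  also have "\<dots> = (LINT t|lebesgue. indicator {0<..<\<omega>} t *\<^sub>R (if t < x then q t else 0))"
    by (intro Bochner_Integration.integral_cong refl) (use assms in \<open>auto simp: indicator_def\<close>)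
  also have "\<dots> = (LINT t|Leb \<omega>. (if t < x then q t else 0))"
    by (rule integral_restrict_space[symmetric]) simp
  finally show ?thesis .
qed

lemma cell_mass_add_tail:
  fixes w :: "real \<Rightarrow> complex"
  assumes \<omega>: "0 < \<omega>" and w: "integrable (Leb \<omega>) w" and m: "0 < m" and l: "l \<le> m"
  shows "(\<Sum>p\<in>{l..<m}. cell_mass \<omega> w m p) = (LINT x|Leb \<omega>. (if x < node \<omega> m l then 0 else w x))"
proof -
  have "(\<Sum>p<m. cell_mass \<omega> w m p) = (\<Sum>p<l. cell_mass \<omega> w m p) + (\<Sum>p\<in>{l..<m}. cell_mass \<omega> w m p)"
    using l by (subst sum.union_disjoint[symmetric]) (auto intro!: sum.cong)
  moreover have "(\<Sum>p<m. cell_mass \<omega> w m p) = (LINT x|Leb \<omega>. w x)"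
    unfolding cell_mass_def by (rule integral_cells[OF \<omega> w m, symmetric])
  moreover have "(\<Sum>p<l. cell_mass \<omega> w m p) = (LINT x|Leb \<omega>. (if x < node \<omega> m l then w x else 0))"
    unfolding cell_mass_def by (rule integral_lessThan_node[OF \<omega> w, symmetric])
  moreover have "(LINT x|Leb \<omega>. (if x < node \<omega> m l then 0 else w x))
    = (LINT x|Leb \<omega>. w x - (if x < node \<omega> m l then w x else 0))"
    by (intro Bochner_Integration.integral_cong) auto
  moreover have "\<dots> = (LINT x|Leb \<omega>. w x) - (LINT x|Leb \<omega>. (if x < node \<omega> m l then w x else 0))"
    by (intro Bochner_Integration.integral_diff w integrable_lessThan)
  ultimately show ?thesis by (simp add: algebra_simps)
qed

lemma sum_triangle_swap:
  fixes f :: "nat \<Rightarrow> nat \<Rightarrow> 'a::comm_monoid_add"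
  shows "(\<Sum>l<m. \<Sum>p\<in>{l..<m}. f l p) = (\<Sum>p<m. \<Sum>l\<le>p. f l p)"
proof -
  have "(\<Sum>l<m. \<Sum>p\<in>{l..<m}. f l p) = (\<Sum>l\<in>{..<m}. \<Sum>p\<in>{p \<in> {..<m}. l \<le> p}. f l p)"
    by (intro sum.cong) auto
  also have "\<dots> = (\<Sum>p\<in>{..<m}. \<Sum>l\<in>{l \<in> {..<m}. l \<le> p}. f l p)"
    by (rule sum.swap_restrict) auto
  also have "\<dots> = (\<Sum>p<m. \<Sum>l\<le>p. f l p)"
    by (intro sum.cong) auto
  finally show ?thesis .
qed

context birman_schwinger
begin

text \<open>Summation by parts over the rows of the grid kernel replaces the integral of
  \<open>cnj (d i x) * u x\<close> over one cell by that over everything to the right of a node,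
  which is an inner product with \<open>u_tail\<close>.\<close>

definition u_tail :: "real \<Rightarrow> real \<Rightarrow> complex" where
  "u_tail t x = (if x < t then 0 else u x)"

lemma u_tail_measurable: "u_tail t \<in> borel_measurable (Leb \<omega>)"
proof -
  have "(\<lambda>x. u x - (if x < t then u x else 0)) \<in> borel_measurable (Leb \<omega>)"
    by (intro borel_measurable_diff borel_measurable_lessThan L2_borel[OF uL2])
  moreover have "(\<lambda>x. u x - (if x < t then u x else 0)) = u_tail t" by (auto simp: u_tail_def)
  ultimately show ?thesis by simp
qed

lemma u_tail_L2: "u_tail t \<in> L2 \<omega>"
  by (rule L2_bound[OF u_tail_measurable uL2, where c = 1]) (auto simp: u_tail_def)

lemma u_tail_norm: "l2_norm \<omega> (u_tail t) \<le> l2_norm \<omega> u"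
  by (rule l2_norm_mono[OF u_tail_measurable uL2]) (auto simp: u_tail_def)

text \<open>The squared distance of two tails is the integral of \<open>norm (V x)\<close> between
  their cut-offs. Uniform continuity of its primitive \<open>W\<close> makes finitely many tails a
  net for the whole family.\<close>

lemma u_tail_close:
  assumes \<epsilon>: "0 < \<epsilon>"
  shows "\<exists>m>0. \<forall>t\<in>{0..\<omega>}. \<exists>p\<le>m. (l2_norm \<omega> (\<lambda>x. u_tail t x - u_tail (node \<omega> m p) x))\<^sup>2 \<le> \<epsilon>"
proof -
  define W where "W x = (LINT t|Leb \<omega>. (if t < x then complex_of_real (norm (V t)) else 0))" for x
  have nV: "integrable (Leb \<omega>) (\<lambda>t. complex_of_real (norm (V t)))" using V by auto
  have "continuous_on {0..\<omega>} W" unfolding W_def by (rule continuous_on_integral_lessThan[OF nV])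
  then have uc: "uniformly_continuous_on {0..\<omega>} W" by (rule compact_uniformly_continuous) simp
  obtain d where d: "0 < d" "\<And>s t. s \<in> {0..\<omega>} \<Longrightarrow> t \<in> {0..\<omega>} \<Longrightarrow> dist t s < d \<Longrightarrow> dist (W t) (W s) < \<epsilon>"
    by (rule uniformly_continuous_onE[OF uc \<epsilon>]) blast
  obtain m where m: "0 < m" "\<omega> / real m < d" using eventually_mesh_less[OF d(1), of \<omega>] by blast
  have le: "(l2_norm \<omega> (\<lambda>x. u_tail t x - u_tail s x))\<^sup>2 = norm (W t - W s)" if "s \<le> t" for s t
  proof -
    have "W t - W s = (LINT x|Leb \<omega>. (if x < t then complex_of_real (norm (V x)) else 0) - (if x < s then complex_of_real (norm (V x)) else 0))"
      unfolding W_def by (intro Bochner_Integration.integral_diff[symmetric] integrable_lessThan nV)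
    also have "\<dots> = (LINT x|Leb \<omega>. complex_of_real ((norm (u_tail t x - u_tail s x))\<^sup>2))"
      by (intro Bochner_Integration.integral_cong refl)
        (use that in \<open>auto simp: u_tail_def norm_u_factor v_factor_def simp flip: of_real_power\<close>)
    also have "\<dots> = of_real ((l2_norm \<omega> (\<lambda>x. u_tail t x - u_tail s x))\<^sup>2)"
      unfolding l2_norm_sq by (rule integral_complex_of_real)
    finally show ?thesis by (simp del: of_real_power)
  qed
  have "\<exists>p\<le>m. (l2_norm \<omega> (\<lambda>x. u_tail t x - u_tail (node \<omega> m p) x))\<^sup>2 \<le> \<epsilon>" if t: "t \<in> {0..\<omega>}" for t
  proof -
    obtain p where p: "p \<le> m" "\<bar>node \<omega> m p - t\<bar> \<le> \<omega> / m" using node_close[OF omega m(1) t] by blast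
    have "dist (W t) (W (node \<omega> m p)) < \<epsilon>"
      using p m(2) t node_in[of \<omega> p m] omega by (intro d(2)) (auto simp: dist_real_def abs_minus_commute)
    then have W: "norm (W t - W (node \<omega> m p)) < \<epsilon>" by (simp add: dist_norm)
    have "(l2_norm \<omega> (\<lambda>x. u_tail t x - u_tail (node \<omega> m p) x))\<^sup>2 = norm (W t - W (node \<omega> m p))"
    proof (cases "node \<omega> m p \<le> t")
      case True
      then show ?thesis by (rule le)
    next
      case False
      then have "(l2_norm \<omega> (\<lambda>x. u_tail (node \<omega> m p) x - u_tail t x))\<^sup>2 = norm (W (node \<omega> m p) - W t)" by (intro le) simp
      then show ?thesis by (simp only: l2_norm_minus_commute[of \<omega> "u_tail t"] norm_minus_commute)
    qed
    with W p show ?thesis by auto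
  qed
  with m(1) show ?thesis by blast
qed

text \<open>The tails of the Bessel sums tend to zero for each function separately. The finite net
  makes this uniform in \<open>t\<close>, the distance to the net being controlled by Bessel's
  inequality.\<close>

lemma u_tail_uniform:
  assumes e: "orthonormal_basis \<omega> e" and \<epsilon>: "0 < \<epsilon>"
  shows "\<exists>N0. \<forall>N\<ge>N0. \<forall>M. \<forall>t\<in>{0..\<omega>}. (\<Sum>i\<in>{N..<M}. (norm (l2_inner \<omega> (e i) (u_tail t)))\<^sup>2) \<le> \<epsilon>"
proof -
  have eL: "e i \<in> L2 \<omega>" for i using e by (auto simp: orthonormal_basis_def)
  \<comment> \<open>A quarter each for the net function and the difference, because squaring a sum
    of two terms doubles both.\<close>
  obtain m where m: "0 < m" "\<And>t. t \<in> {0..\<omega>} \<Longrightarrow> \<exists>p\<le>m. (l2_norm \<omega> (\<lambda>x. u_tail t x - u_tail (node \<omega> m p) x))\<^sup>2 \<le> \<epsilon> / 4"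
    using u_tail_close[of "\<epsilon> / 4"] \<epsilon> by auto
  have "\<forall>p. \<exists>N0. \<forall>N\<ge>N0. \<forall>M. (\<Sum>i\<in>{N..<M}. (norm (l2_inner \<omega> (e i) (u_tail (node \<omega> m p))))\<^sup>2) \<le> \<epsilon> / 4"
    using parseval_tail[OF e u_tail_L2, of "\<epsilon> / 4"] \<epsilon> by auto
  then obtain N0 where N0: "\<And>p N M. N \<ge> N0 p \<Longrightarrow> (\<Sum>i\<in>{N..<M}. (norm (l2_inner \<omega> (e i) (u_tail (node \<omega> m p))))\<^sup>2) \<le> \<epsilon> / 4"
    by metis
  define N1 where "N1 = (\<Sum>p\<le>m. N0 p)"
  have N1: "N0 p \<le> N1" if "p \<le> m" for p unfolding N1_def by (rule member_le_sum) (use that in auto)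
  have "(\<Sum>i\<in>{N..<M}. (norm (l2_inner \<omega> (e i) (u_tail t)))\<^sup>2) \<le> \<epsilon>" if N: "N \<ge> N1" and t: "t \<in> {0..\<omega>}" for N M t
  proof -
    obtain p where p: "p \<le> m" "(l2_norm \<omega> (\<lambda>x. u_tail t x - u_tail (node \<omega> m p) x))\<^sup>2 \<le> \<epsilon> / 4" using m(2)[OF t] by blast
    let ?f = "\<lambda>x. u_tail t x - u_tail (node \<omega> m p) x"
    have fL: "?f \<in> L2 \<omega>" by (intro L2_diff u_tail_L2)
    have "(norm (l2_inner \<omega> (e i) (u_tail t)))\<^sup>2 \<le> 2 * (norm (l2_inner \<omega> (e i) (u_tail (node \<omega> m p))))\<^sup>2 + 2 * (norm (l2_inner \<omega> (e i) ?f))\<^sup>2" for i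
    proof -
      define A B where "A = l2_inner \<omega> (e i) (u_tail (node \<omega> m p))" and "B = l2_inner \<omega> (e i) ?f"
      have 1: "l2_inner \<omega> (e i) (u_tail t) = A + B"
        unfolding A_def B_def by (simp add: l2_inner_diff_right[OF eL u_tail_L2 u_tail_L2])
      have 2: "(norm (A + B))\<^sup>2 \<le> (norm A + norm B)\<^sup>2" by (intro power_mono norm_triangle_ineq) simp
      have 3: "(norm A + norm B)\<^sup>2 \<le> 2 * (norm A)\<^sup>2 + 2 * (norm B)\<^sup>2"
        using sum_squares_bound[of "norm A" "norm B"] by (simp add: power2_sum)
      show ?thesis unfolding 1 A_def[symmetric] B_def[symmetric] by (rule order_trans[OF 2 3])
    qed
    then have "(\<Sum>i\<in>{N..<M}. (norm (l2_inner \<omega> (e i) (u_tail t)))\<^sup>2)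
      \<le> (\<Sum>i\<in>{N..<M}. 2 * (norm (l2_inner \<omega> (e i) (u_tail (node \<omega> m p))))\<^sup>2 + 2 * (norm (l2_inner \<omega> (e i) ?f))\<^sup>2)"
      by (intro sum_mono)
    also have "\<dots> = 2 * (\<Sum>i\<in>{N..<M}. (norm (l2_inner \<omega> (e i) (u_tail (node \<omega> m p))))\<^sup>2) + 2 * (\<Sum>i\<in>{N..<M}. (norm (l2_inner \<omega> (e i) ?f))\<^sup>2)"
      by (simp add: sum.distrib sum_distrib_left)
    also have "\<dots> \<le> 2 * (\<epsilon> / 4) + 2 * (\<epsilon> / 4)"
      using N0[of p N M] N1[OF p(1)] N bessel_inequality[OF e _ fL, of "{N..<M}"] p(2) by simp
    finally show ?thesis by simp
  qed
  then show ?thesis by blast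
qed

text \<open>The supremum over \<open>t\<close> and \<open>M\<close> gives one null sequence in
  \<open>N\<close> that is valid at the nodes of every grid, as \<open>exterior_traces_sums\<close>
  asks of \<tau>.\<close>

definition tail_sup :: "(nat \<Rightarrow> real \<Rightarrow> complex) \<Rightarrow> nat \<Rightarrow> real" where
  "tail_sup e N = Sup {(\<Sum>i\<in>{N..<M}. (norm (l2_inner \<omega> (e i) (u_tail t)))\<^sup>2) | M t. t \<in> {0..\<omega>}}"

lemma tail_sup:
  assumes e: "orthonormal_basis \<omega> e"
  shows tail_sup_ge: "t \<in> {0..\<omega>} \<Longrightarrow> (\<Sum>i\<in>{N..<M}. (norm (l2_inner \<omega> (e i) (u_tail t)))\<^sup>2) \<le> tail_sup e N"
    and tail_sup_lim: "tail_sup e \<longlonglongrightarrow> 0"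
proof -
  let ?S = "\<lambda>N. {(\<Sum>i\<in>{N..<M}. (norm (l2_inner \<omega> (e i) (u_tail t)))\<^sup>2) | M t. t \<in> {0..\<omega>}}"
  have "bdd_above (?S N)" for N
  proof (rule bdd_aboveI[where M = "(l2_norm \<omega> u)\<^sup>2"])
    fix y assume "y \<in> ?S N"
    then obtain M t where y: "y = (\<Sum>i\<in>{N..<M}. (norm (l2_inner \<omega> (e i) (u_tail t)))\<^sup>2)" by blast
    have "y \<le> (l2_norm \<omega> (u_tail t))\<^sup>2" unfolding y by (rule bessel_inequality[OF e _ u_tail_L2]) simp
    also have "\<dots> \<le> (l2_norm \<omega> u)\<^sup>2" by (intro power_mono u_tail_norm l2_norm_nonneg)
    finally show "y \<le> (l2_norm \<omega> u)\<^sup>2" .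
  qed
  then show ge: "t \<in> {0..\<omega>} \<Longrightarrow> (\<Sum>i\<in>{N..<M}. (norm (l2_inner \<omega> (e i) (u_tail t)))\<^sup>2) \<le> tail_sup e N" for t N M
    unfolding tail_sup_def by (intro cSup_upper) auto
  have z: "(0::real) \<in> {0..\<omega>}" using omega by simp
  have ne: "?S N \<noteq> {}" for N using z by blast
  show "tail_sup e \<longlonglongrightarrow> 0"
  proof (rule LIMSEQ_I)
    fix \<epsilon> :: real assume \<epsilon>: "0 < \<epsilon>"
    obtain N0 where N0: "\<And>N M t. N \<ge> N0 \<Longrightarrow> t \<in> {0..\<omega>} \<Longrightarrow> (\<Sum>i\<in>{N..<M}. (norm (l2_inner \<omega> (e i) (u_tail t)))\<^sup>2) \<le> \<epsilon> / 2"
      using u_tail_uniform[OF e half_gt_zero[OF \<epsilon>]] by blast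
    have "norm (tail_sup e N - 0) < \<epsilon>" if "N \<ge> N0" for N
    proof -
      have "tail_sup e N \<le> \<epsilon> / 2"
        unfolding tail_sup_def by (rule cSup_least[OF ne]) (use N0 that in blast)
      moreover have "0 \<le> tail_sup e N" using ge[OF z, of N N] by simp
      ultimately show ?thesis using \<epsilon> by simp
    qed
    then show "\<exists>no. \<forall>n\<ge>no. norm (tail_sup e n - 0) < \<epsilon>" by blast
  qed
qed

section \<open>Factorisation of the grid operators\<close>

definition u_cell :: "(nat \<Rightarrow> real \<Rightarrow> complex) \<Rightarrow> nat \<Rightarrow> nat \<Rightarrow> nat \<Rightarrow> complex" where
  "u_cell d m i p = cell_mass \<omega> (\<lambda>x. cnj (d i x) * u x) m p"

definition v_cell :: "(nat \<Rightarrow> real \<Rightarrow> complex) \<Rightarrow> nat \<Rightarrow> nat \<Rightarrow> nat \<Rightarrow> complex" where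
  "v_cell e m q j = cell_mass \<omega> (\<lambda>x. v x * e j x) m q"

definition green_grid :: "nat \<Rightarrow> nat \<Rightarrow> nat \<Rightarrow> complex" where
  "green_grid m p q = green a b r (node \<omega> m p) (node \<omega> m q)"

text \<open>
  Abel summation over the rows of the grid kernel replaces its values by their increments, which the
  Lipschitz bound makes of order \<open>\<omega> / m\<close>. Splitting them evenly between the two factors
  keeps the Hilbert--Schmidt norms of both bounded uniformly in \<open>m\<close>.
\<close>
definition step_scale :: "nat \<Rightarrow> nat \<Rightarrow> real" where
  "step_scale m l = (if l = 0 then 1 else sqrt (\<omega> / m))"

definition green_step :: "nat \<Rightarrow> nat \<Rightarrow> nat \<Rightarrow> complex" where
  "green_step m l q = (if l = 0 then green_grid m 0 q else (green_grid m l q - green_grid m (l - 1) q) / of_real (step_scale m l))"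

text \<open>Carries the sign of \<open>K\<close>, so that the product with \<open>rfactor\<close>
  approximates \<open>K\<close> itself.\<close>

definition lfactor :: "(nat \<Rightarrow> real \<Rightarrow> complex) \<Rightarrow> nat \<Rightarrow> nat \<Rightarrow> nat \<Rightarrow> complex" where
  "lfactor d m i l = - of_real (step_scale m l) * l2_inner \<omega> (d i) (u_tail (node \<omega> m l))"

definition rfactor :: "(nat \<Rightarrow> real \<Rightarrow> complex) \<Rightarrow> nat \<Rightarrow> nat \<Rightarrow> nat \<Rightarrow> complex" where
  "rfactor e m l j = (\<Sum>q<m. green_step m l q * v_cell e m q j)"

lemma step_scale_pos: "0 < m \<Longrightarrow> 0 < step_scale m l" using omega by (simp add: step_scale_def)

text \<open>Row 0 is unscaled and contributes 1, the others contribute \<open>\<omega> / m\<close>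
  each: the source of the factor \<open>1 + \<omega>\<close> in both Hilbert--Schmidt
  bounds.\<close>

lemma sum_step_scale: "0 < m \<Longrightarrow> (\<Sum>l<m. (step_scale m l)\<^sup>2) \<le> 1 + \<omega>"
proof -
  assume m: "0 < m"
  have "(\<Sum>l<m. (step_scale m l)\<^sup>2) \<le> (\<Sum>l<m. (if l = 0 then 1 else 0) + \<omega> / m)"
    using omega m by (intro sum_mono) (auto simp: step_scale_def)
  also have "\<dots> = 1 + \<omega>" using m by (simp add: sum.distrib)
  finally show ?thesis .
qed

lemma sum_green_step: "0 < m \<Longrightarrow> (\<Sum>l\<le>p. of_real (step_scale m l) * green_step m l q) = green_grid m p q"
proof -
  assume m: "0 < m"
  have *: "of_real (step_scale m (Suc l)) * green_step m (Suc l) q = green_grid m (Suc l) q - green_grid m l q" for l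
    using step_scale_pos[OF m, of "Suc l"] by (simp add: green_step_def)
  show ?thesis
  proof (induction p)
    case 0
    show ?case by (simp add: step_scale_def green_step_def)
  next
    case (Suc p)
    then show ?case using *[of p] by simp
  qed
qed

text \<open>From one node to the next the kernel changes by at most
  \<open>green_const * (\<omega> / m)\<close>, that is \<open>green_const\<close> times the square
  of the scale; \<open>green_step\<close> divides out one power.\<close>

lemma norm_green_step:
  assumes m: "0 < m" and l: "l \<le> m" and q: "q \<le> m"
  shows "norm (green_step m l q) \<le> green_const * step_scale m l"
proof -
  have x: "node \<omega> m p \<in> {0..\<omega>}" if "p \<le> m" for p using node_in[of \<omega> p m] omega that by simp
  show ?thesis
  proof (cases l)
    case 0
    then show ?thesis using green_le[OF x[of 0] x[OF q]] by (simp add: green_step_def green_grid_def step_scale_def)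
  next
    case (Suc k)
    have "norm (green_grid m l q - green_grid m k q) \<le> green_const * \<bar>node \<omega> m l - node \<omega> m k\<bar>"
      unfolding green_grid_def by (rule green_lipschitz_left) (use x l q Suc in auto)
    also have "\<bar>node \<omega> m l - node \<omega> m k\<bar> = step_scale m l * step_scale m l"
      using omega by (simp add: Suc node_Suc step_scale_def)
    finally have "norm (green_grid m l q - green_grid m k q) / step_scale m l \<le> green_const * step_scale m l"
      using step_scale_pos[OF m, of l] by (simp add: pos_divide_le_eq mult.assoc)
    then show ?thesis using Suc step_scale_pos[OF m, of l] by (simp add: green_step_def norm_divide)
  qed
qed

lemma integrable_cnj_u:
  assumes "f \<in> L2 \<omega>"
  shows "integrable (Leb \<omega>) (\<lambda>x. cnj (f x) * u x)"
  by (rule L2_mult_integrable[OF L2_cnj[OF assms] uL2])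

lemma sum_u_cell_tail:
  assumes d: "d i \<in> L2 \<omega>" and m: "0 < m" and l: "l \<le> m"
  shows "(\<Sum>p\<in>{l..<m}. u_cell d m i p) = l2_inner \<omega> (d i) (u_tail (node \<omega> m l))"
  unfolding u_cell_def cell_mass_add_tail[OF omega integrable_cnj_u[of "d i"] m l, OF d] l2_inner_def
  by (intro Bochner_Integration.integral_cong) (auto simp: u_tail_def)

text \<open>Summation by parts: exchanging the sums over \<open>l \<le> p\<close> reassembles row
  \<open>p\<close> of the grid kernel from its scaled increments.\<close>

lemma lfactor_rfactor:
  assumes d: "d i \<in> L2 \<omega>" and m: "0 < m"
  shows "(\<Sum>l<m. lfactor d m i l * rfactor e m l j) = - (\<Sum>p<m. \<Sum>q<m. u_cell d m i p * green_grid m p q * v_cell e m q j)"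
proof -
  have "(\<Sum>l<m. lfactor d m i l * rfactor e m l j)
    = - (\<Sum>l<m. \<Sum>p\<in>{l..<m}. u_cell d m i p * (of_real (step_scale m l) * rfactor e m l j))"
    using m by (simp add: lfactor_def sum_u_cell_tail[where d = d and i = i, OF d m, symmetric] sum_negf[symmetric] sum_distrib_left sum_distrib_right mult_ac)
  also have "(\<Sum>l<m. \<Sum>p\<in>{l..<m}. u_cell d m i p * (of_real (step_scale m l) * rfactor e m l j))
    = (\<Sum>p<m. \<Sum>l\<le>p. u_cell d m i p * (of_real (step_scale m l) * rfactor e m l j))"
    by (rule sum_triangle_swap)
  also have "\<dots> = (\<Sum>p<m. \<Sum>q<m. u_cell d m i p * green_grid m p q * v_cell e m q j)"
  proof (rule sum.cong[OF refl])
    fix p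
    have "(\<Sum>l\<le>p. u_cell d m i p * (of_real (step_scale m l) * rfactor e m l j))
      = (\<Sum>q<m. u_cell d m i p * (\<Sum>l\<le>p. of_real (step_scale m l) * green_step m l q) * v_cell e m q j)"
      unfolding rfactor_def sum_distrib_left sum_distrib_right
      by (subst sum.swap) (simp add: mult_ac)
    then show "(\<Sum>l\<le>p. u_cell d m i p * (of_real (step_scale m l) * rfactor e m l j)) = (\<Sum>q<m. u_cell d m i p * green_grid m p q * v_cell e m q j)"
      by (simp only: sum_green_step[OF m])
  qed
  finally show ?thesis .
qed

lemma lfactor_tail:
  assumes d: "orthonormal_basis \<omega> d" and m: "0 < m"
  shows "(\<Sum>i\<in>{N..<M}. \<Sum>l<m. (norm (lfactor d m i l))\<^sup>2) \<le> (1 + \<omega>) * tail_sup d N"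
proof -
  have t0: "0 \<le> tail_sup d N" using tail_sup_ge[OF d, of 0 N N] omega by simp
  have "(\<Sum>i\<in>{N..<M}. \<Sum>l<m. (norm (lfactor d m i l))\<^sup>2)
    = (\<Sum>l<m. (step_scale m l)\<^sup>2 * (\<Sum>i\<in>{N..<M}. (norm (l2_inner \<omega> (d i) (u_tail (node \<omega> m l))))\<^sup>2))"
    by (subst sum.swap) (simp add: lfactor_def norm_mult power_mult_distrib sum_distrib_left)
  also have "\<dots> \<le> (\<Sum>l<m. (step_scale m l)\<^sup>2 * tail_sup d N)"
    using omega by (intro sum_mono mult_left_mono tail_sup_ge[OF d] node_in) auto
  also have "\<dots> \<le> (1 + \<omega>) * tail_sup d N"
    unfolding sum_distrib_right[symmetric] using sum_step_scale[OF m] t0 by (intro mult_right_mono)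
  finally show ?thesis .
qed

text \<open>For fixed \<open>l\<close>, \<open>rfactor\<close> lists the conjugate coefficients of
  \<open>v\<close> times a function that is constant on cells and at most
  \<open>green_const * step_scale m l\<close> in modulus. Bessel's inequality sums over
  \<open>j\<close>, \<open>sum_step_scale\<close> over \<open>l\<close>.\<close>

lemma rfactor_bound:
  assumes e: "orthonormal_basis \<omega> e" and m: "0 < m"
  shows "(\<Sum>j<M. \<Sum>l<m. (norm (rfactor e m l j))\<^sup>2) \<le> (green_const * l2_norm \<omega> v)\<^sup>2 * (1 + \<omega>)"
proof -
  have eL: "e j \<in> L2 \<omega>" for j using e by (auto simp: orthonormal_basis_def)
  define \<beta> where "\<beta> l x = (\<Sum>q<m. cnj (green_step m l q) * (indicat_real (cell \<omega> m q) x *\<^sub>R v x))" for l x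
  have cnjv: "cnj (v x) = v x" for x by (simp add: v_factor_def)
  have cv: "(\<lambda>x. indicat_real (cell \<omega> m q) x *\<^sub>R v x) \<in> L2 \<omega>" for q
  proof (rule L2_bound[OF _ vL2, where c = 1])
    show "(\<lambda>x. indicat_real (cell \<omega> m q) x *\<^sub>R v x) \<in> borel_measurable (Leb \<omega>)"
      by (intro borel_measurable_scaleR cell_measurable L2_borel[OF vL2])
  qed (auto simp: indicator_def)
  have \<beta>L: "\<beta> l \<in> L2 \<omega>" for l unfolding \<beta>_def[abs_def] by (intro L2_sum L2_scale cv)
  have rfactor: "rfactor e m l j = cnj (l2_inner \<omega> (e j) (\<beta> l))" for l j
  proof -
    have "l2_inner \<omega> (e j) (\<beta> l) = (\<Sum>q<m. cnj (green_step m l q) * l2_inner \<omega> (e j) (\<lambda>x. indicat_real (cell \<omega> m q) x *\<^sub>R v x))"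
      unfolding \<beta>_def[abs_def] by (rule l2_inner_sum_right[OF eL cv])
    moreover have "cnj (l2_inner \<omega> (e j) (\<lambda>x. indicat_real (cell \<omega> m q) x *\<^sub>R v x)) = v_cell e m q j" for q
    proof -
      have "cnj (l2_inner \<omega> (e j) (\<lambda>x. indicat_real (cell \<omega> m q) x *\<^sub>R v x)) = l2_inner \<omega> (\<lambda>x. indicat_real (cell \<omega> m q) x *\<^sub>R v x) (e j)"
        by (rule l2_inner_commute[symmetric])
      also have "\<dots> = v_cell e m q j"
        unfolding l2_inner_def v_cell_def cell_mass_def
        by (intro Bochner_Integration.integral_cong refl) (simp add: cnjv)
      finally show ?thesis .
    qed
    ultimately show ?thesis by (simp add: rfactor_def)
  qed
  have \<beta>n: "(l2_norm \<omega> (\<beta> l))\<^sup>2 \<le> (green_const * l2_norm \<omega> v)\<^sup>2 * (step_scale m l)\<^sup>2" if l: "l < m" for l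
  proof -
    have "l2_norm \<omega> (\<beta> l) \<le> l2_norm \<omega> (\<lambda>x. of_real (green_const * step_scale m l) * v x)"
    proof (rule l2_norm_mono[OF L2_borel[OF \<beta>L] L2_scale[OF vL2]], rule AE_I2)
      fix x assume "x \<in> space (Leb \<omega>)"
      then have x: "0 < x" by simp
      have "norm (\<beta> l x) \<le> (\<Sum>q<m. indicat_real (cell \<omega> m q) x * (green_const * step_scale m l * norm (v x)))"
        unfolding \<beta>_def
      proof (rule sum_norm_le)
        fix q assume "q \<in> {..<m}"
        then have "norm (green_step m l q) \<le> green_const * step_scale m l" using l by (intro norm_green_step m) auto
        then show "norm (cnj (green_step m l q) * (indicat_real (cell \<omega> m q) x *\<^sub>R v x)) \<le> indicat_real (cell \<omega> m q) x * (green_const * step_scale m l * norm (v x))"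
          by (auto simp: norm_mult indicator_def intro: mult_right_mono)
      qed
      also have "\<dots> = (\<Sum>q<m. indicat_real (cell \<omega> m q) x) * (green_const * step_scale m l * norm (v x))" by (simp only: sum_distrib_right)
      also have "\<dots> \<le> 1 * (green_const * step_scale m l * norm (v x))"
        unfolding sum_indicator_cell[OF omega x] using green_const_pos step_scale_pos[OF m, of l] by (intro mult_right_mono) auto
      also have "\<dots> = norm (of_real (green_const * step_scale m l) * v x)"
        using green_const_pos step_scale_pos[OF m, of l] by (simp add: norm_mult)
      finally show "norm (\<beta> l x) \<le> norm (of_real (green_const * step_scale m l) * v x)" .
    qed
    also have "\<dots> = green_const * step_scale m l * l2_norm \<omega> v"
      unfolding l2_norm_scale using green_const_pos step_scale_pos[OF m, of l] by (simp add: norm_mult)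
    finally have "(l2_norm \<omega> (\<beta> l))\<^sup>2 \<le> (green_const * step_scale m l * l2_norm \<omega> v)\<^sup>2" by (intro power_mono) auto
    then show ?thesis by (simp add: power_mult_distrib mult_ac)
  qed
  have "(\<Sum>j<M. \<Sum>l<m. (norm (rfactor e m l j))\<^sup>2) = (\<Sum>l<m. \<Sum>j<M. (norm (l2_inner \<omega> (e j) (\<beta> l)))\<^sup>2)"
    by (subst sum.swap) (simp add: rfactor)
  also have "\<dots> \<le> (\<Sum>l<m. (green_const * l2_norm \<omega> v)\<^sup>2 * (step_scale m l)\<^sup>2)"
    by (intro sum_mono order_trans[OF bessel_inequality[OF e _ \<beta>L] \<beta>n]) auto
  also have "\<dots> \<le> (green_const * l2_norm \<omega> v)\<^sup>2 * (1 + \<omega>)"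
    unfolding sum_distrib_left[symmetric] by (intro mult_left_mono sum_step_scale m) auto
  finally show ?thesis .
qed

text \<open>Freezing the kernel in its second variable approximates the Green's operator at rate
  \<open>\<omega> / m\<close>, uniformly over the nodes; \<open>integral_grid_converges\<close> then
  handles the outer integral against \<open>cnj (d i x) * u x\<close>.\<close>

lemma K_approx:
  assumes d: "d i \<in> L2 \<omega>" and e: "e j \<in> L2 \<omega>"
  shows "(\<lambda>m. - (\<Sum>p<m. \<Sum>q<m. u_cell d m i p * green_grid m p q * v_cell e m q j)) \<longlonglongrightarrow> l2_inner \<omega> (d i) (K (e j))"
proof -
  define w where "w x = cnj (d i x) * u x" for x
  define q where "q t = v t * e j t" for t
  have w: "integrable (Leb \<omega>) w" unfolding w_def by (rule integrable_cnj_u[OF d])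
  have qi: "integrable (Leb \<omega>) q" unfolding q_def by (rule vf_integrable[OF e])
  define s where "s = (LINT t|Leb \<omega>. norm (q t))"
  have s0: "0 \<le> s" by (simp add: s_def)
  define gm where "gm m p = (\<Sum>q'<m. green_grid m p q' * cell_mass \<omega> q m q')" for m p
  have le: "norm (G q (node \<omega> m p) - gm m p) \<le> green_const * (\<omega> / m) * s" if m: "0 < m" and p: "p \<le> m" for m p
  proof -
    have xp: "node \<omega> m k \<in> {0..\<omega>}" if "k \<le> m" for k using node_in[of \<omega> k m] omega that by simp
    have "norm ((LINT t|Leb \<omega>. (if t < node \<omega> m m then green a b r (node \<omega> m p) t * q t else 0))
      - (\<Sum>q'<m. green_grid m p q' * cell_mass \<omega> q m q')) \<le> green_const * (\<omega> / m) * s"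
      unfolding s_def
    proof (rule integral_cells_approx[OF omega qi integral_green(1)[OF qi r0]])
      fix q' t assume q': "q' < m" "t \<in> cell \<omega> m q'" "t \<in> {0<..<\<omega>}"
      have "norm (green a b r (node \<omega> m p) t - green_grid m p q') \<le> green_const * \<bar>t - node \<omega> m q'\<bar>"
        unfolding green_grid_def by (rule green_lipschitz_right) (use xp p q' in auto)
      also have "\<dots> \<le> green_const * (\<omega> / m)"
        using green_const_pos cell_imp(1)[OF omega m q'(2)] by (intro mult_left_mono) auto
      finally show "norm (green a b r (node \<omega> m p) t - green_grid m p q') \<le> green_const * (\<omega> / m)" .
    qed (use green_const_pos omega in auto)
    moreover have "(LINT t|Leb \<omega>. (if t < node \<omega> m m then green a b r (node \<omega> m p) t * q t else 0)) = G q (node \<omega> m p)"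
      unfolding green_operator_def by (intro Bochner_Integration.integral_cong) (auto simp: node_last[OF m])
    ultimately show ?thesis by (simp add: gm_def)
  qed
  have conv: "\<exists>m0. \<forall>m\<ge>m0. \<forall>p\<le>m. norm (G q (node \<omega> m p) - gm m p) \<le> \<epsilon>" if \<epsilon>: "0 < \<epsilon>" for \<epsilon>
  proof -
    have "0 < \<epsilon> / (green_const * (s + 1))" using \<epsilon> green_const_pos s0 by simp
    then obtain m0 where m0: "0 < m0" "\<And>m. m \<ge> m0 \<Longrightarrow> \<omega> / real m < \<epsilon> / (green_const * (s + 1))"
      using eventually_mesh_less by blast
    have "norm (G q (node \<omega> m p) - gm m p) \<le> \<epsilon>" if m: "m \<ge> m0" and p: "p \<le> m" for m p
    proof -
      have m': "0 < m" using m m0 by simp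
      have "norm (G q (node \<omega> m p) - gm m p) \<le> green_const * (\<omega> / m) * s" by (rule le[OF m' p])
      also have "\<dots> \<le> green_const * (\<epsilon> / (green_const * (s + 1))) * (s + 1)"
        using m0(2)[OF m] green_const_pos s0 omega \<epsilon> by (intro mult_mono mult_left_mono) auto
      also have "\<dots> = \<epsilon>"
      proof -
        have "s + 1 \<noteq> 0" using s0 by simp
        then show ?thesis using green_const_pos by simp
      qed
      finally show ?thesis .
    qed
    then show ?thesis by blast
  qed
  have cG: "continuous_on {0..\<omega>} (G q)" by (rule continuous_on_green_operator[OF qi r0])
  have iGw: "integrable (Leb \<omega>) (\<lambda>t. 1 * G q t * w t)"
    using integrable_continuous_mult[OF cG w] by simp
  have "(\<lambda>m. \<Sum>p<m. 1 * cell_mass \<omega> w m p * gm m p) \<longlonglongrightarrow> (LINT t|Leb \<omega>. 1 * G q t * w t)"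
    by (rule integral_grid_converges[OF omega w cG _ iGw conv]) (auto intro: continuous_intros)
  then have "(\<lambda>m. - (\<Sum>p<m. 1 * cell_mass \<omega> w m p * gm m p)) \<longlonglongrightarrow> - (LINT t|Leb \<omega>. 1 * G q t * w t)"
    by (rule tendsto_minus)
  moreover have "(\<Sum>p<m. 1 * cell_mass \<omega> w m p * gm m p) = (\<Sum>p<m. \<Sum>q'<m. u_cell d m i p * green_grid m p q' * v_cell e m q' j)" for m
    unfolding gm_def u_cell_def v_cell_def w_def[symmetric] q_def[symmetric] by (simp add: sum_distrib_left mult.assoc)
  moreover have "- (LINT t|Leb \<omega>. 1 * G q t * w t) = l2_inner \<omega> (d i) (K (e j))"
    unfolding l2_inner_def K_def q_def[symmetric] Bochner_Integration.integral_minus[symmetric]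
    by (intro Bochner_Integration.integral_cong refl) (simp add: w_def)
  ultimately show ?thesis by simp
qed

section \<open>Limit of the grid determinants\<close>

definition wave :: "nat \<Rightarrow> real \<Rightarrow> complex" where
  "wave l x = (if l = 0 then exp (\<i> * r * of_real x) else exp (- \<i> * r * of_real x))"

text \<open>The rank two part of the Green's function. The indices 0 and 1 stand for plus and minus:
  \<open>wave l\<close> is the free term of the forward equation with that sign, and
  \<open>cowave l\<close> is the matching factor in \<open>t\<close>, with the coefficient that
  encodes the boundary condition.\<close>

definition cowave :: "nat \<Rightarrow> real \<Rightarrow> complex" where
  "cowave l t = (if l = 0 then \<i> / (2 * r) * (1 / (a - 1)) * exp (- \<i> * r * of_real t)
    else \<i> / (2 * r) * (b / (b - 1)) * exp (\<i> * r * of_real t))"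

lemma green_wave: "green a b r x t = (\<Sum>l<2. wave l x * cowave l t) - (if t < x then free_kernel r x t else 0)"
proof -
  have "exp (\<i> * r * of_real (x - t)) = exp (\<i> * r * of_real x) * exp (- \<i> * r * of_real t)"
    "exp (- \<i> * r * of_real (x - t)) = exp (- \<i> * r * of_real x) * exp (\<i> * r * of_real t)"
    by (simp_all add: exp_add[symmetric] algebra_simps)
  then show ?thesis
    unfolding green_def by (simp add: wave_def cowave_def numeral_2_eq_2 algebra_simps)
qed

text \<open>Sylvester's identity turns a determinant over \<open>N\<close> basis elements into one
  over the \<open>m\<close> cells, whose entries are built from partial Parseval sums. These tend to
  inner products of \<open>v\<close> and \<open>u\<close> restricted to cells: zero for different
  cells, the cell mass of \<open>u x * v x = V x\<close> for equal ones.\<close>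

lemma grid_det_limit:
  assumes e: "orthonormal_basis \<omega> e" and m: "0 < m"
  shows "(\<lambda>N. minor_det (\<lambda>i j. (if i = j then 1 else 0) - (\<Sum>l<m. lfactor e m i l * rfactor e m l j)) {..<N})
    \<longlonglongrightarrow> minor_det (\<lambda>p q. (if p = q then 1 else 0) + green_grid m p q * cell_mass \<omega> V m q) {..<m}"
proof -
  have eL: "e i \<in> L2 \<omega>" for i using e by (auto simp: orthonormal_basis_def)
  define c where "c p j = - (\<Sum>q<m. green_grid m p q * v_cell e m q j)" for p j
  have 1: "(\<Sum>l<m. lfactor e m i l * rfactor e m l j) = (\<Sum>p<m. u_cell e m i p * c p j)" for i j
    unfolding lfactor_rfactor[where d = e and i = i, OF eL m] c_def
    by (simp add: sum_negf sum_distrib_left mult.assoc)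
  have 2: "minor_det (\<lambda>i j. (if i = j then 1 else 0) - (\<Sum>l<m. lfactor e m i l * rfactor e m l j)) {..<N}
    = minor_det (\<lambda>p p'. (if p = p' then 1 else 0) - (\<Sum>i<N. c p i * u_cell e m i p')) {..<m}" for N
    unfolding 1 by (rule minor_det_sylvester)
  define uc where "uc p x = indicat_real (cell \<omega> m p) x *\<^sub>R u x" for p x
  define vc where "vc p x = indicat_real (cell \<omega> m p) x *\<^sub>R v x" for p x
  have cnjv: "cnj (v x) = v x" for x by (simp add: v_factor_def)
  have cL: "(\<lambda>x. indicat_real (cell \<omega> m q) x *\<^sub>R f x) \<in> L2 \<omega>" if "f \<in> L2 \<omega>" for q f
  proof (rule L2_bound[OF _ that, where c = 1])
    show "(\<lambda>x. indicat_real (cell \<omega> m q) x *\<^sub>R f x) \<in> borel_measurable (Leb \<omega>)"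
      by (intro borel_measurable_scaleR cell_measurable L2_borel[OF that])
  qed (auto simp: indicator_def)
  have ucL: "uc p \<in> L2 \<omega>" and vcL: "vc p \<in> L2 \<omega>" for p
    unfolding uc_def[abs_def] vc_def[abs_def] by (intro cL uL2 vL2)+
  have u_cell: "u_cell e m i p = l2_inner \<omega> (e i) (uc p)" for i p
    unfolding u_cell_def cell_mass_def l2_inner_def uc_def
    by (intro Bochner_Integration.integral_cong refl) simp
  have v_cell: "v_cell e m q i = l2_inner \<omega> (vc q) (e i)" for q i
    unfolding v_cell_def cell_mass_def l2_inner_def vc_def
    by (intro Bochner_Integration.integral_cong refl) (simp add: cnjv)
  have vu: "l2_inner \<omega> (vc q) (uc p) = (if q = p then cell_mass \<omega> V m p else 0)" for p q
  proof -
    have dis: "x \<notin> cell \<omega> m p" if "x \<in> cell \<omega> m q" "q \<noteq> p" for x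
    proof -
      have "node \<omega> m (Suc (min p q)) \<le> node \<omega> m (max p q)"
        using that omega by (intro node_mono) auto
      then show ?thesis using that(1) that(2) by (cases "p < q") (auto simp: cell_node)
    qed
    have "cnj (vc q x) * uc p x = (if q = p then indicat_real (cell \<omega> m p) x *\<^sub>R V x else 0)" for x
    proof (cases "q = p")
      case True
      have "v x * u x = V x" using u_times_v_factor[of V x] by (simp only: mult.commute)
      then show ?thesis using True by (cases "x \<in> cell \<omega> m p") (simp_all add: vc_def uc_def cnjv)
    next
      case False
      then show ?thesis using dis[of x] by (cases "x \<in> cell \<omega> m q") (simp_all add: vc_def uc_def)
    qed
    then show ?thesis by (simp add: l2_inner_def cell_mass_def)
  qed
  show ?thesis
    unfolding 2
  proof (rule tendsto_minor_det)
    fix p p' assume p': "p' \<in> {..<m}"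
    have "(\<Sum>i<N. c p i * u_cell e m i p') = - (\<Sum>q<m. green_grid m p q * (\<Sum>i<N. l2_inner \<omega> (vc q) (e i) * l2_inner \<omega> (e i) (uc p')))" for N
      unfolding c_def u_cell v_cell sum_distrib_left sum_distrib_right sum_negf[symmetric]
      by (subst sum.swap) (simp add: sum_distrib_right sum_negf mult.assoc)
    moreover have "(\<lambda>N. - (\<Sum>q<m. green_grid m p q * (\<Sum>i<N. l2_inner \<omega> (vc q) (e i) * l2_inner \<omega> (e i) (uc p'))))
      \<longlonglongrightarrow> - (\<Sum>q<m. green_grid m p q * l2_inner \<omega> (vc q) (uc p'))"
      by (intro tendsto_intros parseval_identity[OF e ucL vcL])
    moreover have "(\<Sum>q<m. green_grid m p q * l2_inner \<omega> (vc q) (uc p')) = green_grid m p p' * cell_mass \<omega> V m p'"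
      using p' by (simp add: vu if_distrib[of "\<lambda>x. _ * x"] cong: if_cong)
    ultimately have "(\<lambda>N. \<Sum>i<N. c p i * u_cell e m i p') \<longlonglongrightarrow> - (green_grid m p p' * cell_mass \<omega> V m p')" by simp
    from tendsto_diff[OF tendsto_const[of "if p = p' then 1 else 0"] this]
    show "(\<lambda>N. (if p = p' then 1 else 0) - (\<Sum>i<N. c p i * u_cell e m i p')) \<longlonglongrightarrow> (if p = p' then 1 else 0) + green_grid m p p' * cell_mass \<omega> V m p'"
      by simp
  qed
qed

lemma continuous_free_kernel: "continuous_on A (\<lambda>(x, t). free_kernel r x t)"
  unfolding free_kernel_def case_prod_unfold using r0 by (intro continuous_intros) auto

lemma free_kernel_integrable:
  assumes "integrable (Leb \<omega>) q"
  shows "integrable (Leb \<omega>) (\<lambda>t. free_kernel r x t * q t)"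
  unfolding free_kernel_def using r0 by (intro integrable_continuous_mult assms continuous_intros) auto

lemma det_grid_converges:
  fixes \<phi> :: "nat \<Rightarrow> real \<Rightarrow> complex"
  assumes \<phi>c: "\<And>l. continuous_on {0..\<omega>} (\<phi> l)" and V\<phi>: "\<And>l. integrable (Leb \<omega>) (\<lambda>t. V t * \<phi> l t)"
    and \<phi>: "\<And>l x. x \<in> {0..\<omega>} \<Longrightarrow> \<phi> l x = wave l x + (LINT t|Leb \<omega>. (if t < x then free_kernel r x t * V t * \<phi> l t else 0))"
  defines "I \<equiv> \<lambda>l l'. LINT t|Leb \<omega>. cowave l t * \<phi> l' t * V t"
  shows "(\<lambda>m. minor_det (\<lambda>p q. (if p = q then 1 else 0) + green_grid m p q * cell_mass \<omega> V m q) {..<m})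
    \<longlonglongrightarrow> (1 + I 0 0) * (1 + I 1 1) - I 0 1 * I 1 0"
proof -
  define \<Phi> where "\<Phi> m l = volterra_grid (\<lambda>p. wave l (node \<omega> m p))
    (\<lambda>p q. free_kernel r (node \<omega> m p) (node \<omega> m q) * cell_mass \<omega> V m q)" for m l
  have fk: "integrable (Leb \<omega>) (\<lambda>t. free_kernel r x t * V t * \<phi> l t)" for x l
    using free_kernel_integrable[OF V\<phi>[of l]] by (simp add: mult.assoc)
  have conv: "\<exists>m0. \<forall>m\<ge>m0. \<forall>p\<le>m. norm (\<phi> l (node \<omega> m p) - \<Phi> m l p) \<le> \<epsilon>" if "0 < \<epsilon>" for \<epsilon> l
    using volterra_grid_converges[OF omega V continuous_free_kernel \<phi>c fk \<phi> that, of l] unfolding \<Phi>_def by blast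
  have cw: "continuous_on A (cowave l)" for A l unfolding cowave_def[abs_def] using r0 a1 b1 by (cases "l = 0") (auto intro!: continuous_intros)
  have iI: "integrable (Leb \<omega>) (\<lambda>t. cowave l t * \<phi> l' t * V t)" for l l'
    using integrable_continuous_mult[OF cw V\<phi>[of l']] by (simp add: mult_ac)
  have lim: "(\<lambda>m. \<Sum>p<m. cowave l (node \<omega> m p) * cell_mass \<omega> V m p * \<Phi> m l' p) \<longlonglongrightarrow> I l l'" for l l'
    unfolding I_def by (rule integral_grid_converges[OF omega V \<phi>c cw iI conv])
  have det: "minor_det (\<lambda>p q. (if p = q then 1 else 0) + green_grid m p q * cell_mass \<omega> V m q) {..<m}
    = minor_det (\<lambda>l l'. (if l = l' then 1 else 0) + (\<Sum>p<m. cowave l (node \<omega> m p) * cell_mass \<omega> V m p * \<Phi> m l' p)) {..<2}"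
    if m: "0 < m" for m
  proof -
    let ?x = "node \<omega> m" and ?W = "cell_mass \<omega> V m"
    \<comment> \<open>The cut-off in the Green's function is strict, so this matrix vanishes on the
      diagonal as well, as unit triangularity demands.\<close>
    define t where "t p q = (if q < p then free_kernel r (?x p) (?x q) * ?W q else 0)" for p q
    have less: "?x q < ?x p \<longleftrightarrow> q < p" for p q
      using omega m by (auto simp: node_def divide_less_cancel)
    have "minor_det (\<lambda>p q. (if p = q then 1 else 0) + green_grid m p q * ?W q) {..<m}
      = minor_det (\<lambda>p q. (if p = q then 1 else 0) - t p q + (\<Sum>l<2. wave l (?x p) * (cowave l (?x q) * ?W q))) {..<m}"
      by (intro minor_det_cong) (simp add: green_grid_def green_wave less t_def left_diff_distrib sum_distrib_right mult.assoc)
    also have "\<dots> = minor_det (\<lambda>l l'. (if l = l' then 1 else 0) + (\<Sum>p<m. cowave l (?x p) * ?W p * \<Phi> m l' p)) {..<2}"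
    proof (rule minor_det_triangular_plus_finite_rank[where \<phi> = "\<lambda>p l. \<Phi> m l p"])
      show "t p q = 0" if "p \<le> q" for p q using that by (simp add: t_def)
      fix p l assume p: "p < m"
      have "(\<Sum>q<m. t p q * \<Phi> m l q) = (\<Sum>q<p. free_kernel r (?x p) (?x q) * ?W q * \<Phi> m l q)"
      proof -
        have "(\<Sum>q<m. t p q * \<Phi> m l q) = (\<Sum>q<p. t p q * \<Phi> m l q)"
          using p by (intro sum.mono_neutral_right) (auto simp: t_def)
        also have "\<dots> = (\<Sum>q<p. free_kernel r (?x p) (?x q) * ?W q * \<Phi> m l q)"
          by (intro sum.cong) (auto simp: t_def)
        finally show ?thesis .
      qed
      then show "\<Phi> m l p = wave l (?x p) + (\<Sum>q<m. t p q * \<Phi> m l q)"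
        unfolding \<Phi>_def by (subst volterra_grid.simps) simp
    qed
    finally show ?thesis .
  qed
  have "(\<lambda>m. minor_det (\<lambda>l l'. (if l = l' then 1 else 0) + (\<Sum>p<m. cowave l (node \<omega> m p) * cell_mass \<omega> V m p * \<Phi> m l' p)) {..<2})
    \<longlonglongrightarrow> minor_det (\<lambda>l l'. (if l = l' then 1 else 0) + I l l') {..<2}"
    by (intro tendsto_minor_det tendsto_intros lim)
  moreover have "minor_det (\<lambda>l l'. (if l = l' then 1 else 0) + I l l') {..<2} = (1 + I 0 0) * (1 + I 1 1) - I 0 1 * I 1 0"
    unfolding minor_det_2 by simp
  ultimately have L: "(\<lambda>m. minor_det (\<lambda>l l'. (if l = l' then 1 else 0) + (\<Sum>p<m. cowave l (node \<omega> m p) * cell_mass \<omega> V m p * \<Phi> m l' p)) {..<2})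
    \<longlonglongrightarrow> (1 + I 0 0) * (1 + I 1 1) - I 0 1 * I 1 0" by (simp only:)
  show ?thesis
    by (rule Lim_transform_eventually[OF L], rule eventually_sequentiallyI[of 1]) (simp add: det)
qed

theorem has_fredholm_det_K:
  fixes \<phi> :: "nat \<Rightarrow> real \<Rightarrow> complex"
  assumes \<phi>c: "\<And>l. continuous_on {0..\<omega>} (\<phi> l)" and V\<phi>: "\<And>l. integrable (Leb \<omega>) (\<lambda>t. V t * \<phi> l t)"
    and \<phi>: "\<And>l x. x \<in> {0..\<omega>} \<Longrightarrow> \<phi> l x = wave l x + (LINT t|Leb \<omega>. (if t < x then free_kernel r x t * V t * \<phi> l t else 0))"
  defines "I \<equiv> \<lambda>l l'. LINT t|Leb \<omega>. cowave l t * \<phi> l' t * V t"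
  shows "has_fredholm_det \<omega> (K_op \<omega> \<theta> V (r\<^sup>2)) ((1 + I 0 0) * (1 + I 1 1) - I 0 1 * I 1 0)"
  unfolding has_fredholm_det_def trace_class_def
proof (intro conjI allI impI bounded_K_op)
  fix d e assume d: "orthonormal_basis \<omega> d" and e: "orthonormal_basis \<omega> e"
  have dL: "d i \<in> L2 \<omega>" and eL: "e i \<in> L2 \<omega>" for i using d e by (auto simp: orthonormal_basis_def)
  have "summable (\<lambda>n. norm (l2_inner \<omega> (d n) (K (e n))))"
  \<comment> \<open>Grids are indexed by \<open>Suc m\<close>, since the estimates are for grids
    with at least one cell.\<close>
  proof (rule summable_factored_entries[where L = Suc and a = "\<lambda>m. lfactor d (Suc m)" and b = "\<lambda>m. rfactor e (Suc m)"])
    fix i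
    show "(\<lambda>m. \<Sum>l<Suc m. lfactor d (Suc m) i l * rfactor e (Suc m) l i) \<longlonglongrightarrow> l2_inner \<omega> (d i) (K (e i))"
      unfolding lfactor_rfactor[where d = d and i = i, OF dL zero_less_Suc]
      using K_approx[where d = d and e = e, OF dL eL] by (rule LIMSEQ_Suc)
  next
    fix m M
    show "(\<Sum>i<M. \<Sum>l<Suc m. (norm (lfactor d (Suc m) i l))\<^sup>2) \<le> (1 + \<omega>) * tail_sup d 0"
      using lfactor_tail[OF d, where m = "Suc m" and N = 0 and M = M] by (simp add: atLeast0LessThan)
    show "(\<Sum>i<M. \<Sum>l<Suc m. (norm (rfactor e (Suc m) l i))\<^sup>2) \<le> (green_const * l2_norm \<omega> v)\<^sup>2 * (1 + \<omega>)"
      by (rule rfactor_bound[OF e]) simp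
  qed
  then show "summable (\<lambda>n. norm (l2_inner \<omega> (d n) (op_app (K_op \<omega> \<theta> V (r\<^sup>2)) (e n))))"
    by (simp add: inner_op_app_K dL eL)
next
  fix e assume e: "orthonormal_basis \<omega> e"
  have eL: "e i \<in> L2 \<omega>" for i using e by (auto simp: orthonormal_basis_def)
  have "(\<lambda>n. (-1) ^ n * (\<Sum>\<^sub>\<infinity>S\<in>{S. finite S \<and> card S = n}. minor_det (\<lambda>i j. l2_inner \<omega> (e i) (K (e j))) S))
    sums ((1 + I 0 0) * (1 + I 1 1) - I 0 1 * I 1 0)"
  proof (rule exterior_traces_sums[where L = Suc and a = "\<lambda>m. lfactor e (Suc m)" and b = "\<lambda>m. rfactor e (Suc m)"])
    fix i j
    show "(\<lambda>m. \<Sum>l<Suc m. lfactor e (Suc m) i l * rfactor e (Suc m) l j) \<longlonglongrightarrow> l2_inner \<omega> (e i) (K (e j))"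
      unfolding lfactor_rfactor[where d = e and i = i, OF eL zero_less_Suc]
      using K_approx[where d = e and e = e, OF eL eL] by (rule LIMSEQ_Suc)
  next
    fix m N M
    show "(\<Sum>i\<in>{N..<M}. \<Sum>l<Suc m. (norm (lfactor e (Suc m) i l))\<^sup>2) \<le> (1 + \<omega>) * tail_sup e N"
      by (rule lfactor_tail[OF e]) simp
    show "(\<Sum>j<M. \<Sum>l<Suc m. (norm (rfactor e (Suc m) l j))\<^sup>2) \<le> (green_const * l2_norm \<omega> v)\<^sup>2 * (1 + \<omega>)"
      by (rule rfactor_bound[OF e]) simp
    show "(\<lambda>N. minor_det (\<lambda>i j. (if i = j then 1 else 0) - (\<Sum>l<Suc m. lfactor e (Suc m) i l * rfactor e (Suc m) l j)) {..<N})
      \<longlonglongrightarrow> minor_det (\<lambda>p q. (if p = q then 1 else 0) + green_grid (Suc m) p q * cell_mass \<omega> V (Suc m) q) {..<Suc m}"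
      by (rule grid_det_limit[OF e]) simp
  next
    show "(\<lambda>N. (1 + \<omega>) * tail_sup e N) \<longlonglongrightarrow> 0"
      using tendsto_mult_right_zero[OF tail_sup_lim[OF e]] by simp
    show "(\<lambda>m. minor_det (\<lambda>p q. (if p = q then 1 else 0) + green_grid (Suc m) p q * cell_mass \<omega> V (Suc m) q) {..<Suc m})
      \<longlonglongrightarrow> (1 + I 0 0) * (1 + I 1 1) - I 0 1 * I 1 0"
      using det_grid_converges[OF \<phi>c V\<phi> \<phi>] unfolding I_def by (rule LIMSEQ_Suc)
  qed
  then show "(\<lambda>n. (-1) ^ n * exterior_power_trace \<omega> e (K_op \<omega> \<theta> V (r\<^sup>2)) n) sums ((1 + I 0 0) * (1 + I 1 1) - I 0 1 * I 1 0)"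
    unfolding exterior_power_trace_def by (simp add: inner_op_app_K eL)
qed

end

section \<open>Moments of solutions\<close>

text \<open>A common form for solutions of the differential, the forward and the backward equation:
  \<alpha> and \<beta> are the values of \<open>y' + \<i> * r * y\<close> and
  \<open>y' - \<i> * r * y\<close> at 0.\<close>

definition volterra_solution :: "real \<Rightarrow> (real \<Rightarrow> complex) \<Rightarrow> complex \<Rightarrow> complex \<Rightarrow> complex \<Rightarrow> (real \<Rightarrow> complex) \<Rightarrow> bool" where
  "volterra_solution \<omega> V r \<alpha> \<beta> y \<longleftrightarrow> continuous_on {0..\<omega>} y \<and> integrable (Leb \<omega>) (\<lambda>t. V t * y t) \<and>
    (\<forall>x\<in>{0..\<omega>}. y x = (\<alpha> * exp (\<i> * r * of_real x) - \<beta> * exp (- \<i> * r * of_real x)) / (2 * \<i> * r)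
      + (LINT t|Leb \<omega>. (if t < x then free_kernel r x t * V t * y t else 0)))"

lemma continuous_on_integral_free_kernel:
  assumes q: "integrable (Leb \<omega>) q" and r: "r \<noteq> 0"
  shows "continuous_on A (\<lambda>x. LINT t|Leb \<omega>. (if t < x then free_kernel r x t * q t else 0))"
  unfolding integral_free_kernel[OF q r] using r
  by (intro continuous_intros continuous_on_exp_moment q) auto

lemma volterra_solutionI:
  assumes Vy: "integrable (Leb \<omega>) (\<lambda>t. V t * y t)" and r: "r \<noteq> 0"
    and eq: "\<And>x. x \<in> {0..\<omega>} \<Longrightarrow> y x = (\<alpha> * exp (\<i> * r * of_real x) - \<beta> * exp (- \<i> * r * of_real x)) / (2 * \<i> * r)
      + (LINT t|Leb \<omega>. (if t < x then free_kernel r x t * V t * y t else 0))"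
  shows "volterra_solution \<omega> V r \<alpha> \<beta> y"
  unfolding volterra_solution_def
proof (intro conjI ballI eq Vy)
  have "continuous_on {0..\<omega>} (\<lambda>x. (\<alpha> * exp (\<i> * r * of_real x) - \<beta> * exp (- \<i> * r * of_real x)) / (2 * \<i> * r)
      + (LINT t|Leb \<omega>. (if t < x then free_kernel r x t * (V t * y t) else 0)))"
    using r by (intro continuous_intros continuous_on_integral_free_kernel Vy) auto
  then show "continuous_on {0..\<omega>} y"
    by (rule continuous_on_cong[THEN iffD1, OF refl, rotated]) (simp add: eq mult.assoc cong: if_cong)
qed

lemma volterra_solution_linear:
  assumes r: "r \<noteq> 0" and 1: "volterra_solution \<omega> V r \<alpha>1 \<beta>1 y1" and 2: "volterra_solution \<omega> V r \<alpha>2 \<beta>2 y2"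
  shows "volterra_solution \<omega> V r (A * \<alpha>1 + B * \<alpha>2) (A * \<beta>1 + B * \<beta>2) (\<lambda>x. A * y1 x + B * y2 x)"
proof (rule volterra_solutionI[OF _ r])
  have i1: "integrable (Leb \<omega>) (\<lambda>t. V t * y1 t)" and i2: "integrable (Leb \<omega>) (\<lambda>t. V t * y2 t)"
    using 1 2 by (auto simp: volterra_solution_def)
  have "integrable (Leb \<omega>) (\<lambda>t. A * (V t * y1 t) + B * (V t * y2 t))"
    by (intro Bochner_Integration.integrable_add integrable_mult_right i1 i2)
  then show "integrable (Leb \<omega>) (\<lambda>t. V t * (A * y1 t + B * y2 t))" by (simp add: algebra_simps)
  fix x assume x: "x \<in> {0..\<omega>}"
  have j: "integrable (Leb \<omega>) (\<lambda>t. if t < x then free_kernel r x t * V t * y t else 0)"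
    if "integrable (Leb \<omega>) (\<lambda>t. V t * y t)" for y
    unfolding mult.assoc using r
    by (intro integrable_lessThan) (auto simp: free_kernel_def intro!: integrable_continuous_mult that continuous_intros)
  have "(LINT t|Leb \<omega>. (if t < x then free_kernel r x t * V t * (A * y1 t + B * y2 t) else 0))
    = (LINT t|Leb \<omega>. A * (if t < x then free_kernel r x t * V t * y1 t else 0) + B * (if t < x then free_kernel r x t * V t * y2 t else 0))"
    by (intro Bochner_Integration.integral_cong refl) (auto simp: algebra_simps)
  also have "\<dots> = A * (LINT t|Leb \<omega>. (if t < x then free_kernel r x t * V t * y1 t else 0)) + B * (LINT t|Leb \<omega>. (if t < x then free_kernel r x t * V t * y2 t else 0))"
    by (subst Bochner_Integration.integral_add) (auto intro!: integrable_mult_right j i1 i2 simp del: integrable_mult_right_iff)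
  finally have *: "(LINT t|Leb \<omega>. (if t < x then free_kernel r x t * V t * (A * y1 t + B * y2 t) else 0))
    = A * (LINT t|Leb \<omega>. (if t < x then free_kernel r x t * V t * y1 t else 0)) + B * (LINT t|Leb \<omega>. (if t < x then free_kernel r x t * V t * y2 t else 0))" .
  have e1: "y1 x = (\<alpha>1 * exp (\<i> * r * of_real x) - \<beta>1 * exp (- \<i> * r * of_real x)) / (2 * \<i> * r)
      + (LINT t|Leb \<omega>. (if t < x then free_kernel r x t * V t * y1 t else 0))"
    using 1 x by (simp add: volterra_solution_def)
  have e2: "y2 x = (\<alpha>2 * exp (\<i> * r * of_real x) - \<beta>2 * exp (- \<i> * r * of_real x)) / (2 * \<i> * r)
      + (LINT t|Leb \<omega>. (if t < x then free_kernel r x t * V t * y2 t else 0))"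
    using 2 x by (simp add: volterra_solution_def)
  have alg: "A * ((\<alpha>1 * p - \<beta>1 * q) / w + i1) + B * ((\<alpha>2 * p - \<beta>2 * q) / w + i2)
    = ((A * \<alpha>1 + B * \<alpha>2) * p - (A * \<beta>1 + B * \<beta>2) * q) / w + (A * i1 + B * i2)" for p q w i1 i2 :: complex
    by (simp add: algebra_simps add_divide_distrib diff_divide_distrib)
  show "A * y1 x + B * y2 x = ((A * \<alpha>1 + B * \<alpha>2) * exp (\<i> * r * of_real x) - (A * \<beta>1 + B * \<beta>2) * exp (- \<i> * r * of_real x)) / (2 * \<i> * r)
      + (LINT t|Leb \<omega>. (if t < x then free_kernel r x t * V t * (A * y1 t + B * y2 t) else 0))"
    unfolding * by (subst e1, subst e2) (rule alg)
qed

lemma volterra_solution_unique: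
  assumes \<omega>: "0 < \<omega>" and V: "integrable (Leb \<omega>) V" and r: "r \<noteq> 0"
    and 1: "volterra_solution \<omega> V r \<alpha> \<beta> y1" and 2: "volterra_solution \<omega> V r \<alpha> \<beta> y2" and x: "x \<in> {0..\<omega>}"
  shows "y1 x = y2 x"
proof -
  have k: "continuous_on ({0..\<omega>} \<times> {0..\<omega>}) (\<lambda>(x, t). free_kernel r x t)"
    unfolding free_kernel_def case_prod_unfold using r by (intro continuous_intros) auto
  have j: "integrable (Leb \<omega>) (\<lambda>t. free_kernel r x t * V t * y t)"
    if "integrable (Leb \<omega>) (\<lambda>t. V t * y t)" for x y
    unfolding mult.assoc using r
    by (auto simp: free_kernel_def intro!: integrable_continuous_mult that continuous_intros)
  show ?thesis
    by (rule volterra_unique[OF \<omega> V k, where P = "\<lambda>x. (\<alpha> * exp (\<i> * r * of_real x) - \<beta> * exp (- \<i> * r * of_real x)) / (2 * \<i> * r)", OF _ _ j j _ _ x])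
      (use 1 2 in \<open>auto simp: volterra_solution_def\<close>)
qed

text \<open>\<open>exp_reduction\<close> with both signs of the exponent; at \<omega> it expresses
  the final data, which enter the discriminant, by moments of \<open>y\<close>.\<close>

lemma schroedinger_solution_volterra:
  assumes \<omega>: "0 < \<omega>" and V: "integrable (Leb \<omega>) V" and r: "r \<noteq> 0"
    and y: "schroedinger_solution \<omega> V (r\<^sup>2) y y'"
  defines "\<alpha> \<equiv> y' 0 + \<i> * r * y 0" and "\<beta> \<equiv> y' 0 - \<i> * r * y 0"
  shows "volterra_solution \<omega> V r \<alpha> \<beta> y"
    and "exp (- \<i> * r * of_real \<omega>) * (y' \<omega> + \<i> * r * y \<omega>) = \<alpha> + (LINT t|Leb \<omega>. exp (- \<i> * r * of_real t) * (V t * y t))"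
    and "exp (\<i> * r * of_real \<omega>) * (y' \<omega> - \<i> * r * y \<omega>) = \<beta> + (LINT t|Leb \<omega>. exp (\<i> * r * of_real t) * (V t * y t))"
proof -
  have ac: "ac_derivative_on \<omega> y y'"
    and der: "AE x in Leb \<omega>. \<exists>\<psi>''. (y' has_vector_derivative \<psi>'') (at x) \<and> - \<psi>'' + V x * y x = r\<^sup>2 * y x"
    using y by (auto simp: schroedinger_solution_def)
  have cy: "continuous_on {0..\<omega>} y"
    using ac by (auto simp: ac_derivative_on_def intro: abs_continuous_on_imp_continuous_on)
  have Vy: "integrable (Leb \<omega>) (\<lambda>t. V t * y t)"
    using integrable_continuous_mult[OF cy V] by (simp add: mult.commute)
  have der': "AE x in Leb \<omega>. (y' has_vector_derivative (V x * y x - r\<^sup>2 * y x)) (at x)"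
    using der
  proof eventually_elim
    case (elim x)
    then obtain d where d: "(y' has_vector_derivative d) (at x)" "- d + V x * y x = r\<^sup>2 * y x" by blast
    then have "d = V x * y x - r\<^sup>2 * y x" by (simp add: algebra_simps)
    then show ?case using d by simp
  qed
  have k: "(\<i> * r)\<^sup>2 = - (r\<^sup>2)" "(- \<i> * r)\<^sup>2 = - (r\<^sup>2)" by (simp_all add: power_mult_distrib)
  let ?q = "\<lambda>t. V t * y t"
  have p: "exp (- \<i> * r * of_real x) * (y' x + \<i> * r * y x) = \<alpha> + exp_moment \<omega> (- \<i> * r) ?q x"
    and m: "exp (\<i> * r * of_real x) * (y' x - \<i> * r * y x) = \<beta> + exp_moment \<omega> (\<i> * r) ?q x"
    if "x \<in> {0..\<omega>}" for x
    using exp_reduction[OF \<omega> ac Vy der' k(1) that] exp_reduction[OF \<omega> ac Vy der' k(2) that]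
    by (simp_all add: \<alpha>_def \<beta>_def)
  show "exp (- \<i> * r * of_real \<omega>) * (y' \<omega> + \<i> * r * y \<omega>) = \<alpha> + (LINT t|Leb \<omega>. exp (- \<i> * r * of_real t) * (V t * y t))"
    "exp (\<i> * r * of_real \<omega>) * (y' \<omega> - \<i> * r * y \<omega>) = \<beta> + (LINT t|Leb \<omega>. exp (\<i> * r * of_real t) * (V t * y t))"
    using p[of \<omega>] m[of \<omega>] \<omega> by (simp_all add: exp_moment_end)
  show "volterra_solution \<omega> V r \<alpha> \<beta> y"
  proof (rule volterra_solutionI[OF Vy r])
    fix x assume x: "x \<in> {0..\<omega>}"
    define e where "e = exp (\<i> * r * complex_of_real x)"
    have e: "e \<noteq> 0" "exp (- \<i> * r * complex_of_real x) = inverse e" by (simp_all add: e_def exp_minus)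
    have p': "y' x + \<i> * r * y x = e * (\<alpha> + exp_moment \<omega> (- \<i> * r) ?q x)"
      using p[OF x] e(1) unfolding e(2) by (simp add: field_simps)
    have m': "y' x - \<i> * r * y x = inverse e * (\<beta> + exp_moment \<omega> (\<i> * r) ?q x)"
      using m[OF x] e(1) unfolding e_def[symmetric] by (simp add: field_simps)
    have "2 * \<i> * r * y x = e * (\<alpha> + exp_moment \<omega> (- \<i> * r) ?q x) - inverse e * (\<beta> + exp_moment \<omega> (\<i> * r) ?q x)"
      unfolding p'[symmetric] m'[symmetric] by simp
    then have "y x = (e * (\<alpha> + exp_moment \<omega> (- \<i> * r) ?q x) - inverse e * (\<beta> + exp_moment \<omega> (\<i> * r) ?q x)) / (2 * \<i> * r)"
      using r by (simp add: field_simps)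
    then show "y x = (\<alpha> * exp (\<i> * r * of_real x) - \<beta> * exp (- \<i> * r * of_real x)) / (2 * \<i> * r)
      + (LINT t|Leb \<omega>. (if t < x then free_kernel r x t * V t * y t else 0))"
      unfolding mult.assoc[of "free_kernel r x _"] integral_free_kernel[OF Vy r] e(2) e_def[symmetric]
      by (simp add: algebra_simps add_divide_distrib diff_divide_distrib)
  qed
qed

lemma volterra_forward_solution:
  assumes r: "r \<noteq> 0" and \<phi>: "volterra_forward \<omega> V r \<kappa> \<phi>"
    and \<kappa>: "\<And>x. exp (\<kappa> * complex_of_real x) = (\<alpha> * exp (\<i> * r * of_real x) - \<beta> * exp (- \<i> * r * of_real x)) / (2 * \<i> * r)"
  shows "volterra_solution \<omega> V r \<alpha> \<beta> \<phi>"
proof (rule volterra_solutionI[OF _ r])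
  show "integrable (Leb \<omega>) (\<lambda>t. V t * \<phi> t)" using \<phi> by (simp add: volterra_forward_def)
  fix x assume x: "x \<in> {0..\<omega>}"
  have "\<phi> x = exp (\<kappa> * of_real x) + (LINT x'|lebesgue_on {0<..<x}. free_kernel r x x' * V x' * \<phi> x')"
    using \<phi> x by (simp add: volterra_forward_def)
  then show "\<phi> x = (\<alpha> * exp (\<i> * r * of_real x) - \<beta> * exp (- \<i> * r * of_real x)) / (2 * \<i> * r)
      + (LINT t|Leb \<omega>. (if t < x then free_kernel r x t * V t * \<phi> t else 0))"
    unfolding \<kappa> integral_restrict_lessThan[OF x] .
qed

text \<open>The integral to the right of \<open>x\<close> is the full one minus the forward one. By
  \<open>integral_free_kernel\<close> the full one is a combination of the two exponentials, so it
  only shifts the coefficients, to values that contain moments of \<psi> itself.\<close>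

lemma volterra_backward_solution:
  assumes \<omega>: "0 < \<omega>" and r: "r \<noteq> 0" and \<psi>: "volterra_backward \<omega> V r \<kappa> \<psi>"
    and \<kappa>: "\<And>x. exp (\<kappa> * complex_of_real x) = (\<alpha> * exp (\<i> * r * of_real x) - \<beta> * exp (- \<i> * r * of_real x)) / (2 * \<i> * r)"
  shows "volterra_solution \<omega> V r (\<alpha> - (LINT t|Leb \<omega>. exp (- \<i> * r * of_real t) * (V t * \<psi> t)))
    (\<beta> - (LINT t|Leb \<omega>. exp (\<i> * r * of_real t) * (V t * \<psi> t))) \<psi>"
proof (rule volterra_solutionI[OF _ r])
  show Vy: "integrable (Leb \<omega>) (\<lambda>t. V t * \<psi> t)" using \<psi> by (simp add: volterra_backward_def)
  fix x assume x: "x \<in> {0..\<omega>}"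
  let ?f = "\<lambda>t. free_kernel r x t * (V t * \<psi> t)"
  have fi: "integrable (Leb \<omega>) ?f"
    using r by (auto simp: free_kernel_def intro!: integrable_continuous_mult Vy continuous_intros)
  have "\<psi> x = exp (\<kappa> * of_real x) - (LINT x'|lebesgue_on {x<..<\<omega>}. free_kernel r x x' * V x' * \<psi> x')"
    using \<psi> x by (simp add: volterra_backward_def)
  moreover have "(LINT x'|lebesgue_on {x<..<\<omega>}. free_kernel r x x' * V x' * \<psi> x')
    = (LINT t|Leb \<omega>. (if t < \<omega> then ?f t else 0)) - (LINT t|Leb \<omega>. (if t < x then ?f t else 0))"
  proof -
    have "(LINT x'|lebesgue_on {x<..<\<omega>}. free_kernel r x x' * V x' * \<psi> x') = (LINT t|lebesgue. indicator {x<..<\<omega>} t *\<^sub>R ?f t)"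
      unfolding mult.assoc by (rule integral_restrict_space) simp
    also have "\<dots> = (LINT t|lebesgue. indicator {0<..<\<omega>} t *\<^sub>R ((if t < \<omega> then ?f t else 0) - (if t < x then ?f t else 0)))"
    proof (intro Bochner_Integration.integral_cong refl)
      fix t
      show "indicator {x<..<\<omega>} t *\<^sub>R ?f t = indicator {0<..<\<omega>} t *\<^sub>R ((if t < \<omega> then ?f t else 0) - (if t < x then ?f t else 0))"
        \<comment> \<open>The two sides cut differently at the point \<open>x\<close>, but the
          kernel vanishes there.\<close>
        using x by (cases "t = x") (auto simp: indicator_def free_kernel_def)
    qed
    also have "\<dots> = (LINT t|Leb \<omega>. (if t < \<omega> then ?f t else 0) - (if t < x then ?f t else 0))"
      by (rule integral_restrict_space[symmetric]) simp
    also have "\<dots> = (LINT t|Leb \<omega>. (if t < \<omega> then ?f t else 0)) - (LINT t|Leb \<omega>. (if t < x then ?f t else 0))"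
      by (intro Bochner_Integration.integral_diff integrable_lessThan fi)
    finally show ?thesis .
  qed
  ultimately have "\<psi> x = exp (\<kappa> * of_real x) - ((LINT t|Leb \<omega>. (if t < \<omega> then ?f t else 0)) - (LINT t|Leb \<omega>. (if t < x then ?f t else 0)))"
    by simp
  then show "\<psi> x = ((\<alpha> - (LINT t|Leb \<omega>. exp (- \<i> * r * of_real t) * (V t * \<psi> t))) * exp (\<i> * r * of_real x)
      - (\<beta> - (LINT t|Leb \<omega>. exp (\<i> * r * of_real t) * (V t * \<psi> t))) * exp (- \<i> * r * of_real x)) / (2 * \<i> * r)
      + (LINT t|Leb \<omega>. (if t < x then free_kernel r x t * V t * \<psi> t else 0))"
    unfolding \<kappa> integral_free_kernel[OF Vy r, of \<omega>] exp_moment_end mult.assoc[of "free_kernel r x _"]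
    by (simp add: algebra_simps add_divide_distrib diff_divide_distrib)
qed

section \<open>Wronskian and the algebra of the moments\<close>

lemma wronskian_constant:
  assumes \<omega>: "0 < \<omega>" and c: "schroedinger_solution \<omega> V z c c'" and s: "schroedinger_solution \<omega> V z s s'"
  shows "c \<omega> * s' \<omega> - c' \<omega> * s \<omega> = c 0 * s' 0 - c' 0 * s 0"
proof -
  have acc: "abs_continuous_on 0 \<omega> c" "abs_continuous_on 0 \<omega> c'" "abs_continuous_on 0 \<omega> s" "abs_continuous_on 0 \<omega> s'"
    and dc: "\<And>x. x \<in> {0..\<omega>} \<Longrightarrow> (c has_vector_derivative c' x) (at x within {0..\<omega>})"
    and ds: "\<And>x. x \<in> {0..\<omega>} \<Longrightarrow> (s has_vector_derivative s' x) (at x within {0..\<omega>})"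
    and c2: "AE x in Leb \<omega>. \<exists>\<psi>''. (c' has_vector_derivative \<psi>'') (at x) \<and> - \<psi>'' + V x * c x = z * c x"
    and s2: "AE x in Leb \<omega>. \<exists>\<psi>''. (s' has_vector_derivative \<psi>'') (at x) \<and> - \<psi>'' + V x * s x = z * s x"
    using c s by (auto simp: schroedinger_solution_def ac_derivative_on_def)
  \<comment> \<open>The difference is written as a sum with the factor -1 to fit the closure rules
    for absolute continuity.\<close>
  define W where "W x = c x * s' x + (-1) * (c' x * s x)" for x
  have "abs_continuous_on 0 \<omega> (\<lambda>x. -1)" by (rule abs_continuous_on_lipschitz[of _ _ _ 0]) simp
  then have AC: "abs_continuous_on 0 \<omega> W"
    unfolding W_def by (intro abs_continuous_on_add abs_continuous_on_mult acc)
  have "AE x in Leb \<omega>. x \<in> space (Leb \<omega>)" by (rule AE_space)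
  with c2 s2 have der: "AE x in Leb \<omega>. (W has_vector_derivative 0) (at x)"
  proof eventually_elim
    case (elim x)
    have x: "x \<in> interior {0..\<omega>}" "x \<in> {0..\<omega>}" using elim(3) by auto
    obtain d1 d2 where d1: "(c' has_vector_derivative d1) (at x)" "- d1 + V x * c x = z * c x"
      and d2: "(s' has_vector_derivative d2) (at x)" "- d2 + V x * s x = z * s x" using elim(1,2) by blast
    have dcx: "(c has_vector_derivative c' x) (at x)" using dc[OF x(2)] unfolding at_within_interior[OF x(1)] .
    have dsx: "(s has_vector_derivative s' x) (at x)" using ds[OF x(2)] unfolding at_within_interior[OF x(1)] .
    have "(W has_vector_derivative (c x * d2 + c' x * s' x) + (-1) * (c' x * s' x + d1 * s x)) (at x)"
      unfolding W_def
      by (intro has_vector_derivative_add has_vector_derivative_mult_right has_vector_derivative_mult dcx dsx d1(1) d2(1))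
    moreover have "d1 = V x * c x - z * c x" "d2 = V x * s x - z * s x"
      using d1(2) d2(2) by (simp_all add: algebra_simps)
    ultimately show ?case by (simp add: algebra_simps)
  qed
  have "W \<omega> - W 0 = (LINT t|Leb \<omega>. (if t < \<omega> then 0 else 0))"
    by (rule ftc_lessThan[OF \<omega> AC der]) (use \<omega> in auto)
  then show ?thesis by (simp add: W_def)
qed

text \<open>By uniqueness \<open>y\<close> is the combination of \<open>yp\<close> and
  \<open>ym\<close> with the coefficients that \<alpha> and \<beta> prescribe, so every moment
  reduces to those of the two forward solutions.\<close>

lemma volterra_solution_moment:
  fixes \<kappa> :: complex
  assumes \<omega>: "0 < \<omega>" and V: "integrable (Leb \<omega>) V" and r: "r \<noteq> 0"
    and p: "volterra_solution \<omega> V r (2 * \<i> * r) 0 yp" and m: "volterra_solution \<omega> V r 0 (- 2 * \<i> * r) ym"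
    and y: "volterra_solution \<omega> V r \<alpha> \<beta> y"
  shows "(LINT t|Leb \<omega>. exp (\<kappa> * of_real t) * V t * y t)
    = \<alpha> * ((LINT t|Leb \<omega>. exp (\<kappa> * of_real t) * V t * yp t) / (2 * \<i> * r))
      - \<beta> * ((LINT t|Leb \<omega>. exp (\<kappa> * of_real t) * V t * ym t) / (2 * \<i> * r))"
proof -
  define A where "A = \<alpha> / (2 * \<i> * r)"
  define B where "B = - \<beta> / (2 * \<i> * r)"
  have AB: "A * (2 * \<i> * r) + B * 0 = \<alpha>" "A * 0 + B * (- 2 * \<i> * r) = \<beta>"
    using r by (simp_all add: A_def B_def)
  have y_eq: "y t = A * yp t + B * ym t" if "t \<in> {0..\<omega>}" for t
    by (rule volterra_solution_unique[OF \<omega> V r y volterra_solution_linear[OF r p m, of A B, unfolded AB] that])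
  have i: "integrable (Leb \<omega>) (\<lambda>t. exp (\<kappa> * of_real t) * (V t * w t))"
    if "integrable (Leb \<omega>) (\<lambda>t. V t * w t)" for w
    by (intro integrable_continuous_mult that continuous_intros)
  have ip: "integrable (Leb \<omega>) (\<lambda>t. exp (\<kappa> * of_real t) * V t * yp t)"
    and im: "integrable (Leb \<omega>) (\<lambda>t. exp (\<kappa> * of_real t) * V t * ym t)"
    using i[of yp] i[of ym] p m by (auto simp: volterra_solution_def mult.assoc)
  have "(LINT t|Leb \<omega>. exp (\<kappa> * of_real t) * V t * y t)
    = (LINT t|Leb \<omega>. A * (exp (\<kappa> * of_real t) * V t * yp t) + B * (exp (\<kappa> * of_real t) * V t * ym t))"
    by (rule Bochner_Integration.integral_cong[OF refl]) (simp add: y_eq algebra_simps)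
  also have "\<dots> = A * (LINT t|Leb \<omega>. exp (\<kappa> * of_real t) * V t * yp t) + B * (LINT t|Leb \<omega>. exp (\<kappa> * of_real t) * V t * ym t)"
    by (subst Bochner_Integration.integral_add) (auto intro!: integrable_mult_right ip im simp del: integrable_mult_right_iff)
  finally show ?thesis by (simp add: A_def B_def)
qed

text \<open>Here \<open>k = \<i> * r\<close>, while \<open>e\<close> and \<open>E\<close> are the
  exponentials with rates \<open>k\<close> and \<open>- k\<close> at \<omega>. There
  \<open>\<phi>\<^sub>p\<close> has the value \<open>x * e - p * E\<close> and
  \<open>\<phi>\<^sub>m\<close> the value \<open>m * e + y * E\<close>: the first identity says that
  this transfer matrix has determinant one, the second that \<open>e * x + E * y\<close> is the
  trace of the monodromy, twice the discriminant.\<close>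

lemma monodromy_identities:
  fixes k E e x y p m cw cw' sw sw' :: complex
  assumes k: "k \<noteq> 0" and E: "E * e = 1"
    and c: "E * (cw' + k * cw) = k * (x + m)" "e * (cw' - k * cw) = k * (p - y)"
    and s: "E * (sw' + k * sw) = x - m" "e * (sw' - k * sw) = y + p"
    and W: "cw * sw' - cw' * sw = 1"
  shows "x * y + p * m = 1" and "cw + sw' = e * x + E * y"
proof -
  have inv: "w = e * t" if "E * w = t" for w t using that E by (metis mult.assoc mult.commute mult_1)
  have inv': "w = E * t" if "e * w = t" for w t using that E by (metis mult.assoc mult.commute mult_1)
  note 1 = inv[OF c(1)] and 2 = inv'[OF c(2)] and 3 = inv[OF s(1)] and 4 = inv'[OF s(2)]
  have cw: "2 * k * cw = e * (k * (x + m)) - E * (k * (p - y))" and cw': "2 * cw' = e * (k * (x + m)) + E * (k * (p - y))"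
    and sw: "2 * k * sw = e * (x - m) - E * (y + p)" and sw': "2 * sw' = e * (x - m) + E * (y + p)"
    unfolding 1[symmetric] 2[symmetric] 3[symmetric] 4[symmetric] by (simp_all add: algebra_simps)
  have "4 * k = 4 * k * (cw * sw' - cw' * sw)" by (simp add: W)
  also have "\<dots> = (2 * k * cw) * (2 * sw') - (2 * cw') * (2 * k * sw)" by (simp add: algebra_simps)
  also have "\<dots> = 4 * k * (E * e) * (x * y + p * m)"
    unfolding cw cw' sw sw' by (simp add: algebra_simps)
  finally show "x * y + p * m = 1" using k E by simp
  have "2 * k * (cw + sw') = 2 * k * cw + k * (2 * sw')" by (simp add: algebra_simps)
  also have "\<dots> = 2 * k * (e * x + E * y)" unfolding cw sw' by (simp add: algebra_simps)
  finally have "2 * k * (cw + sw') = 2 * k * (e * x + E * y)" .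
  then show "cw + sw' = e * x + E * y" using k by simp
qed

text \<open>The moments \<open>q1\<close>, \<open>q2\<close> of \<open>\<psi>\<^sub>p\<close> and
  \<open>r1\<close>, \<open>r2\<close> of \<open>\<psi>\<^sub>m\<close> solve linear systems of size
  two with determinant \<open>x * y + p * m = 1\<close> up to sign; the identities below are
  Cramer's rule.\<close>

lemma backward_moments:
  fixes x y p m q1 q2 r1 r2 :: complex
  assumes W: "x * y + p * m = 1"
    and 1: "q1 = (1 - q1) * (x - 1) + q2 * m" and 2: "q2 = (1 - q1) * p + q2 * (1 - y)"
    and 3: "r2 = (- r2) * (x - 1) + (1 + r1) * m" and 4: "r1 = (- r2) * p + (1 + r1) * (1 - y)"
  shows "q1 = 1 - y" "q2 = p" "r1 = x - 1" "r2 = m"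
proof -
  have e1: "(1 - q1) * x + q2 * m = 1" and e2: "q2 * y = (1 - q1) * p"
    and e3: "- r2 * x + (1 + r1) * m = 0" and e4: "(1 + r1) * y = 1 - r2 * p"
    using 1 2 3 4 by (simp_all add: algebra_simps)
  have "1 - q1 = (1 - q1) * (x * y + p * m)" by (simp add: W)
  also have "\<dots> = ((1 - q1) * x + q2 * m) * y - m * (q2 * y - (1 - q1) * p)" by (simp add: algebra_simps)
  finally have q1: "1 - q1 = y" by (simp add: e1 e2)
  then show "q1 = 1 - y" by (simp add: algebra_simps)
  have "q2 = q2 * (x * y + p * m)" by (simp add: W)
  also have "\<dots> = ((1 - q1) * x + q2 * m) * p + x * (q2 * y - (1 - q1) * p)" by (simp add: algebra_simps)
  finally show "q2 = p" by (simp add: e1 e2)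
  have "1 + r1 = (1 + r1) * (x * y + p * m)" by (simp add: W)
  also have "\<dots> = (- r2 * x + (1 + r1) * m) * p + x * ((1 + r1) * y - (1 - r2 * p)) + x" by (simp add: algebra_simps)
  finally have "1 + r1 = x" by (simp only: e3 e4) simp
  then show "r1 = x - 1" by (simp add: algebra_simps)
  have "r2 = r2 * (x * y + p * m)" by (simp add: W)
  also have "\<dots> = - (- r2 * x + (1 + r1) * m) * y + m * ((1 + r1) * y - (1 - r2 * p)) + m" by (simp add: algebra_simps)
  finally show "r2 = m" by (simp only: e3 e4) simp
qed

text \<open>The quotient is expanded by \<open>2 * E\<close>; with \<open>a = \<rho> * E\<close> and
  \<open>b = \<rho>' * E\<close> its denominator becomes \<open>(a - 1) * (b - 1)\<close>.\<close>

lemma floquet_quotient: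
  fixes E e \<rho> \<rho>' x y :: complex
  assumes E: "E * e = 1" and \<rho>: "\<rho> * \<rho>' = 1" and a: "a = \<rho> * E" "a \<noteq> 1" and b: "b = \<rho>' * E" "b \<noteq> 1"
  shows "((e * x + E * y) / 2 - (\<rho> + \<rho>') / 2) / ((e + E) / 2 - (\<rho> + \<rho>') / 2)
    = (E\<^sup>2 * y - E * (\<rho> + \<rho>') + x) / ((a - 1) * (b - 1))"
proof -
  have half: "u / 2 - v / 2 = (u - v) / 2" "u / 2 / (v / 2) = u / v" for u v :: complex
    by (simp_all add: diff_divide_distrib)
  have "(a - 1) * (b - 1) = E * E * (\<rho> * \<rho>') - E * (\<rho> + \<rho>') + E * e"
    unfolding a(1) b(1) E by (simp add: algebra_simps)
  then have d: "(a - 1) * (b - 1) = E * ((e + E) - (\<rho> + \<rho>'))" unfolding \<rho> by (simp add: algebra_simps)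
  have "E\<^sup>2 * y - E * (\<rho> + \<rho>') + x = E\<^sup>2 * y - E * (\<rho> + \<rho>') + (E * e) * x" by (simp add: E)
  then have n: "E\<^sup>2 * y - E * (\<rho> + \<rho>') + x = E * ((e * x + E * y) - (\<rho> + \<rho>'))"
    by (simp add: algebra_simps power2_eq_square)
  have "E \<noteq> 0" using E by auto
  then show ?thesis unfolding d n half by simp
qed

text \<open>Over the common denominator the numerator is
  \<open>(a - x) * (b * y - 1) - b * p * m\<close>. Its quadratic terms combine to
  \<open>- \<rho>' * E * (x * y + p * m)\<close>, which the determinant identity frees of
  moments.\<close>

lemma forward_form:
  fixes E \<rho> \<rho>' x y p m :: complex
  assumes W: "x * y + p * m = 1" and \<rho>: "\<rho> * \<rho>' = 1" and a: "a = \<rho> * E" "a \<noteq> 1" and b: "b = \<rho>' * E" "b \<noteq> 1"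
  shows "(1 - 1 / (a - 1) * (x - 1)) * (1 - b / (b - 1) * (1 - y)) - b / ((a - 1) * (b - 1)) * p * m
    = (E\<^sup>2 * y - E * (\<rho> + \<rho>') + x) / ((a - 1) * (b - 1))"
proof -
  have "E\<^sup>2 * y - E * (\<rho> + \<rho>') + x = (a - x) * (b * y - 1) - b * p * m"
  proof -
    have "(a - x) * (b * y - 1) - b * p * m = (\<rho> * \<rho>') * E\<^sup>2 * y - \<rho> * E - \<rho>' * E * (x * y + p * m) + x"
      unfolding a(1) b(1) by (simp add: algebra_simps power2_eq_square)
    then show ?thesis unfolding W \<rho> by (simp add: algebra_simps)
  qed
  moreover have "1 - (x - 1) / (a - 1) = (a - x) / (a - 1)" "1 - b * (1 - y) / (b - 1) = (b * y - 1) / (b - 1)"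
    using a(2) b(2) by (simp_all add: field_simps)
  ultimately show ?thesis by (simp add: diff_divide_distrib[of "(a - x) * (b * y - 1)"])
qed

text \<open>The counterpart of \<open>forward_form\<close> with \<open>a\<close> and
  \<open>b\<close> exchanged, under which the right-hand side is symmetric. By
  \<open>backward_moments\<close>, \<open>1 - y\<close> and \<open>x - 1\<close> are now moments of
  the backward solutions.\<close>

lemma backward_form:
  fixes E \<rho> \<rho>' x y p m :: complex
  assumes W: "x * y + p * m = 1" and \<rho>: "\<rho> * \<rho>' = 1" and a: "a = \<rho> * E" "a \<noteq> 1" and b: "b = \<rho>' * E" "b \<noteq> 1"
  shows "(1 - a / (a - 1) * (1 - y)) * (1 - 1 / (b - 1) * (x - 1)) - a / ((a - 1) * (b - 1)) * p * m
    = (E\<^sup>2 * y - E * (\<rho> + \<rho>') + x) / ((a - 1) * (b - 1))"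
proof -
  have "E\<^sup>2 * y - E * (\<rho> + \<rho>') + x = (a * y - 1) * (b - x) - a * p * m"
  proof -
    have "(a * y - 1) * (b - x) - a * p * m = (\<rho> * \<rho>') * E\<^sup>2 * y - \<rho>' * E - \<rho> * E * (x * y + p * m) + x"
      unfolding a(1) b(1) by (simp add: algebra_simps power2_eq_square)
    then show ?thesis unfolding W \<rho> by (simp add: algebra_simps)
  qed
  moreover have "1 - (x - 1) / (b - 1) = (b - x) / (b - 1)" "1 - a * (1 - y) / (a - 1) = (a * y - 1) / (a - 1)"
    using a(2) b(2) by (simp_all add: field_simps)
  ultimately show ?thesis by (simp add: diff_divide_distrib[of "(a * y - 1) * (b - x)"])
qed

theorem theorem4p10:
  fixes \<omega> \<theta> :: real and V :: "real \<Rightarrow> complex" and z r :: complex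
    and c c' s s' \<phi>\<^sub>p \<phi>\<^sub>m \<psi>\<^sub>p \<psi>\<^sub>m :: "real \<Rightarrow> complex"
  assumes "\<omega> > 0"
    and "integrable (Leb \<omega>) V"
    and "0 \<le> \<theta>" and "\<theta> < 2 * pi"
    and "z \<notin> op_spectrum \<omega> (H0 \<omega> \<theta>)" and "z \<noteq> 0"
    and "r\<^sup>2 = z" and "Im r \<ge> 0"
    and "schroedinger_solution \<omega> V z c c'" and "c 0 = 1" and "c' 0 = 0"
    and "schroedinger_solution \<omega> V z s s'" and "s 0 = 0" and "s' 0 = 1"
    and "volterra_forward \<omega> V r (\<i> * r) \<phi>\<^sub>p"
    and "volterra_forward \<omega> V r (- \<i> * r) \<phi>\<^sub>m"
    and "volterra_backward \<omega> V r (\<i> * r) \<psi>\<^sub>p"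
    and "volterra_backward \<omega> V r (- \<i> * r) \<psi>\<^sub>m"
  shows
    "let \<Delta> = (c \<omega> + s' \<omega>) / 2;
         a = exp (\<i> * of_real \<theta>) * exp (- \<i> * r * of_real \<omega>);
         b = exp (- \<i> * of_real \<theta>) * exp (- \<i> * r * of_real \<omega>);
         D = (\<Delta> - cos (of_real \<theta>)) / (cos (r * of_real \<omega>) - cos (of_real \<theta>))
     in has_fredholm_det \<omega> (K_op \<omega> \<theta> V z) D
      \<and> D = (1 + \<i> / (2 * r) * (a / (a - 1))
                 * (LINT x|Leb \<omega>. exp (- \<i> * r * of_real x) * V x * \<psi>\<^sub>p x))
            * (1 + \<i> / (2 * r) * (1 / (b - 1))
                 * (LINT x|Leb \<omega>. exp (\<i> * r * of_real x) * V x * \<psi>\<^sub>m x))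
            + 1 / (4 * z) * (a / ((a - 1) * (b - 1)))
                 * (LINT x|Leb \<omega>. exp (\<i> * r * of_real x) * V x * \<psi>\<^sub>p x)
                 * (LINT x|Leb \<omega>. exp (- \<i> * r * of_real x) * V x * \<psi>\<^sub>m x)
      \<and> D = (1 + \<i> / (2 * r) * (1 / (a - 1))
                 * (LINT x|Leb \<omega>. exp (- \<i> * r * of_real x) * V x * \<phi>\<^sub>p x))
            * (1 + \<i> / (2 * r) * (b / (b - 1))
                 * (LINT x|Leb \<omega>. exp (\<i> * r * of_real x) * V x * \<phi>\<^sub>m x))
            + 1 / (4 * z) * (b / ((a - 1) * (b - 1)))
                 * (LINT x|Leb \<omega>. exp (\<i> * r * of_real x) * V x * \<phi>\<^sub>p x)
                 * (LINT x|Leb \<omega>. exp (- \<i> * r * of_real x) * V x * \<phi>\<^sub>m x)"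
proof -
  define a where "a = exp (\<i> * complex_of_real \<theta>) * exp (- \<i> * r * of_real \<omega>)"
  define b where "b = exp (- \<i> * complex_of_real \<theta>) * exp (- \<i> * r * of_real \<omega>)"
  note \<omega> = assms(1) and V = assms(2)
  have r: "r \<noteq> 0" using \<open>r\<^sup>2 = z\<close> \<open>z \<noteq> 0\<close> by auto
  interpret birman_schwinger \<omega> \<theta> V r a b
    by unfold_locales (use assms(5,7) in \<open>simp_all add: \<omega> V r a_def b_def\<close>)
  define k where "k = \<i> * r"
  have k: "k \<noteq> 0" and fk: "\<i> / (2 * r) = - (1 / (2 * k))" and zk: "1 / (4 * z) = - (1 / (2 * k) * (1 / (2 * k)))"
    using r by (simp_all add: k_def power2_eq_square field_simps flip: \<open>r\<^sup>2 = z\<close>)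
  have fp: "volterra_solution \<omega> V r (2 * \<i> * r) 0 \<phi>\<^sub>p"
    by (rule volterra_forward_solution[OF r assms(15)]) (use r in simp)
  have fm: "volterra_solution \<omega> V r 0 (- 2 * \<i> * r) \<phi>\<^sub>m"
    by (rule volterra_forward_solution[OF r assms(16)]) (use r in simp)
  \<comment> \<open>Division by \<open>2 * k\<close> absorbs the prefactors
    \<open>\<i> / (2 * r)\<close> and \<open>1 / (4 * z)\<close> up to sign, see \<open>fk\<close>
    and \<open>zk\<close>.\<close>
  define M where "M \<kappa> y = (LINT t|Leb \<omega>. exp (\<kappa> * of_real t) * V t * y t) / (2 * k)" for \<kappa> and y :: "real \<Rightarrow> complex"
  have moment: "M \<kappa> y = \<alpha> / (2 * k) * M \<kappa> \<phi>\<^sub>p - \<beta> / (2 * k) * M \<kappa> \<phi>\<^sub>m"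
    if "volterra_solution \<omega> V r \<alpha> \<beta> y" for \<kappa> \<alpha> \<beta> y
    unfolding M_def volterra_solution_moment[OF \<omega> V r fp fm that]
    by (simp add: k_def mult.assoc diff_divide_distrib)
  have int: "(LINT t|Leb \<omega>. exp (\<kappa> * of_real t) * V t * y t) = 2 * k * M \<kappa> y" for \<kappa> y
    using k by (simp add: M_def)
  define x where "x = 1 + M (- k) \<phi>\<^sub>p"
  define y where "y = 1 - M k \<phi>\<^sub>m"
  define p where "p = M k \<phi>\<^sub>p"
  define m where "m = M (- k) \<phi>\<^sub>m"
  define E where "E = exp (- k * of_real \<omega>)"
  define e where "e = exp (k * of_real \<omega>)"
  have Ee: "E * e = 1" by (simp add: E_def e_def exp_minus)
  note sc = schroedinger_solution_volterra[OF \<omega> V r assms(9)[folded \<open>r\<^sup>2 = z\<close>], unfolded assms(10,11), folded mult.assoc]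
    and ss = schroedinger_solution_volterra[OF \<omega> V r assms(12)[folded \<open>r\<^sup>2 = z\<close>], unfolded assms(13,14), folded mult.assoc]
  have km: "- \<i> * r = - k" "\<i> * r = k" by (simp_all add: k_def)
  have Mc: "2 * M \<kappa> c = M \<kappa> \<phi>\<^sub>p + M \<kappa> \<phi>\<^sub>m" for \<kappa>
    using moment[OF sc(1), of \<kappa>] k by (simp add: km)
  have Ms: "2 * k * M \<kappa> s = M \<kappa> \<phi>\<^sub>p - M \<kappa> \<phi>\<^sub>m" for \<kappa>
    using moment[OF ss(1), of \<kappa>] k by (simp add: km field_simps)
  have "E * (c' \<omega> + k * c \<omega>) = k + k * (2 * M (- k) c)" "e * (c' \<omega> - k * c \<omega>) = - k + k * (2 * M k c)"
    using sc(2,3) unfolding km int by (simp_all add: E_def e_def)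
  then have c1: "E * (c' \<omega> + k * c \<omega>) = k * (x + m)" and c2: "e * (c' \<omega> - k * c \<omega>) = k * (p - y)"
    unfolding Mc by (simp_all add: x_def y_def p_def m_def algebra_simps)
  have "E * (s' \<omega> + k * s \<omega>) = 1 + 2 * k * M (- k) s" "e * (s' \<omega> - k * s \<omega>) = 1 + 2 * k * M k s"
    using ss(2,3) unfolding km int by (simp_all add: E_def e_def)
  then have s1: "E * (s' \<omega> + k * s \<omega>) = x - m" and s2: "e * (s' \<omega> - k * s \<omega>) = y + p"
    unfolding Ms by (simp_all add: x_def y_def p_def m_def algebra_simps)
  have "c \<omega> * s' \<omega> - c' \<omega> * s \<omega> = 1"
    using wronskian_constant[OF \<omega> assms(9,12)] by (simp add: assms)
  note W = monodromy_identities[OF k Ee c1 c2 s1 s2 this]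
  \<comment> \<open>The coefficients contain the unknown moments; inserting them into
    \<open>moment\<close> gives the linear systems of \<open>backward_moments\<close>.\<close>
  have gp: "volterra_solution \<omega> V r (2 * k * (1 - M (- k) \<psi>\<^sub>p)) (- 2 * k * M k \<psi>\<^sub>p) \<psi>\<^sub>p"
    using volterra_backward_solution[OF \<omega> r assms(17), of "2 * k" 0] r
    unfolding km mult.assoc[symmetric] int by (simp add: k_def algebra_simps)
  have gm: "volterra_solution \<omega> V r (- 2 * k * M (- k) \<psi>\<^sub>m) (- 2 * k * (1 + M k \<psi>\<^sub>m)) \<psi>\<^sub>m"
    using volterra_backward_solution[OF \<omega> r assms(18), of 0 "- 2 * k"] r
    unfolding km mult.assoc[symmetric] int by (simp add: k_def algebra_simps)
  have gm': "M \<kappa> \<psi>\<^sub>m = (- M (- k) \<psi>\<^sub>m) * M \<kappa> \<phi>\<^sub>p + (1 + M k \<psi>\<^sub>m) * M \<kappa> \<phi>\<^sub>m" for \<kappa>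
  proof -
    have "M \<kappa> \<psi>\<^sub>m = (- M (- k) \<psi>\<^sub>m) * M \<kappa> \<phi>\<^sub>p - (- (1 + M k \<psi>\<^sub>m)) * M \<kappa> \<phi>\<^sub>m"
      using moment[OF gm, of \<kappa>] k by simp
    then show ?thesis by (simp only: minus_mult_left[symmetric] diff_minus_eq_add)
  qed
  have "M (- k) \<psi>\<^sub>p = (1 - M (- k) \<psi>\<^sub>p) * (x - 1) + M k \<psi>\<^sub>p * m"
    "M k \<psi>\<^sub>p = (1 - M (- k) \<psi>\<^sub>p) * p + M k \<psi>\<^sub>p * (1 - y)"
    using moment[OF gp, of k] moment[OF gp, of "- k"] k by (simp_all add: x_def y_def p_def m_def)
  moreover have "M (- k) \<psi>\<^sub>m = (- M (- k) \<psi>\<^sub>m) * (x - 1) + (1 + M k \<psi>\<^sub>m) * m"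
    "M k \<psi>\<^sub>m = (- M (- k) \<psi>\<^sub>m) * p + (1 + M k \<psi>\<^sub>m) * (1 - y)"
    using gm'[of "- k"] gm'[of k] by (simp_all add: x_def y_def p_def m_def)
  ultimately have q: "M (- k) \<psi>\<^sub>p = 1 - y" "M k \<psi>\<^sub>p = p" "M k \<psi>\<^sub>m = x - 1" "M (- k) \<psi>\<^sub>m = m"
    by (rule backward_moments[OF W(1)])+
  define \<rho> where "\<rho> = exp (\<i> * complex_of_real \<theta>)"
  define \<rho>' where "\<rho>' = exp (- \<i> * complex_of_real \<theta>)"
  have \<rho>: "\<rho> * \<rho>' = 1" by (simp add: \<rho>_def \<rho>'_def exp_minus)
  have ab: "a = \<rho> * E" "b = \<rho>' * E" by (simp_all add: a_def b_def \<rho>_def \<rho>'_def E_def k_def)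
  define D where "D = ((c \<omega> + s' \<omega>) / 2 - cos (of_real \<theta>)) / (cos (r * of_real \<omega>) - cos (of_real \<theta>))"
  \<comment> \<open>The common form to which both moment formulas are reduced.\<close>
  have D: "D = (E\<^sup>2 * y - E * (\<rho> + \<rho>') + x) / ((a - 1) * (b - 1))"
    using floquet_quotient[OF Ee \<rho> ab(1) a1 ab(2) b1, of x y]
    unfolding D_def W(2) cos_exp_eq by (simp add: \<rho>_def \<rho>'_def E_def e_def k_def mult.assoc)
  have fwd: "D = (1 + \<i> / (2 * r) * (1 / (a - 1)) * (2 * k * M (- k) \<phi>\<^sub>p))
      * (1 + \<i> / (2 * r) * (b / (b - 1)) * (2 * k * M k \<phi>\<^sub>m))
      + 1 / (4 * z) * (b / ((a - 1) * (b - 1))) * (2 * k * M k \<phi>\<^sub>p) * (2 * k * M (- k) \<phi>\<^sub>m)"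
    unfolding D forward_form[OF W(1) \<rho> ab(1) a1 ab(2) b1, symmetric] fk zk
    using k by (simp add: x_def y_def p_def m_def)
  have bwd: "D = (1 + \<i> / (2 * r) * (a / (a - 1)) * (2 * k * M (- k) \<psi>\<^sub>p))
      * (1 + \<i> / (2 * r) * (1 / (b - 1)) * (2 * k * M k \<psi>\<^sub>m))
      + 1 / (4 * z) * (a / ((a - 1) * (b - 1))) * (2 * k * M k \<psi>\<^sub>p) * (2 * k * M (- k) \<psi>\<^sub>m)"
    unfolding D backward_form[OF W(1) \<rho> ab(1) a1 ab(2) b1, symmetric] fk zk q
    using k by simp
  define \<phi> where "\<phi> l = (if l = (0::nat) then \<phi>\<^sub>p else \<phi>\<^sub>m)" for l
  have cow: "(LINT t|Leb \<omega>. cowave 0 t * y t * V t) = \<i> / (2 * r) * (1 / (a - 1)) * (2 * k * M (- k) y)"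
    "(LINT t|Leb \<omega>. cowave 1 t * y t * V t) = \<i> / (2 * r) * (b / (b - 1)) * (2 * k * M k y)" for y
    unfolding int[symmetric] integral_mult_right_zero[symmetric]
    by (simp_all add: cowave_def mult_ac k_def)
  have "has_fredholm_det \<omega> (K_op \<omega> \<theta> V (r\<^sup>2))
      ((1 + (LINT t|Leb \<omega>. cowave 0 t * \<phi> 0 t * V t)) * (1 + (LINT t|Leb \<omega>. cowave 1 t * \<phi> 1 t * V t))
        - (LINT t|Leb \<omega>. cowave 0 t * \<phi> 1 t * V t) * (LINT t|Leb \<omega>. cowave 1 t * \<phi> 0 t * V t))"
  proof (rule has_fredholm_det_K)
    show "continuous_on {0..\<omega>} (\<phi> l)" "integrable (Leb \<omega>) (\<lambda>t. V t * \<phi> l t)" for l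
      using fp fm by (simp_all add: \<phi>_def volterra_solution_def)
    show "\<phi> l x = wave l x + (LINT t|Leb \<omega>. (if t < x then free_kernel r x t * V t * \<phi> l t else 0))"
      if x: "x \<in> {0..\<omega>}" for l x
      using fp fm x r by (cases "l = 0") (simp_all add: \<phi>_def volterra_solution_def wave_def cong: if_cong)
  qed
  also have "((1 + (LINT t|Leb \<omega>. cowave 0 t * \<phi> 0 t * V t)) * (1 + (LINT t|Leb \<omega>. cowave 1 t * \<phi> 1 t * V t))
        - (LINT t|Leb \<omega>. cowave 0 t * \<phi> 1 t * V t) * (LINT t|Leb \<omega>. cowave 1 t * \<phi> 0 t * V t)) = D"
  proof -
    have \<phi>: "\<phi> 0 = \<phi>\<^sub>p" "\<phi> 1 = \<phi>\<^sub>m" by (simp_all add: \<phi>_def fun_eq_iff)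
    \<comment> \<open>The determinant of size two has its off-diagonal product with a minus sign; as
      the square of \<open>\<i> / (2 * r)\<close> is \<open>- 1 / (4 * z)\<close>, it becomes the
      last term of the forward formula.\<close>
    have alg: "S - (f * \<alpha> * P) * (f * \<beta> * Q) = S + - (f * f) * (\<alpha> * \<beta>) * Q * P" for S f \<alpha> \<beta> P Q :: complex
      by (simp add: mult_ac)
    have zf: "1 / (4 * z) = - (\<i> / (2 * r) * (\<i> / (2 * r)))" and ab': "b / ((a - 1) * (b - 1)) = 1 / (a - 1) * (b / (b - 1))"
      unfolding zk fk by simp_all
    show ?thesis unfolding cow \<phi> fwd zf ab' by (rule alg)
  qed
  finally have "has_fredholm_det \<omega> (K_op \<omega> \<theta> V z) D" by (simp add: \<open>r\<^sup>2 = z\<close>)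
  then show ?thesis
    using fwd bwd unfolding Let_def D_def[symmetric] a_def b_def km int by (intro conjI)
qed

end
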